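(* Let $m,n\ge 2$ be integers, let $\Omega\subset\mathbb{R}^n$ be a bounded domain with Lipschitz boundary, let $L\in\mathbb{M}^{m\times n}\setminus\{0\}$, $t\in\mathbb{R}$, and $\Sigma_t=\{\xi\in\mathbb{M}^{m\times n} : \sum_{i,j}L_{ij}\xi_{ij}=t\}$. Assume that $$Lb\ne 0\in\mathbb{R}^m\quad\text{for all } b\in\mathbb{R}^n\setminus\{0\}.$$ Let $U$ be a bounded (relatively) open set in $\Sigma_t$, and let $v\in W^{1,\infty}(\Omega;\mathbb{R}^m)$ be a piecewise $C^1$ map satisfying $\nabla v\in U^{rc}$ a.e. in $\Omega$. Then for each $\epsilon>0$ there exists a map $u\in W^{1,\infty}(\Omega;\mathbb{R}^m)$ such that $$\nabla u\in U \ \text{ a.e. in }\Omega,\qquad u=v\ \text{ on }\partial\Omega,\qquad \|u-v\|_{L^\infty(\Omega)}<\epsilon.$$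
   Context: $\mathbb{M}^{m\times n}$ is the space of real $m\times n$ matrices. For $u:\Omega\subset\mathbb{R}^n\to\mathbb{R}^m$, $\nabla u$ is the $m\times n$ matrix with entries $\partial u^i/\partial x_j$. "$u=v$ on $\partial\Omega$" means $u\in v+W^{1,\infty}_0(\Omega;\mathbb{R}^m)$. A map $v:\Omega\to\mathbb{R}^m$ is piecewise $C^1$ if there is a sequence $\{\Omega_j\}_{j\in\mathbb{N}}$ of disjoint open subsets of $\Omega$ whose union has Lebesgue measure $|\Omega|$ and such that $v\in C^1(\bar\Omega_j;\mathbb{R}^m)$ for all $j$. A function $f:\mathbb{M}^{m\times n}\to\mathbb{R}$ is rank-one convex if $f(\lambda\xi_1+(1-\lambda)\xi_2)\le\lambda f(\xi_1)+(1-\lambda)f(\xi_2)$ for all $\xi_1,\xi_2$ with $\operatorname{rank}(\xi_1-\xi_2)=1$ and all $\lambda\in[0,1]$. For compact $K\subset\mathbb{M}^{m\times n}$, the rank-one convex hull is $$K^{rc}=\{\xi\in\mathbb{M}^{m\times n} : f(\xi)\le\sup_K f\ \text{ for all rank-one convex } f:\mathbb{M}^{m\times n}\to\mathbb{R}\},$$ and for an arbitrary set $E\subset\mathbb{M}^{m\times n}$, $E^{rc}=\bigcup\{K^{rc} : K\subset E,\ K\text{ compact}\}$. *)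

theory Defs
  imports "HOL-Analysis.Analysis" "HOL-Probability.Essential_Supremum"
begin

section \<open>Test functions\<close>

primrec Ck_on :: "nat \<Rightarrow> 'a::euclidean_space set \<Rightarrow> ('a \<Rightarrow> 'b::real_normed_vector) \<Rightarrow> bool" where
  "Ck_on 0 S f \<longleftrightarrow> continuous_on S f"
| "Ck_on (Suc k) S f \<longleftrightarrow>
     (\<forall>x\<in>S. f differentiable (at x)) \<and>
     (\<forall>b\<in>Basis. Ck_on k S (\<lambda>x. frechet_derivative f (at x) b))"

text \<open>The space of smooth functions whose support is a compact subset of \<open>\<Omega>\<close>, extended by zero
  to the whole space.\<close>

definition test_functions :: "'a::euclidean_space set \<Rightarrow> ('a \<Rightarrow> 'b::real_normed_vector) set" where
  "test_functions \<Omega> = {\<phi>. (\<forall>k. Ck_on k UNIV \<phi>) \<and>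
     compact (closure {x. \<phi> x \<noteq> 0}) \<and> closure {x. \<phi> x \<noteq> 0} \<subseteq> \<Omega>}"

section \<open>Weak gradients and Sobolev spaces\<close>

text \<open>Maps on \<open>\<Omega>\<close> are represented by total functions; every notion below depends only on the
  values on \<open>\<Omega>\<close>, and, except for piecewise smoothness, only on the class modulo null sets.\<close>

definition locally_integrable_on ::
    "('a::euclidean_space \<Rightarrow> 'b::euclidean_space) \<Rightarrow> 'a set \<Rightarrow> bool" where
  "locally_integrable_on f \<Omega> \<longleftrightarrow> (\<forall>K. compact K \<and> K \<subseteq> \<Omega> \<longrightarrow> f absolutely_integrable_on K)"

definition has_weak_gradient ::
    "(real^'n \<Rightarrow> real^'m) \<Rightarrow> (real^'n \<Rightarrow> real^'n^'m) \<Rightarrow> (real^'n) set \<Rightarrow> bool" where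
  "has_weak_gradient u G \<Omega> \<longleftrightarrow>
     locally_integrable_on u \<Omega> \<and> locally_integrable_on G \<Omega> \<and>
     (\<forall>\<phi>\<in>test_functions \<Omega>. \<forall>i j.
        (LINT x|lebesgue_on \<Omega>. u x $ i * frechet_derivative \<phi> (at x) (axis j 1)) =
        - (LINT x|lebesgue_on \<Omega>. G x $ i $ j * (\<phi> x :: real)))"

definition Linf_norm :: "'a::euclidean_space set \<Rightarrow> ('a \<Rightarrow> 'b::euclidean_space) \<Rightarrow> ereal" where
  "Linf_norm \<Omega> f = esssup (lebesgue_on \<Omega>) (\<lambda>x. ereal (norm (f x)))"

definition Linf :: "'a::euclidean_space set \<Rightarrow> ('a \<Rightarrow> 'b::euclidean_space) set" where
  "Linf \<Omega> = {f \<in> borel_measurable (lebesgue_on \<Omega>). Linf_norm \<Omega> f < \<infinity>}"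

definition W1inf :: "(real^'n) set \<Rightarrow> (real^'n \<Rightarrow> real^'m) set" where
  "W1inf \<Omega> = {u \<in> Linf \<Omega>. \<exists>G \<in> Linf \<Omega>. has_weak_gradient u G \<Omega>}"

text \<open>The closure of the test functions in the norm of \<open>W\<^sup>1\<^sup>,\<^sup>1(\<Omega>; \<real>\<^sup>m)\<close>.\<close>

definition W11_0 :: "(real^'n) set \<Rightarrow> (real^'n \<Rightarrow> real^'m) set" where
  "W11_0 \<Omega> = {u. integrable (lebesgue_on \<Omega>) u \<and>
     (\<exists>G. integrable (lebesgue_on \<Omega>) G \<and> has_weak_gradient u G \<Omega> \<and>
        (\<forall>e>0. \<exists>\<phi>\<in>test_functions \<Omega>.
           (\<integral>\<^sup>+x. ennreal (norm (u x - \<phi> x)) \<partial>lebesgue_on \<Omega>) +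
           (\<integral>\<^sup>+x. ennreal (norm (G x - jacobian \<phi> (at x))) \<partial>lebesgue_on \<Omega>) < ennreal e))}"

text \<open>The space \<open>W\<^sub>0\<^sup>1\<^sup>,\<^sup>\<infinity>\<close> is, as usual in this setting, \<open>W\<^sup>1\<^sup>,\<^sup>\<infinity> \<inter> W\<^sub>0\<^sup>1\<^sup>,\<^sup>1\<close>. It is not the norm
  closure of the test functions in \<open>W\<^sup>1\<^sup>,\<^sup>\<infinity>\<close>, which contains continuously differentiable maps only.\<close>

definition W1inf_0 :: "(real^'n) set \<Rightarrow> (real^'n \<Rightarrow> real^'m) set" where
  "W1inf_0 \<Omega> = W1inf \<Omega> \<inter> W11_0 \<Omega>"

section \<open>Domains with Lipschitz boundary\<close>

text \<open>Near each boundary point, \<open>\<Omega>\<close> is the strict epigraph of a Lipschitz function \<open>\<gamma>\<close> in rotated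
  coordinates with origin \<open>p\<close>: \<open>\<nu>\<close> is the direction of the last coordinate axis, and \<open>\<gamma>\<close> is
  defined on the hyperplane orthogonal to \<open>\<nu>\<close>, which takes the place of \<open>\<real>\<^sup>n\<^sup>-\<^sup>1\<close>.\<close>

definition lipschitz_boundary :: "'a::euclidean_space set \<Rightarrow> bool" where
  "lipschitz_boundary \<Omega> \<longleftrightarrow>
     (\<forall>p\<in>frontier \<Omega>. \<exists>r>0. \<exists>\<nu>. \<exists>C. \<exists>\<gamma>::'a \<Rightarrow> real.
        norm \<nu> = 1 \<and> C-lipschitz_on {y. \<nu> \<bullet> y = 0} \<gamma> \<and>
        \<Omega> \<inter> ball p r =
          {x \<in> ball p r. \<gamma> ((x - p) - (\<nu> \<bullet> (x - p)) *\<^sub>R \<nu>) < \<nu> \<bullet> (x - p)})"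

definition bounded_lipschitz_domain :: "'a::euclidean_space set \<Rightarrow> bool" where
  "bounded_lipschitz_domain \<Omega> \<longleftrightarrow>
     open \<Omega> \<and> connected \<Omega> \<and> \<Omega> \<noteq> {} \<and> bounded \<Omega> \<and> lipschitz_boundary \<Omega>"

section \<open>Piecewise continuously differentiable maps\<close>

text \<open>The space \<open>C\<^sup>1\<close> of the closure of an open set \<open>A\<close>: maps that are continuously differentiable
  in \<open>A\<close> and that, together with their gradient, extend continuously to the closure of \<open>A\<close>.\<close>

definition C1_closure :: "(real^'n) set \<Rightarrow> (real^'n \<Rightarrow> real^'m) \<Rightarrow> bool" where
  "C1_closure A v \<longleftrightarrow>
     (\<forall>x\<in>A. v differentiable (at x)) \<and>
     (\<exists>w. continuous_on (closure A) w \<and> (\<forall>x\<in>A. w x = v x)) \<and>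
     (\<exists>G. continuous_on (closure A) G \<and> (\<forall>x\<in>A. G x = jacobian v (at x)))"

definition piecewise_C1 :: "(real^'n) set \<Rightarrow> (real^'n \<Rightarrow> real^'m) \<Rightarrow> bool" where
  "piecewise_C1 \<Omega> v \<longleftrightarrow>
     (\<exists>A::nat \<Rightarrow> (real^'n) set. disjoint_family A \<and> (\<forall>j. open (A j) \<and> A j \<subseteq> \<Omega>) \<and>
        emeasure lebesgue (\<Union>j. A j) = emeasure lebesgue \<Omega> \<and> (\<forall>j. C1_closure (A j) v))"

section \<open>Rank-one convexity\<close>

definition rank_one_convex :: "(real^'n^'m \<Rightarrow> real) \<Rightarrow> bool" where
  "rank_one_convex f \<longleftrightarrow>
     (\<forall>\<xi>1 \<xi>2 c. rank (\<xi>1 - \<xi>2) = 1 \<and> 0 \<le> c \<and> c \<le> 1 \<longrightarrow>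
        f (c *\<^sub>R \<xi>1 + (1 - c) *\<^sub>R \<xi>2) \<le> c * f \<xi>1 + (1 - c) * f \<xi>2)"

text \<open>The supremum is taken in the extended reals, so that it is \<open>-\<infinity>\<close>, and the hull is empty,
  for empty \<open>K\<close>.\<close>

definition rc_hull_compact :: "(real^'n^'m) set \<Rightarrow> (real^'n^'m) set" where
  "rc_hull_compact K =
     {\<xi>. \<forall>f. rank_one_convex f \<longrightarrow> ereal (f \<xi>) \<le> (SUP \<eta>\<in>K. ereal (f \<eta>))}"

definition rc_hull :: "(real^'n^'m) set \<Rightarrow> (real^'n^'m) set" where
  "rc_hull E = \<Union> {rc_hull_compact K | K. K \<subseteq> E \<and> compact K}"

end

theory Submission
  imports Defs
begin

text \<open>Fix \<open>K \<subseteq> U\<close> compact and let \<open>env K\<close> be the largest function on the affine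
  space \<open>\<langle>L, \<cdot>\<rangle> = t\<close> that is convex along its rank-one segments and lies below the distance to \<open>K\<close>; let \<open>H\<close> be the
  union of the zero sets of all \<open>env K\<close>. A sup-convolution, corrected by a large multiple of \<open>(\<langle>L, \<xi>\<rangle> - t)\<^sup>2\<close>, extends
  \<open>env K\<close> up to a small error to a rank-one convex function on all matrices, because \<open>L b \<noteq> 0\<close> makes
  every rank-one matrix \<open>\<xi>\<close> differ from one with \<open>\<langle>L, \<xi>\<rangle> = 0\<close> by a multiple of \<open>\<langle>L, \<xi>\<rangle>\<close>; hence the hull of \<open>U\<close> is contained
  in \<open>H\<close>, a relatively open set.

  For \<open>z \<in> H\<close> let \<open>p z\<close> be the smallest fraction of volume on which a small smooth perturbation
  of compact support, with all gradients in \<open>H\<close>, of the affine map with gradient \<open>z\<close> must have its gradient outside \<open>U\<close>.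
  An explicit oscillating field, which solves the linear constraint exactly, shows that \<open>p\<close>
  is convex along the rank-one segments in \<open>H\<close>. Gluing \<open>p\<close> with a multiple of \<open>env K\<close>
  gives a competitor in the definition of \<open>env K\<close>, so \<open>p = 0\<close> on \<open>H\<close>. The solution is a limit of
  successive perturbations, the next one being supported where the gradient is not yet in \<open>U\<close>.\<close>

section \<open>Rank-one convex envelopes under a linear constraint\<close>

text \<open>Since \<open>U\<close> is open only inside a hyperplane, a perturbation whose gradient
  leaves the hyperplane by any amount is useless, and cutting off an oscillation creates such
  errors. Injectivity of \<open>L\<close> is therefore used a second time: for every
  \<open>b\<close> there is a vector \<open>r\<close> with
  \<open>r \<bullet> (L *v x) = b \<bullet> x\<close>, and a correction along \<open>r\<close>
  cancels the error exactly. The hull is given by duality and not by a construction, so there is no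
  sequence of laminates to follow. Instead the failure to reach \<open>U\<close> is itself turned
  into a function convex along rank-one segments, to which duality applies. Volume fractions are the
  right measure of failure: they can be required on every bounded open set at once, and volumes add
  up over disjoint pieces. The gluing is needed because convexity of \<open>p\<close> is known only
  inside \<open>H\<close>, whereas competitors live on the whole hyperplane. The distance to
  \<open>K\<close> is a convenient upper bound for competitors: it yields Lipschitz continuity,
  bounded sublevel sets and, as \<open>p\<close> vanishes near \<open>K\<close> and is at most 1,
  room for a positive multiple of the glued function.\<close>

definition outer :: "real^'m \<Rightarrow> real^'n \<Rightarrow> real^'n^'m" where
  "outer a b = (\<chi> i j. a $ i * b $ j)"

lemma outer_nth [simp]: "outer a b $ i $ j = a $ i * b $ j"
  by (simp add: outer_def)

lemma scaleR_outer: "c *\<^sub>R outer a b = outer (c *\<^sub>R a) b"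
  by (simp add: vec_eq_iff)

lemma outer_diff_left: "outer (a - a') b = outer a b - outer a' b"
  by (simp add: vec_eq_iff algebra_simps)

lemma inner_outer: "L \<bullet> outer a b = a \<bullet> (L *v b)"
  by (simp add: inner_vec_def matrix_vector_mult_def sum_distrib_left mult_ac)

lemma outer_mult_vec: "outer a b *v x = (b \<bullet> x) *\<^sub>R a"
  by (simp add: vec_eq_iff inner_vec_def matrix_vector_mult_def sum_distrib_left sum_distrib_right mult_ac)

lemma norm_outer: "norm (outer a b) = norm a * norm b"
proof -
  have "outer a b \<bullet> outer a b = (a \<bullet> a) * (b \<bullet> b)"
    unfolding inner_outer outer_mult_vec by (simp add: mult.commute)
  then show ?thesis
    by (simp add: norm_eq_sqrt_inner real_sqrt_mult)
qed

text \<open>The range is a line; \<open>a\<close> spans it, and the entries of \<open>b\<close> are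
  the coordinates of the columns along \<open>a\<close>.\<close>

lemma rank_one_outer:
  fixes A :: "real^'n^'m"
  assumes "rank A = 1"
  obtains a b where "A = outer a b"
proof -
  have "dim (range ((*v) A)) = 1"
    using assms by (simp add: rank_dim_range)
  then obtain B where B: "B \<subseteq> range ((*v) A)" "range ((*v) A) \<subseteq> span B" "card B = 1"
    using basis_exists by metis
  then obtain a where "B = {a}"
    by (auto simp: card_1_singleton_iff)
  then have "\<And>x. \<exists>k. A *v x = k *\<^sub>R a"
    using B(2) by (auto simp: span_singleton)
  then obtain k where k: "\<And>x. A *v x = k x *\<^sub>R a"
    by metis
  have "A = outer a (\<chi> j. k (axis j 1))"
    using k[of "axis _ 1"] by (simp add: vec_eq_iff matrix_vector_mult_basis column_def)
  then show thesis by (rule that)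
qed

text \<open>\<open>R\<close> is any bound for \<open>U\<close> and may be negative if
  \<open>U\<close> is empty; where its sign matters, it is a separate assumption.\<close>

locale hull_setting =
  fixes L :: "real^'n^'m" and t R :: real and U :: "(real^'n^'m) set"
  assumes L_inj: "\<And>b. b \<noteq> 0 \<Longrightarrow> L *v b \<noteq> 0"
    and U_bound: "\<And>x. x \<in> U \<Longrightarrow> norm x \<le> R"
    and U_open: "openin (top_of_set {x. L \<bullet> x = t}) U"
begin

section \<open>The envelope of the distance to a set, inside the hyperplane\<close>

definition Sg :: "(real^'n^'m) set" where
  "Sg = {x. L \<bullet> x = t}"

lemma closed_Sg: "closed Sg"
  unfolding Sg_def by (rule closed_hyperplane)

lemma U_subset: "U \<subseteq> Sg"
  using U_open unfolding openin_euclidean_subtopology_iff Sg_def by blast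

lemma U_nbhd: "x \<in> U \<Longrightarrow> \<exists>e>0. \<forall>y\<in>Sg. dist y x < e \<longrightarrow> y \<in> U"
  using U_open unfolding openin_euclidean_subtopology_iff Sg_def by blast

lemma Sg_convex_comb: "x \<in> Sg \<Longrightarrow> y \<in> Sg \<Longrightarrow> c *\<^sub>R x + (1 - c) *\<^sub>R y \<in> Sg"
  by (simp add: Sg_def inner_add_right algebra_simps)

lemma Sg_add: "x \<in> Sg \<Longrightarrow> L \<bullet> h = 0 \<Longrightarrow> x + h \<in> Sg"
  by (simp add: Sg_def inner_add_right)

lemma Sg_diff: "x \<in> Sg \<Longrightarrow> y \<in> Sg \<Longrightarrow> L \<bullet> (x - y) = 0"
  by (simp add: Sg_def inner_diff_right)

text \<open>Stated with \<open>outer a b\<close> and not with the rank, so that a zero difference,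
  for which the inequality is trivial, needs no separate treatment. Values off \<open>Sg\<close> do
  not enter.\<close>

definition sroc :: "(real^'n^'m \<Rightarrow> real) \<Rightarrow> bool" where
  "sroc f \<longleftrightarrow> (\<forall>x\<in>Sg. \<forall>y\<in>Sg. \<forall>a b c. x - y = outer a b \<and> 0 \<le> c \<and> c \<le> 1 \<longrightarrow>
     f (c *\<^sub>R x + (1 - c) *\<^sub>R y) \<le> c * f x + (1 - c) * f y)"

lemma srocD:
  assumes "sroc f" "x \<in> Sg" "y \<in> Sg" "x - y = outer a b" "0 \<le> c" "c \<le> 1"
  shows "f (c *\<^sub>R x + (1 - c) *\<^sub>R y) \<le> c * f x + (1 - c) * f y"
  using assms unfolding sroc_def by blast

definition minorants :: "(real^'n^'m) set \<Rightarrow> (real^'n^'m \<Rightarrow> real) set" where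
  "minorants K = {f. sroc f \<and> (\<forall>y\<in>Sg. f y \<le> infdist y K)}"

text \<open>Off \<open>Sg\<close> the minorants are arbitrary and this real supremum carries no
  information, hence the assumption \<open>x \<in> Sg\<close> in the estimates below.\<close>

definition env :: "(real^'n^'m) set \<Rightarrow> real^'n^'m \<Rightarrow> real" where
  "env K x = (SUP f\<in>minorants K. f x)"

lemma zero_minorant: "(\<lambda>x. 0) \<in> minorants K"
  by (simp add: minorants_def sroc_def infdist_nonneg)

lemma minorants_bdd: "x \<in> Sg \<Longrightarrow> bdd_above ((\<lambda>f. f x) ` minorants K)"
  by (rule bdd_aboveI2[where M = "infdist x K"]) (auto simp: minorants_def)

lemma env_ge: "f \<in> minorants K \<Longrightarrow> x \<in> Sg \<Longrightarrow> f x \<le> env K x"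
  unfolding env_def by (rule cSUP_upper[OF _ minorants_bdd])

lemma env_leI: "(\<And>f. f \<in> minorants K \<Longrightarrow> f x \<le> c) \<Longrightarrow> env K x \<le> c"
  unfolding env_def using zero_minorant by (intro cSUP_least) auto

lemma env_nonneg: "x \<in> Sg \<Longrightarrow> 0 \<le> env K x"
  using env_ge[OF zero_minorant] .

lemma env_le_infdist: "x \<in> Sg \<Longrightarrow> env K x \<le> infdist x K"
  by (rule env_leI) (simp add: minorants_def)

lemma sroc_env: "sroc (env K)"
  unfolding sroc_def
proof (intro ballI allI impI env_leI, elim conjE)
  fix x y a b c f
  assume x: "x \<in> Sg" and y: "y \<in> Sg" and xy: "x - y = outer a b" and c: "0 \<le> c" "c \<le> (1::real)"
    and f: "f \<in> minorants K"
  have "f (c *\<^sub>R x + (1 - c) *\<^sub>R y) \<le> c * f x + (1 - c) * f y"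
    using f x y xy c by (auto simp: minorants_def intro: srocD)
  also have "\<dots> \<le> c * env K x + (1 - c) * env K y"
    using env_ge[OF f x] env_ge[OF f y] c by (intro add_mono mult_left_mono) auto
  finally show "f (c *\<^sub>R x + (1 - c) *\<^sub>R y) \<le> c * env K x + (1 - c) * env K y" .
qed

text \<open>A translate of a minorant in a direction \<open>h\<close> of the hyperplane, lowered by
  \<open>d\<close>, is a minorant for \<open>K'\<close>. Three cases are used:
  \<open>h = y - x\<close> with \<open>K' = K\<close> gives Lipschitz continuity,
  \<open>h = 0\<close> gives monotonicity in the set, and translating \<open>K\<close> along with
  the point gives openness of \<open>H\<close>.\<close>

lemma env_translate:
  assumes "L \<bullet> h = 0" and "\<And>y. y \<in> Sg \<Longrightarrow> infdist (y + h) K \<le> infdist y K' + d" and "x \<in> Sg"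
  shows "env K (x + h) \<le> env K' x + d"
proof (rule env_leI)
  fix f assume f: "f \<in> minorants K"
  have "(\<lambda>x. f (x + h) - d) \<in> minorants K'"
    unfolding minorants_def
  proof (intro CollectI conjI ballI)
    show "sroc (\<lambda>x. f (x + h) - d)"
      unfolding sroc_def
    proof (intro ballI allI impI, elim conjE)
      fix x y a b c
      assume x: "x \<in> Sg" and y: "y \<in> Sg" and xy: "x - y = outer a b" and c: "0 \<le> c" "c \<le> (1::real)"
      have "f (c *\<^sub>R (x + h) + (1 - c) *\<^sub>R (y + h)) \<le> c * f (x + h) + (1 - c) * f (y + h)"
        using f x y xy c assms(1) by (intro srocD[of f _ _ a b] Sg_add) (auto simp: minorants_def)
      moreover have "c *\<^sub>R (x + h) + (1 - c) *\<^sub>R (y + h) = c *\<^sub>R x + (1 - c) *\<^sub>R y + h"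
        by (simp add: algebra_simps)
      ultimately show "f (c *\<^sub>R x + (1 - c) *\<^sub>R y + h) - d
          \<le> c * (f (x + h) - d) + (1 - c) * (f (y + h) - d)"
        by (simp add: algebra_simps)
    qed
    fix y assume "y \<in> Sg"
    then have "f (y + h) \<le> infdist (y + h) K"
      using f Sg_add[OF _ assms(1)] by (auto simp: minorants_def)
    then show "f (y + h) - d \<le> infdist y K'"
      using assms(2)[OF \<open>y \<in> Sg\<close>] by linarith
  qed
  from env_ge[OF this \<open>x \<in> Sg\<close>] show "f (x + h) \<le> env K' x + d"
    by simp
qed

lemma env_lipschitz:
  assumes "x \<in> Sg" "y \<in> Sg"
  shows "env K y \<le> env K x + dist y x"
proof -
  have "env K (x + (y - x)) \<le> env K x + norm (y - x)"
  proof (rule env_translate)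
    show "infdist (z + (y - x)) K \<le> infdist z K + norm (y - x)" for z
      using infdist_triangle[of "z + (y - x)" K z] by (simp add: dist_norm)
  qed (use assms Sg_diff in auto)
  then show ?thesis by (simp add: dist_norm)
qed

lemma continuous_on_env: "continuous_on Sg (env K)"
  unfolding continuous_on_iff
proof (intro ballI allI impI)
  fix x and e :: real assume "x \<in> Sg" "0 < e"
  have "dist (env K y) (env K x) \<le> dist y x" if "y \<in> Sg" for y
    using env_lipschitz[OF \<open>x \<in> Sg\<close> that, of K] env_lipschitz[OF that \<open>x \<in> Sg\<close>, of K]
    by (simp add: dist_real_def dist_commute)
  then show "\<exists>d>0. \<forall>y\<in>Sg. dist y x < d \<longrightarrow> dist (env K y) (env K x) < e"
    using \<open>0 < e\<close> by (intro exI[of _ e]) force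
qed

text \<open>\<open>norm x - R\<close> is convex and lies below the distance to \<open>K\<close>, so
  it is itself a competitor. This makes the sublevel sets of the envelope bounded.\<close>

lemma env_norm_bound:
  assumes "K \<subseteq> U" "K \<noteq> {}" "x \<in> Sg"
  shows "norm x \<le> R + env K x"
proof -
  have "(\<lambda>x. norm x - R) \<in> minorants K"
    unfolding minorants_def
  proof (intro CollectI conjI ballI)
    show "sroc (\<lambda>x. norm x - R)"
      unfolding sroc_def
    proof (intro ballI allI impI, elim conjE)
      fix x y :: "real^'n^'m" and c :: real assume "0 \<le> c" "c \<le> 1"
      then have "norm (c *\<^sub>R x + (1 - c) *\<^sub>R y) \<le> c * norm x + (1 - c) * norm y"
        by (metis abs_of_nonneg diff_ge_0_iff_ge norm_scaleR norm_triangle_ineq)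
      then show "norm (c *\<^sub>R x + (1 - c) *\<^sub>R y) - R \<le> c * (norm x - R) + (1 - c) * (norm y - R)"
        by (simp add: algebra_simps)
    qed
    fix y assume "y \<in> Sg"
    show "norm y - R \<le> infdist y K"
      unfolding infdist_notempty[OF assms(2)]
    proof (rule cINF_greatest[OF assms(2)])
      fix k assume "k \<in> K"
      then have "norm k \<le> R" using U_bound assms(1) by blast
      then show "norm y - R \<le> dist y k"
        using norm_triangle_ineq2[of y k] by (simp add: dist_norm)
    qed
  qed
  from env_ge[OF this \<open>x \<in> Sg\<close>] show ?thesis by simp
qed

section \<open>The zero set of the envelopes: rank-one segments and openness\<close>

text \<open>The condition \<open>K \<noteq> {}\<close> is essential: \<open>infdist\<close> to the
  empty set is 0 by convention, so the envelope of the empty set vanishes on all of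
  \<open>Sg\<close>.\<close>

definition H :: "(real^'n^'m) set" where
  "H = {x \<in> Sg. \<exists>K. compact K \<and> K \<noteq> {} \<and> K \<subseteq> U \<and> env K x \<le> 0}"

lemma H_subset: "H \<subseteq> Sg"
  by (auto simp: H_def)

lemma H_bound:
  assumes "x \<in> H"
  shows "norm x \<le> R"
proof -
  obtain K where K: "K \<noteq> {}" "K \<subseteq> U" "env K x \<le> 0" and "x \<in> Sg"
    using assms unfolding H_def by blast
  then show ?thesis
    using env_norm_bound[OF K(2,1) \<open>x \<in> Sg\<close>] by linarith
qed

lemma U_subset_H: "U \<subseteq> H"
proof
  fix x assume x: "x \<in> U"
  then have "env {x} x \<le> 0"
    using env_le_infdist[of x "{x}"] U_subset by auto
  then show "x \<in> H"
    using x U_subset unfolding H_def by (intro CollectI conjI exI[of _ "{x}"]) auto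
qed

lemma env_mono:
  assumes "K \<subseteq> K'" "K \<noteq> {}" "x \<in> Sg"
  shows "env K' x \<le> env K x"
  using env_translate[of 0 K' K 0 x] infdist_mono[OF assms(1,2)] assms(3) by simp

text \<open>Enlarging \<open>K\<close> lowers the envelope, so the union of the sets belonging to
  the two end points serves both of them, and then the whole segment.\<close>

lemma H_segment:
  assumes "x \<in> H" "y \<in> H" "x - y = outer a b" "0 \<le> c" "c \<le> 1"
  shows "c *\<^sub>R x + (1 - c) *\<^sub>R y \<in> H"
proof -
  obtain K1 K2 where K: "compact K1" "K1 \<noteq> {}" "K1 \<subseteq> U" "env K1 x \<le> 0"
     "compact K2" "K2 \<noteq> {}" "K2 \<subseteq> U" "env K2 y \<le> 0"
    using assms unfolding H_def by auto
  have S: "x \<in> Sg" "y \<in> Sg" using assms H_subset by auto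
  let ?K = "K1 \<union> K2"
  have "env ?K x \<le> 0" "env ?K y \<le> 0"
    using env_mono[of K1 ?K x] env_mono[of K2 ?K y] K S by auto
  then have "c * env ?K x + (1 - c) * env ?K y \<le> 0"
    using assms by (simp add: add_nonpos_nonpos mult_nonneg_nonpos)
  then have "env ?K (c *\<^sub>R x + (1 - c) *\<^sub>R y) \<le> 0"
    using srocD[OF sroc_env S assms(3-5), of ?K] by linarith
  then show ?thesis
    using K S unfolding H_def
    by (intro CollectI conjI exI[of _ ?K]) (auto intro: Sg_convex_comb)
qed

text \<open>A Lebesgue number for the covering of \<open>K\<close> by the neighbourhoods. Relative
  openness is spelled out pointwise, so that both \<open>U\<close> and \<open>H\<close> can take the
  role of \<open>V\<close>.\<close>

lemma compact_nbhd:
  assumes "compact K" "K \<subseteq> V" and "\<And>x. x \<in> V \<Longrightarrow> \<exists>e>0. \<forall>y\<in>Sg. dist y x < e \<longrightarrow> y \<in> V"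
  obtains d where "d > 0" "\<And>x y. x \<in> K \<Longrightarrow> y \<in> Sg \<Longrightarrow> dist y x < d \<Longrightarrow> y \<in> V"
proof -
  from assms have "\<forall>x\<in>K. \<exists>e>0. \<forall>y\<in>Sg. dist y x < e \<longrightarrow> y \<in> V" by blast
  then obtain e where e: "\<And>x. x \<in> K \<Longrightarrow> e x > 0"
     "\<And>x y. x \<in> K \<Longrightarrow> y \<in> Sg \<Longrightarrow> dist y x < e x \<Longrightarrow> y \<in> V" by metis
  let ?C = "(\<lambda>x. ball x (e x)) ` K"
  have "K \<subseteq> \<Union>?C" using e by force
  then obtain d where d: "d > 0" "\<And>x. x \<in> K \<Longrightarrow> \<exists>G\<in>?C. ball x d \<subseteq> G"
    using Heine_Borel_lemma[OF assms(1), of ?C] by (metis (no_types, lifting) image_iff open_ball)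
  show thesis
  proof (rule that[OF d(1)])
    fix x y assume "x \<in> K" "y \<in> Sg" "dist y x < d"
    then obtain z where z: "z \<in> K" "ball x d \<subseteq> ball z (e z)" using d(2) by blast
    then have "y \<in> ball z (e z)" using \<open>dist y x < d\<close> by (auto simp: dist_commute)
    then show "y \<in> V" using e(2)[OF z(1) \<open>y \<in> Sg\<close>] by (simp add: dist_commute)
  qed
qed

text \<open>The radius is a Lebesgue number of \<open>K\<close> in \<open>U\<close>: shifting
  \<open>K\<close> by \<open>y - x\<close> keeps it in \<open>U\<close>, and the envelope of the
  shifted set at \<open>y\<close> is at most that of \<open>K\<close> at \<open>x\<close>.\<close>

lemma H_uniform:
  assumes "compact K" "K \<noteq> {}" "K \<subseteq> U"
  obtains r where "r > 0" "\<And>x y. x \<in> Sg \<Longrightarrow> env K x \<le> 0 \<Longrightarrow> y \<in> Sg \<Longrightarrow> dist y x < r \<Longrightarrow> y \<in> H"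
proof -
  obtain d where d: "d > 0" "\<And>x y. x \<in> K \<Longrightarrow> y \<in> Sg \<Longrightarrow> dist y x < d \<Longrightarrow> y \<in> U"
    using compact_nbhd[OF assms(1,3) U_nbhd] by metis
  show thesis
  proof (rule that[OF d(1)])
    fix x y assume x: "x \<in> Sg" "env K x \<le> 0" and y: "y \<in> Sg" "dist y x < d"
    let ?K = "(\<lambda>k. k + (y - x)) ` K"
    have "?K \<subseteq> U"
    proof (clarify)
      fix k assume k: "k \<in> K"
      then have "k + (y - x) \<in> Sg"
        using assms U_subset Sg_add[OF _ Sg_diff] x y by blast
      then show "k + (y - x) \<in> U"
        using d(2)[OF k] y(2) by (simp add: dist_norm)
    qed
    moreover have "compact ?K"
      using compact_translation[OF assms(1), of "y - x"] by (simp add: add.commute)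
    moreover have "env ?K (x + (y - x)) \<le> env K x + 0"
    proof (rule env_translate)
      have "(\<lambda>k. dist (z + (y - x)) (k + (y - x))) ` K = (\<lambda>k. dist z k) ` K" for z
        by simp
      then show "infdist (z + (y - x)) ?K \<le> infdist z K + 0" for z
        using assms(2) by (simp add: infdist_notempty image_image)
    qed (use x y Sg_diff in auto)
    ultimately show "y \<in> H"
      using x y assms(2) unfolding H_def by (intro CollectI conjI exI[of _ ?K]) auto
  qed
qed

lemma H_nbhd:
  assumes "x \<in> H"
  shows "\<exists>e>0. \<forall>y\<in>Sg. dist y x < e \<longrightarrow> y \<in> H"
proof -
  obtain K where K: "x \<in> Sg" "compact K" "K \<noteq> {}" "K \<subseteq> U" "env K x \<le> 0"
    using assms unfolding H_def by blast
  show ?thesis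
    using H_uniform[OF K(2-4)] K(1,5) by metis
qed

text \<open>Outside \<open>H\<close> the envelope of \<open>K\<close> is positive; on the compact
  set of points outside \<open>H\<close> with value at most 1 it has a positive minimum, and half of
  it bounds the level. The strip below the level is where a function known only on \<open>H\<close>
  can be glued to the envelope.\<close>

lemma H_sublevel:
  assumes "compact K" "K \<noteq> {}" "K \<subseteq> U"
  obtains \<eta> where "\<eta> > 0" "\<And>x. x \<in> Sg \<Longrightarrow> env K x \<le> \<eta> \<Longrightarrow> x \<in> H"
proof -
  define C where "C = {x \<in> Sg. env K x \<le> 1}"
  have "closed C"
    unfolding C_def using continuous_on_closed_Collect_le[OF continuous_on_env continuous_on_const closed_Sg] .
  moreover have "bounded C"
    unfolding bounded_iff C_def using env_norm_bound[OF assms(3,2)] by (intro exI[of _ "R + 1"]) fastforce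
  ultimately have C: "compact C" using compact_eq_bounded_closed by blast
  \<comment> \<open>\<open>H\<close> is only relatively open; removing from \<open>C\<close> an open
    set of the full space with the same trace on \<open>Sg\<close> leaves a compact set.\<close>
  have "\<exists>W. open W \<and> Sg \<inter> W = Sg \<inter> H"
  proof -
    have "openin (top_of_set Sg) H"
      unfolding openin_euclidean_subtopology_iff using H_subset H_nbhd by blast
    then show ?thesis using H_subset unfolding openin_open by blast
  qed
  then obtain W where W: "open W" "Sg \<inter> W = Sg \<inter> H" by blast
  have D: "compact (C - W)" using C W by (simp add: compact_diff)
  show thesis
  proof (cases "C - W = {}")
    case True
    then show thesis using W that[of 1] unfolding C_def by force
  next
    case False
    have "continuous_on (C - W) (env K)"
      using continuous_on_env by (rule continuous_on_subset) (auto simp: C_def)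
    then obtain x0 where x0: "x0 \<in> C - W" "\<And>x. x \<in> C - W \<Longrightarrow> env K x0 \<le> env K x"
      using continuous_attains_inf[OF D False] by blast
    have "env K x0 > 0"
      using x0(1) W assms unfolding C_def H_def by force
    show thesis
    proof (rule that[of "min 1 (env K x0 / 2)"])
      show "0 < min 1 (env K x0 / 2)" using \<open>env K x0 > 0\<close> by simp
      fix x assume x: "x \<in> Sg" "env K x \<le> min 1 (env K x0 / 2)"
      then have "x \<notin> C - W" using x0(2)[of x] \<open>env K x0 > 0\<close> by auto
      then show "x \<in> H" using x W unfolding C_def by auto
    qed
  qed
qed

text \<open>Intermediate values of the continuous envelope along the segment from \<open>A\<close>
  to \<open>x\<close>: if the end lies above \<open>\<eta>\<close>, some point has the value
  \<open>\<eta>\<close> exactly; otherwise the end itself is taken.\<close>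

lemma exit_point:
  assumes K: "K \<noteq> {}" and A: "A \<in> Sg" and x: "x \<in> Sg" and A0: "env K A < \<eta>"
    and xA: "x - A = outer a b"
  obtains s where "0 < s" "s \<le> 1" "env K (A + s *\<^sub>R (x - A)) \<le> \<eta>"
    "s < 1 \<Longrightarrow> env K (A + s *\<^sub>R (x - A)) = \<eta>"
proof (cases "env K x \<le> \<eta>")
  case True
  then show thesis using that[of 1] by simp
next
  case False
  have S: "A + s *\<^sub>R (x - A) \<in> Sg" for s
    using Sg_add[OF A] Sg_diff[OF x A] by simp
  have "continuous_on {0..1} (\<lambda>s. env K (A + s *\<^sub>R (x - A)))"
    by (rule continuous_on_compose2[OF continuous_on_env]) (auto intro!: continuous_intros S)
  then obtain s where s: "0 \<le> s" "s \<le> 1" "env K (A + s *\<^sub>R (x - A)) = \<eta>"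
    using IVT'[of "\<lambda>s. env K (A + s *\<^sub>R (x - A))" 0 \<eta> 1] A0 False by auto
  then have "s \<noteq> 0" using A0 by auto
  then show thesis using s that[of s] by auto
qed

section \<open>Convexity identities and the gluing argument\<close>

lemma weighted_mean_shift:
  fixes A d :: "'v::real_vector"
  shows "q *\<^sub>R (A + s *\<^sub>R ((1 - c) *\<^sub>R d)) + (1 - q) *\<^sub>R (A + r *\<^sub>R ((- c) *\<^sub>R d)) =
    A + (q * s * (1 - c) - (1 - q) * r * c) *\<^sub>R d"
  by (simp add: algebra_simps)

lemma difference_of_shifts:
  fixes A d :: "'v::real_vector"
  shows "A + s *\<^sub>R ((1 - c) *\<^sub>R d) - (A + r *\<^sub>R ((- c) *\<^sub>R d)) = (s * (1 - c) + r * c) *\<^sub>R d"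
  by (simp add: algebra_simps)

text \<open>The exact convexity defect of the squared norm. Together with its scalar counterpart
  below it makes the quadratic penalty and the quadratic correction in
  \<open>rank_one_convex_extension\<close> comparable term by term.\<close>

lemma weighted_parallelogram:
  fixes w d :: "'v::real_inner"
  shows "c * (norm (w + (1 - c) *\<^sub>R d))\<^sup>2 + (1 - c) * (norm (w - c *\<^sub>R d))\<^sup>2 =
    (norm w)\<^sup>2 + c * (1 - c) * (norm d)\<^sup>2"
  by (simp add: power2_norm_eq_inner inner_add_left inner_add_right inner_diff_left
      inner_diff_right inner_commute[of d w] algebra_simps)

lemma weighted_square:
  fixes x y c :: real
  shows "c * (x - t)\<^sup>2 + (1 - c) * (y - t)\<^sup>2 = (c * x + (1 - c) * y - t)\<^sup>2 + c * (1 - c) * (x - y)\<^sup>2"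
  by (simp add: power2_eq_square algebra_simps)

text \<open>The glued function \<open>g\<close> is the maximum of \<open>p\<close> and
  \<open>M * env K\<close> below the level \<open>\<eta>\<close>, and \<open>M * env K\<close>
  elsewhere. The two branches fit because \<open>M * env K\<close> equals 1, the upper bound of
  \<open>p\<close>, at the level. Convexity of \<open>p\<close> holds only between points of
  \<open>H\<close>, so a segment leaving the sublevel set is shortened on both sides and the
  inequality obtained there is scaled back to the full segment.\<close>

lemma vanishing_on_H:
  fixes p :: "real^'n^'m \<Rightarrow> real"
  assumes p01: "\<And>x. x \<in> H \<Longrightarrow> 0 \<le> p x \<and> p x \<le> 1" and pU: "\<And>x. x \<in> U \<Longrightarrow> p x = 0"
    and conv: "\<And>x y a b c. x \<in> H \<Longrightarrow> y \<in> H \<Longrightarrow> x - y = outer a b \<Longrightarrow> 0 < c \<Longrightarrow> c < 1 \<Longrightarrow>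
      p (c *\<^sub>R x + (1 - c) *\<^sub>R y) \<le> c * p x + (1 - c) * p y"
    and z: "z \<in> H"
  shows "p z = 0"
proof -
  obtain K where K: "compact K" "K \<noteq> {}" "K \<subseteq> U" "env K z \<le> 0"
    using z unfolding H_def by blast
  let ?e = "env K"
  obtain \<eta> where \<eta>: "\<eta> > 0" and sub: "\<And>x. x \<in> Sg \<Longrightarrow> ?e x \<le> \<eta> \<Longrightarrow> x \<in> H"
    using H_sublevel[OF K(1-3)] by metis
  obtain d where d: "d > 0" "\<And>x y. x \<in> K \<Longrightarrow> y \<in> Sg \<Longrightarrow> dist y x < d \<Longrightarrow> y \<in> U"
    using compact_nbhd[OF K(1,3) U_nbhd] by metis
  define M where "M = 1 / \<eta>"
  have M: "M > 0" "M * \<eta> = 1" using \<eta> by (auto simp: M_def)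
  define g where "g x = (if ?e x < \<eta> then max (p x) (M * ?e x) else M * ?e x)" for x
  have g_ge: "M * ?e x \<le> g x" for x by (simp add: g_def)
  have g_p: "p x \<le> g x" if "x \<in> Sg" "?e x \<le> \<eta>" for x
    using p01[OF sub[OF that]] M that by (cases "?e x = \<eta>") (auto simp: g_def)
  \<comment> \<open>Convexity of \<open>g\<close> along the segment from \<open>A\<close>, tested at
    the shortened end point with \<open>p\<close> on the left. At an interior exit \<open>p\<close>
    is at most \<open>M * env K\<close>, whose convexity is known; otherwise the end point is
    \<open>x\<close>, where \<open>p \<le> g\<close>.\<close>
  have exitb: "\<exists>s. 0 < s \<and> s \<le> 1 \<and> A + s *\<^sub>R (x - A) \<in> H \<and>
       p (A + s *\<^sub>R (x - A)) \<le> s * g x + (1 - s) * g A"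
    if A: "A \<in> Sg" and x: "x \<in> Sg" and A0: "?e A < \<eta>" and xA: "x - A = outer a b" for A x a b
  proof -
    from exit_point[OF K(2) A x A0 xA] obtain s where s: "0 < s" "s \<le> 1"
      "?e (A + s *\<^sub>R (x - A)) \<le> \<eta>" "s < 1 \<Longrightarrow> ?e (A + s *\<^sub>R (x - A)) = \<eta>" by blast
    let ?x = "A + s *\<^sub>R (x - A)"
    have S: "?x \<in> Sg" using Sg_add[OF A] Sg_diff[OF x A] by simp
    then have xH: "?x \<in> H" using sub s by blast
    have "p ?x \<le> s * g x + (1 - s) * g A"
    proof (cases "s < 1")
      case True
      have eq: "?x = s *\<^sub>R x + (1 - s) *\<^sub>R A" by (simp add: algebra_simps)
      have "p ?x \<le> M * ?e ?x" using p01[OF xH] s(4)[OF True] M by simp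
      also have "\<dots> \<le> M * (s * ?e x + (1 - s) * ?e A)"
        using srocD[OF sroc_env x A xA, of s K] s M eq by (intro mult_left_mono) auto
      also have "\<dots> = s * (M * ?e x) + (1 - s) * (M * ?e A)" by (simp add: algebra_simps)
      also have "\<dots> \<le> s * g x + (1 - s) * g A"
        using s by (intro add_mono mult_left_mono g_ge) auto
      finally show ?thesis .
    next
      case False
      then show ?thesis using s g_p[of x] x by simp
    qed
    then show ?thesis using s xH by blast
  qed
  have "sroc g"
    unfolding sroc_def
  proof (intro ballI allI impI, elim conjE)
    fix x y a b c
    assume x: "x \<in> Sg" and y: "y \<in> Sg" and xy: "x - y = outer a b" and c: "0 \<le> c" "c \<le> (1::real)"
    let ?A = "c *\<^sub>R x + (1 - c) *\<^sub>R y"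
    have AS: "?A \<in> Sg" using Sg_convex_comb[OF x y] .
    show "g ?A \<le> c * g x + (1 - c) * g y"
    \<comment> \<open>Where the envelope attains the maximum, its own convexity suffices. What
      remains is a proper convex combination with \<open>g ?A = p ?A\<close> strictly below the
      level.\<close>
    proof (cases "g ?A = M * ?e ?A \<or> c = 0 \<or> c = 1")
      case True
      have "M * ?e ?A \<le> M * (c * ?e x + (1 - c) * ?e y)"
        using srocD[OF sroc_env x y xy c] M by (intro mult_left_mono) auto
      also have "\<dots> = c * (M * ?e x) + (1 - c) * (M * ?e y)" by (simp add: algebra_simps)
      also have "\<dots> \<le> c * g x + (1 - c) * g y"
        using c by (intro add_mono mult_left_mono g_ge) auto
      finally show ?thesis using True by auto
    next
      case False
      then have A0: "?e ?A < \<eta>" and gA: "g ?A = p ?A" and c': "0 < c" "c < 1"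
        using c by (auto simp: g_def max_def split: if_splits)
      have xd: "x - ?A = (1 - c) *\<^sub>R (x - y)" and yd: "y - ?A = (- c) *\<^sub>R (x - y)"
        by (simp_all add: algebra_simps)
      have xA: "x - ?A = outer ((1 - c) *\<^sub>R a) b" and yA: "y - ?A = outer ((- c) *\<^sub>R a) b"
        unfolding scaleR_outer[symmetric] xy[symmetric] by (rule xd yd)+
      obtain s where s: "0 < s" "s \<le> 1" "?A + s *\<^sub>R (x - ?A) \<in> H"
         "p (?A + s *\<^sub>R (x - ?A)) \<le> s * g x + (1 - s) * g ?A"
        using exitb[OF AS x A0 xA] by blast
      obtain r where r: "0 < r" "r \<le> 1" "?A + r *\<^sub>R (y - ?A) \<in> H"
         "p (?A + r *\<^sub>R (y - ?A)) \<le> r * g y + (1 - r) * g ?A"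
        using exitb[OF AS y A0 yA] by blast
      let ?x = "?A + s *\<^sub>R (x - ?A)" and ?y = "?A + r *\<^sub>R (y - ?A)"
      define D where "D = s * (1 - c) + r * c"
      have D: "D > 0" using s r c' unfolding D_def by (simp add: add_pos_pos)
      \<comment> \<open>The weight for which \<open>?A\<close> is also the mean of the two shortened
        end points; \<open>D\<close> is the length of the shortened segment in units of
        \<open>x - y\<close>.\<close>
      define q where "q = r * c / D"
      have q1: "1 - q = s * (1 - c) / D" using D unfolding q_def D_def by (simp add: field_simps)
      have "0 < s * (1 - c) / D" using D s c' by simp
      then have q: "0 < q" "q < 1" using D r c' unfolding q1[symmetric] by (simp_all add: q_def del: divide_less_eq_1_pos)
      have key: "q * s * (1 - c) = (1 - q) * r * c"
        unfolding q1 unfolding q_def by simp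
      have "?x - ?y = outer (D *\<^sub>R a) b"
        unfolding xd yd scaleR_outer[symmetric] xy[symmetric] D_def by (rule difference_of_shifts)
      then have "p (q *\<^sub>R ?x + (1 - q) *\<^sub>R ?y) \<le> q * p ?x + (1 - q) * p ?y"
        using conv[OF s(3) r(3) _ q] by blast
      moreover have "q *\<^sub>R ?x + (1 - q) *\<^sub>R ?y = ?A + (q * s * (1 - c) - (1 - q) * r * c) *\<^sub>R (x - y)"
        unfolding xd yd by (rule weighted_mean_shift)
      ultimately have "g ?A \<le> q * p ?x + (1 - q) * p ?y" using key gA by simp
      also have "\<dots> \<le> q * (s * g x + (1 - s) * g ?A) + (1 - q) * (r * g y + (1 - r) * g ?A)"
        using s r q by (intro add_mono mult_left_mono) auto
      \<comment> \<open>The terms with \<open>1 - s\<close> and \<open>1 - r\<close> are moved to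
        the left. The weights that remain on the right are in the ratio of \<open>c\<close> to
        \<open>1 - c\<close>, and their sum \<open>T\<close> is the factor on the left.\<close>
      finally have main: "(q * s + (1 - q) * r) * g ?A \<le> q * s * g x + (1 - q) * r * g y"
        by (simp add: algebra_simps)
      define T where "T = q * s + (1 - q) * r"
      have T: "T > 0" using q s r unfolding T_def by (simp add: add_pos_pos)
      have "q * s = c * T" "(1 - q) * r = (1 - c) * T"
        using key unfolding T_def by (auto simp: algebra_simps)
      then have "q * s * g x + (1 - q) * r * g y = T * (c * g x + (1 - c) * g y)"
        by (simp add: distrib_left)
      then have "T * g ?A \<le> T * (c * g x + (1 - c) * g y)"
        using main unfolding T_def[symmetric] by (rule subst)
      then show ?thesis using T by simp
    qed
  qed
  \<comment> \<open>\<open>M\<close> controls the envelope part by the distance to \<open>K\<close>;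
    \<open>1 / d\<close> controls \<open>p\<close>, which vanishes at points of \<open>Sg\<close>
    closer than \<open>d\<close> to \<open>K\<close> and is at most 1 elsewhere below the
    level.\<close>
  define C where "C = M + 1 / d"
  have C: "C > 0" using M d by (simp add: C_def add_pos_pos)
  have "(\<lambda>x. g x / C) \<in> minorants K"
    unfolding minorants_def
  proof (intro CollectI conjI ballI)
    show "sroc (\<lambda>x. g x / C)"
      unfolding sroc_def
    proof (intro ballI allI impI, elim conjE)
      fix x y a b c
      assume "x \<in> Sg" "y \<in> Sg" "x - y = outer a b" "0 \<le> c" "c \<le> (1::real)"
      then have "g (c *\<^sub>R x + (1 - c) *\<^sub>R y) / C \<le> (c * g x + (1 - c) * g y) / C"
        using srocD[OF \<open>sroc g\<close>] C by (intro divide_right_mono) auto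
      then show "g (c *\<^sub>R x + (1 - c) *\<^sub>R y) / C \<le> c * (g x / C) + (1 - c) * (g y / C)"
        by (simp add: add_divide_distrib)
    qed
    fix y assume y: "y \<in> Sg"
    have i0: "infdist y K \<ge> 0" by (rule infdist_nonneg)
    have M1: "M * ?e y \<le> C * infdist y K"
      using env_le_infdist[OF y, of K] env_nonneg[OF y, of K] M C d i0 unfolding C_def
      by (intro mult_mono) auto
    have p1: "p y \<le> C * infdist y K" if ey: "?e y < \<eta>"
    proof (cases "infdist y K < d")
      case True
      obtain k where k: "k \<in> K" "infdist y K = dist y k"
        using infdist_attains_inf[OF compact_imp_closed[OF K(1)] K(2)] by blast
      then have "y \<in> U" using d(2)[OF k(1) y] True by simp
      then show ?thesis using pU C i0 by simp
    next
      case False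
      have "p y \<le> 1" using p01 sub[OF y] ey by simp
      also have "\<dots> \<le> (1 / d) * infdist y K" using False d by (simp add: field_simps)
      also have "\<dots> \<le> C * infdist y K" using M i0 unfolding C_def by (intro mult_right_mono) auto
      finally show ?thesis .
    qed
    have "g y \<le> C * infdist y K"
      using M1 p1 by (auto simp: g_def)
    then show "g y / C \<le> infdist y K" using C by (simp add: field_simps)
  qed
  from env_ge[OF this, of z] have "g z / C \<le> 0"
    using K(4) z H_subset by auto
  then have "g z \<le> 0" using C by (simp add: field_simps)
  then have "p z \<le> 0" using g_p[of z] z H_subset K(4) \<eta> by force
  then show ?thesis using p01[OF z] by linarith
qed

section \<open>From test functions on all matrices to the envelope on the hyperplane\<close>

lemma inj_L: "inj ((*v) L)"
  unfolding linear_injective_0[OF matrix_vector_mul_linear] using L_inj by blast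

lemma L_lower_bound: obtains \<beta> where "\<beta> > 0" "\<And>b. \<beta> * norm b \<le> norm (L *v b)"
proof -
  obtain B where "B > 0" "\<And>x. B * norm x \<le> norm (L *v x)"
    using linear_inj_bounded_below_pos[of "(*v) L"] inj_L by (metis matrix_vector_mul_linear)
  then show thesis using that by blast
qed

text \<open>The supremum in \<open>f\<close> is the sup-convolution of the envelope with a quadratic
  of weight \<open>A\<close>. A rank-one segment from \<open>C\<close> to \<open>B\<close> is
  compared with a segment in \<open>Sg\<close> through the competing point \<open>x'\<close>, in the
  direction \<open>outer a' b\<close> orthogonal to \<open>L\<close>, along which the envelope is
  convex. The two directions differ by \<open>outer (a - a') b\<close>, and the quadratic loss
  caused by this is compensated by the convexity of the last term of \<open>f\<close>.\<close>

lemma rank_one_convex_extension: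
  assumes K: "K \<subseteq> U" "k0 \<in> K" and A: "A > 0"
  obtains f where "rank_one_convex f" "\<And>x. x \<in> Sg \<Longrightarrow> env K x \<le> f x"
    "\<And>x. x \<in> K \<Longrightarrow> f x \<le> 1 / (4 * A)"
proof -
  obtain \<beta> where \<beta>: "\<beta> > 0" "\<And>b. \<beta> * norm b \<le> norm (L *v b)"
    using L_lower_bound by blast
  \<comment> \<open>A bound for the squared ratio of \<open>norm b\<close> to
    \<open>norm (L *v b)\<close>, the factor that enters when a direction is projected into the
    hyperplane.\<close>
  define \<kappa> where "\<kappa> = 1 / \<beta>\<^sup>2"
  define S where "S x = (\<lambda>x'. env K x' - A * (norm (x - x'))\<^sup>2) ` Sg" for x
  define f where "f x = Sup (S x) + \<kappa> * A * (L \<bullet> x - t)\<^sup>2" for x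
  \<comment> \<open>The maximum of distance minus penalty; it bounds the error of the
    sup-convolution on \<open>K\<close>.\<close>
  have quad: "n - A * n\<^sup>2 \<le> 1 / (4 * A)" for n :: real
  proof -
    have "0 \<le> (2 * A * n - 1)\<^sup>2" by simp
    then have "4 * A * (n - A * n\<^sup>2) \<le> 1" by (simp add: power2_eq_square algebra_simps)
    then show ?thesis using A by (simp add: field_simps)
  qed
  have bound: "env K x' - A * (norm (x - x'))\<^sup>2 \<le> dist x k + 1 / (4 * A)"
    if "x' \<in> Sg" "k \<in> K" for x x' k
  proof -
    have "env K x' \<le> dist x' k"
      using env_le_infdist[OF that(1), of K] infdist_le[OF that(2), of x'] by linarith
    also have "\<dots> \<le> norm (x - x') + dist x k"
      using dist_triangle[of x' k x] by (simp add: dist_norm norm_minus_commute)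
    finally show ?thesis using quad[of "norm (x - x')"] by linarith
  qed
  have bdd: "bdd_above (S x)" for x
    unfolding S_def using bound[OF _ K(2)] by (intro bdd_aboveI2) auto
  have ne: "Sg \<noteq> {}" using K U_subset by auto
  have upper: "env K x' - A * (norm (x - x'))\<^sup>2 \<le> Sup (S x)" if "x' \<in> Sg" for x x'
    using that by (intro cSup_upper bdd) (auto simp: S_def)
  show thesis
  proof (rule that)
    show "rank_one_convex f"
      unfolding rank_one_convex_def
    proof (intro allI impI, elim conjE)
      fix B C :: "real^'n^'m" and c :: real
      assume rk: "rank (B - C) = 1" and c: "0 \<le> c" "c \<le> 1"
      obtain a b where ab: "B - C = outer a b" using rank_one_outer[OF rk] .
      have "b \<noteq> 0"
      proof
        assume "b = 0"
        then have "B - C = 0" using ab by (simp add: vec_eq_iff)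
        then show False using rk by simp
      qed
      define s where "s = a \<bullet> (L *v b)"
      \<comment> \<open>The projection of \<open>a\<close> to the orthogonal complement of
        \<open>L *v b\<close>, which makes \<open>outer a' b\<close> a direction of the
        hyperplane.\<close>
      define a' where "a' = a - (s / (norm (L *v b))\<^sup>2) *\<^sub>R (L *v b)"
      have Lb: "norm (L *v b) > 0" using L_inj[OF \<open>b \<noteq> 0\<close>] by simp
      have La': "L \<bullet> outer a' b = 0"
        using Lb unfolding inner_outer a'_def s_def
        by (simp add: inner_diff_left power2_norm_eq_inner)
      have "norm (a - a') * norm b = \<bar>s\<bar> * (norm b / norm (L *v b))"
        using Lb by (simp add: a'_def power2_eq_square field_simps)
      moreover have "norm b / norm (L *v b) \<le> 1 / \<beta>"
        using \<beta>(1) \<beta>(2)[of b] Lb by (simp add: field_simps)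
      ultimately have "norm (outer (a - a') b) \<le> \<bar>s\<bar> * (1 / \<beta>)"
        unfolding norm_outer by (metis abs_ge_zero mult_left_mono)
      then have "(norm (outer (a - a') b))\<^sup>2 \<le> (\<bar>s\<bar> * (1 / \<beta>))\<^sup>2"
        by (intro power_mono) auto
      then have corr: "(norm (outer (a - a') b))\<^sup>2 \<le> \<kappa> * s\<^sup>2"
        by (simp add: \<kappa>_def power_mult_distrib power_divide)
      have Ls: "L \<bullet> (B - C) = s" unfolding ab inner_outer s_def by simp
      let ?x = "c *\<^sub>R B + (1 - c) *\<^sub>R C"
      have "Sup (S ?x) \<le> c * f B + (1 - c) * f C - \<kappa> * A * (L \<bullet> ?x - t)\<^sup>2"
      proof (rule cSup_least)
        show "S ?x \<noteq> {}" using ne by (simp add: S_def)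
        fix y assume "y \<in> S ?x"
        then obtain x' where x': "x' \<in> Sg" and y: "y = env K x' - A * (norm (?x - x'))\<^sup>2"
          by (auto simp: S_def)
        \<comment> \<open>\<open>B'\<close> and \<open>C'\<close> are points of \<open>Sg\<close>
          with weighted mean \<open>x'\<close>, to be inserted as competitors in the suprema for
          \<open>B\<close> and \<open>C\<close>.\<close>
        define B' where "B' = x' + (1 - c) *\<^sub>R outer a' b"
        define C' where "C' = x' - c *\<^sub>R outer a' b"
        have BC: "B' \<in> Sg" "C' \<in> Sg"
          using x' La' by (auto simp: B'_def C'_def Sg_def inner_add_right inner_diff_right)
        have "B' - C' = outer a' b" by (simp add: B'_def C'_def algebra_simps)
        moreover have "c *\<^sub>R B' + (1 - c) *\<^sub>R C' = x'" by (simp add: B'_def C'_def algebra_simps)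
        ultimately have e1: "env K x' \<le> c * env K B' + (1 - c) * env K C'"
          using srocD[OF sroc_env BC _ c, of a' b K] by simp
        let ?w = "?x - x'" and ?D = "outer (a - a') b"
        have B1: "B - B' = ?w + (1 - c) *\<^sub>R ?D" and C1: "C - C' = ?w - c *\<^sub>R ?D"
          unfolding B'_def C'_def outer_diff_left ab[symmetric] by (simp_all add: algebra_simps)
        have n1: "c * (norm (B - B'))\<^sup>2 + (1 - c) * (norm (C - C'))\<^sup>2
            = (norm ?w)\<^sup>2 + c * (1 - c) * (norm ?D)\<^sup>2"
          unfolding B1 C1 by (rule weighted_parallelogram)
        have n2: "c * (L \<bullet> B - t)\<^sup>2 + (1 - c) * (L \<bullet> C - t)\<^sup>2 = (L \<bullet> ?x - t)\<^sup>2 + c * (1 - c) * s\<^sup>2"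
          unfolding Ls[symmetric] inner_add_right inner_diff_right inner_scaleR_right by (rule weighted_square)
        have "c * (1 - c) * (norm ?D)\<^sup>2 \<le> c * (1 - c) * (\<kappa> * s\<^sup>2)"
          using corr c by (intro mult_left_mono) auto
        then have n3: "A * (c * (1 - c) * (norm ?D)\<^sup>2) \<le> A * (c * (1 - c) * (\<kappa> * s\<^sup>2))"
          using A by (rule mult_left_mono[OF _ less_imp_le])
        have "y \<le> c * env K B' + (1 - c) * env K C'
            - A * (c * (norm (B - B'))\<^sup>2 + (1 - c) * (norm (C - C'))\<^sup>2) + A * (c * (1 - c) * (\<kappa> * s\<^sup>2))"
          using e1 n3 unfolding y n1 by (simp add: algebra_simps)
        also have "\<dots> = c * (env K B' - A * (norm (B - B'))\<^sup>2) + (1 - c) * (env K C' - A * (norm (C - C'))\<^sup>2)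
            + \<kappa> * A * (c * (1 - c) * s\<^sup>2)"
          by (simp add: algebra_simps)
        also have "\<dots> \<le> c * Sup (S B) + (1 - c) * Sup (S C) + \<kappa> * A * (c * (1 - c) * s\<^sup>2)"
          using upper[OF BC(1), of B] upper[OF BC(2), of C] c
          by (intro add_right_mono add_mono mult_left_mono) auto
        also have "\<dots> = c * f B + (1 - c) * f C
            - \<kappa> * A * (c * (L \<bullet> B - t)\<^sup>2 + (1 - c) * (L \<bullet> C - t)\<^sup>2 - c * (1 - c) * s\<^sup>2)"
          unfolding f_def by (simp add: algebra_simps)
        also have "\<dots> = c * f B + (1 - c) * f C - \<kappa> * A * (L \<bullet> ?x - t)\<^sup>2"
          unfolding n2 by simp
        finally show "y \<le> c * f B + (1 - c) * f C - \<kappa> * A * (L \<bullet> ?x - t)\<^sup>2" .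
      qed
      then show "f ?x \<le> c * f B + (1 - c) * f C" by (simp add: f_def)
    qed
    show "env K x \<le> f x" if "x \<in> Sg" for x
      using upper[OF that, of x] that by (simp add: f_def Sg_def)
    show "f x \<le> 1 / (4 * A)" if "x \<in> K" for x
    proof -
      have "x \<in> Sg" using that K U_subset by blast
      moreover have "Sup (S x) \<le> 1 / (4 * A)"
        using ne bound[OF _ that, of _ x] by (intro cSup_least) (auto simp: S_def)
      ultimately show ?thesis by (simp add: f_def Sg_def)
    qed
  qed
qed

text \<open>For both signs of \<open>s\<close> these test functions vanish on \<open>Sg\<close>;
  they force the hull of a subset of \<open>Sg\<close> to stay in \<open>Sg\<close>.\<close>

lemma rank_one_convex_inner: "rank_one_convex (\<lambda>x. s * (L \<bullet> x - t))"
  unfolding rank_one_convex_def by (auto simp: inner_add_right algebra_simps)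

lemma rc_hull_subset_H: "rc_hull U \<subseteq> H"
proof
  fix z assume "z \<in> rc_hull U"
  then obtain K where K: "K \<subseteq> U" "compact K" and zK: "z \<in> rc_hull_compact K"
    unfolding rc_hull_def by blast
  have hull: "f z \<le> c" if "rank_one_convex f" "\<And>x. x \<in> K \<Longrightarrow> f x \<le> c" for f c
  proof -
    have "ereal (f z) \<le> (SUP x\<in>K. ereal (f x))"
      using zK that(1) unfolding rc_hull_compact_def by blast
    also have "\<dots> \<le> ereal c" using that(2) by (intro SUP_least) auto
    finally show ?thesis by simp
  qed
  have "rank_one_convex (\<lambda>x. 0)" by (simp add: rank_one_convex_def)
  \<comment> \<open>For empty \<open>K\<close> the bound \<open>-1\<close> for the zero function
    would hold vacuously.\<close>
  then have "K \<noteq> {}" using hull[of "\<lambda>x. 0" "-1"] by auto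
  then obtain k0 where k0: "k0 \<in> K" by blast
  have "s * (L \<bullet> z - t) \<le> 0" for s
    by (rule hull[OF rank_one_convex_inner]) (use K U_subset in \<open>auto simp: Sg_def\<close>)
  from this[of 1] this[of "-1"] have zS: "z \<in> Sg" unfolding Sg_def by simp
  have "env K z \<le> 1 / (4 * A)" if A: "A > 0" for A
  proof -
    obtain f where f: "rank_one_convex f" "\<And>x. x \<in> Sg \<Longrightarrow> env K x \<le> f x"
      "\<And>x. x \<in> K \<Longrightarrow> f x \<le> 1 / (4 * A)"
      using rank_one_convex_extension[OF K(1) k0 A] by metis
    have "f z \<le> 1 / (4 * A)" by (rule hull[OF f(1)]) (rule f(3))
    then show ?thesis using f(2)[OF zS] by linarith
  qed
  note bound = this
  \<comment> \<open>The weight \<open>A = 1 / (4 * e)\<close> makes the error of the extension equal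
    to \<open>e\<close>.\<close>
  have "env K z \<le> 0 + e" if "e > 0" for e
    using bound[of "1 / (4 * e)"] that by simp
  then have "env K z \<le> 0" by (rule field_le_epsilon)
  then show "z \<in> H"
    using zS K \<open>K \<noteq> {}\<close> unfolding H_def by blast
qed

end

section \<open>Smooth functions\<close>

definition smooth :: "('a::euclidean_space \<Rightarrow> 'b::real_normed_vector) \<Rightarrow> bool" where
  "smooth f \<longleftrightarrow> (\<forall>k. Ck_on k UNIV f)"

text \<open>Any derivative produced by the differentiation rules may be supplied in place of
  \<open>frechet_derivative\<close>.\<close>

lemma Ck_on_SucI:
  assumes "\<And>x. (f has_derivative f' x) (at x)" and "\<And>b. b \<in> Basis \<Longrightarrow> Ck_on k UNIV (\<lambda>x. f' x b)"
  shows "Ck_on (Suc k) UNIV f"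
proof -
  have "frechet_derivative f (at x) = f' x" for x
    using frechet_derivative_at[OF assms(1)] by simp
  then show ?thesis
    using assms by (auto simp: differentiable_def)
qed

lemma Ck_on_SucE:
  assumes "Ck_on (Suc k) UNIV f"
  obtains f' where "\<And>x. (f has_derivative f' x) (at x)" "\<And>b. b \<in> Basis \<Longrightarrow> Ck_on k UNIV (\<lambda>x. f' x b)"
  using assms that[of "\<lambda>x. frechet_derivative f (at x)"] by (simp add: frechet_derivative_works)

text \<open>The recursive clause speaks of the derivatives only, so lower orders have to be
  recovered by induction; at the base, differentiability gives continuity.\<close>

lemma Ck_on_Suc_imp: "Ck_on (Suc k) UNIV f \<Longrightarrow> Ck_on k UNIV f"
proof (induction k arbitrary: f)
  case 0
  then show ?case
    by (auto intro!: continuous_at_imp_continuous_on differentiable_imp_continuous_within)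
next
  case (Suc k)
  obtain f' where f': "\<And>x. (f has_derivative f' x) (at x)" "\<And>b. b \<in> Basis \<Longrightarrow> Ck_on (Suc k) UNIV (\<lambda>x. f' x b)"
    using Ck_on_SucE[OF Suc.prems] by blast
  show ?case
    using f' Suc.IH by (intro Ck_on_SucI[of f f']) blast+
qed

lemma Ck_on_const: "Ck_on k UNIV (\<lambda>x. c)"
proof (induction k arbitrary: c)
  case (Suc k)
  show ?case by (rule Ck_on_SucI[where f' = "\<lambda>_ _. 0"]) (auto simp: Suc)
qed simp

lemma Ck_on_linear:
  assumes "bounded_linear f"
  shows "Ck_on k UNIV f"
proof (cases k)
  case 0
  then show ?thesis using linear_continuous_on[OF assms] by simp
next
  case (Suc j)
  show ?thesis unfolding Suc
    by (rule Ck_on_SucI[where f' = "\<lambda>_. f"]) (use bounded_linear_imp_has_derivative[OF assms] Ck_on_const in auto)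
qed

lemma Ck_on_add: "Ck_on k UNIV f \<Longrightarrow> Ck_on k UNIV g \<Longrightarrow> Ck_on k UNIV (\<lambda>x. f x + g x)"
proof (induction k arbitrary: f g)
  case 0
  then show ?case by (simp add: continuous_on_add)
next
  case (Suc k)
  obtain f' where f': "\<And>x. (f has_derivative f' x) (at x)" "\<And>b. b \<in> Basis \<Longrightarrow> Ck_on k UNIV (\<lambda>x. f' x b)"
    using Ck_on_SucE[OF Suc.prems(1)] by blast
  obtain g' where g': "\<And>x. (g has_derivative g' x) (at x)" "\<And>b. b \<in> Basis \<Longrightarrow> Ck_on k UNIV (\<lambda>x. g' x b)"
    using Ck_on_SucE[OF Suc.prems(2)] by blast
  show ?case
    using has_derivative_add[OF f'(1) g'(1)] Suc.IH[OF f'(2) g'(2)]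
    by (intro Ck_on_SucI[where f' = "\<lambda>x h. f' x h + g' x h"]) auto
qed

lemma Ck_on_scaleR: "Ck_on k UNIV f \<Longrightarrow> Ck_on k UNIV g \<Longrightarrow> Ck_on k UNIV (\<lambda>x. f x *\<^sub>R g x)"
proof (induction k arbitrary: f g)
  case 0
  then show ?case by (simp add: continuous_on_scaleR)
next
  case (Suc k)
  obtain f' where f': "\<And>x. (f has_derivative f' x) (at x)" "\<And>b. b \<in> Basis \<Longrightarrow> Ck_on k UNIV (\<lambda>x. f' x b)"
    using Ck_on_SucE[OF Suc.prems(1)] by blast
  obtain g' where g': "\<And>x. (g has_derivative g' x) (at x)" "\<And>b. b \<in> Basis \<Longrightarrow> Ck_on k UNIV (\<lambda>x. g' x b)"
    using Ck_on_SucE[OF Suc.prems(2)] by blast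
  note fg = Suc.prems[THEN Ck_on_Suc_imp]
  show ?case
    using has_derivative_scaleR[OF f'(1) g'(1)] fg f'(2) g'(2)
    by (intro Ck_on_SucI[where f' = "\<lambda>x h. f x *\<^sub>R g' x h + f' x h *\<^sub>R g x"] Ck_on_add Suc.IH) auto
qed

text \<open>With an outer function of one real variable the chain rule is a scalar multiple of the
  inner derivative, so the induction closes by the product rule alone.\<close>

lemma Ck_on_compose_real:
  fixes F :: "real \<Rightarrow> real"
  shows "Ck_on k UNIV F \<Longrightarrow> Ck_on k UNIV g \<Longrightarrow> Ck_on k UNIV (\<lambda>x. F (g x))"
proof (induction k arbitrary: F g)
  case 0
  then show ?case using continuous_on_compose2[of UNIV F UNIV g] by simp
next
  case (Suc k)
  obtain F' where F': "\<And>x. (F has_derivative F' x) (at x)" "\<And>b. b \<in> Basis \<Longrightarrow> Ck_on k UNIV (\<lambda>x. F' x b)"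
    using Ck_on_SucE[OF Suc.prems(1)] by blast
  obtain g' where g': "\<And>x. (g has_derivative g' x) (at x)" "\<And>b. b \<in> Basis \<Longrightarrow> Ck_on k UNIV (\<lambda>x. g' x b)"
    using Ck_on_SucE[OF Suc.prems(2)] by blast
  have lin: "F' x h = h * F' x 1" for x h
    using linear_scale[OF has_derivative_linear[OF F'(1)], of x h 1] by simp
  have "((\<lambda>x. F (g x)) has_derivative (\<lambda>h. F' (g x) (g' x h))) (at x)" for x
    using has_derivative_compose[OF g'(1) F'(1)] .
  moreover have "(\<lambda>h. F' (g x) (g' x h)) = (\<lambda>h. g' x h *\<^sub>R F' (g x) 1)" for x
    by (rule ext) (metis lin real_scaleR_def)
  ultimately show ?case
    using Suc.IH[OF F'(2)[of 1] Ck_on_Suc_imp[OF Suc.prems(2)]] g'(2)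
    by (intro Ck_on_SucI[where f' = "\<lambda>x h. g' x h *\<^sub>R F' (g x) 1"] Ck_on_scaleR) auto
qed

lemma smooth_const [simp]: "smooth (\<lambda>x. c)"
  by (simp add: smooth_def Ck_on_const)

lemma smooth_linear: "bounded_linear f \<Longrightarrow> smooth f"
  by (simp add: smooth_def Ck_on_linear)

lemma smooth_add: "smooth f \<Longrightarrow> smooth g \<Longrightarrow> smooth (\<lambda>x. f x + g x)"
  by (simp add: smooth_def Ck_on_add)

lemma smooth_scaleR: "smooth f \<Longrightarrow> smooth g \<Longrightarrow> smooth (\<lambda>x. f x *\<^sub>R g x)"
  by (simp add: smooth_def Ck_on_scaleR)

lemma smooth_mult: "smooth f \<Longrightarrow> smooth g \<Longrightarrow> smooth (\<lambda>x. f x * g x :: real)"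
  using smooth_scaleR[of f g] by simp

lemma smooth_diff: "smooth f \<Longrightarrow> smooth g \<Longrightarrow> smooth (\<lambda>x. f x - g x)"
  using smooth_add[of f "\<lambda>x. (- 1) *\<^sub>R g x"] smooth_scaleR[of "\<lambda>x. - 1" g] by simp

lemma smooth_sum: "(\<And>i. i \<in> I \<Longrightarrow> smooth (f i)) \<Longrightarrow> smooth (\<lambda>x. \<Sum>i\<in>I. f i x)"
  by (induction I rule: infinite_finite_induct) (auto intro: smooth_add)

lemma smooth_compose: "smooth F \<Longrightarrow> smooth g \<Longrightarrow> smooth (\<lambda>x. F (g x) :: real)"
  for F :: "real \<Rightarrow> real"
  by (simp add: smooth_def Ck_on_compose_real)

lemma smooth_inner_left: "smooth (\<lambda>x. b \<bullet> x)"
  by (rule smooth_linear) (rule bounded_linear_inner_right)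

lemma smooth_norm_square: "smooth (\<lambda>x. (norm (x - c))\<^sup>2)"
proof -
  have "(\<lambda>x. (norm (x - c))\<^sup>2) = (\<lambda>x. \<Sum>b\<in>Basis. (b \<bullet> x - b \<bullet> c) * (b \<bullet> x - b \<bullet> c))"
    unfolding power2_norm_eq_inner by (subst euclidean_inner) (simp add: inner_diff_right inner_commute)
  then show ?thesis
    by (auto intro!: smooth_sum smooth_mult smooth_diff smooth_inner_left)
qed

lemma smooth_has_derivative: "smooth f \<Longrightarrow> (f has_derivative frechet_derivative f (at x)) (at x)"
  unfolding smooth_def frechet_derivative_works[symmetric] using Ck_on.simps(2)[of 0 UNIV f] by blast

lemma smooth_differentiable: "smooth f \<Longrightarrow> f differentiable (at x)"
  using smooth_has_derivative by (auto simp: differentiable_def)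

lemma smooth_continuous: "smooth f \<Longrightarrow> continuous_on S f"
  unfolding smooth_def using Ck_on.simps(1)[of UNIV f] continuous_on_subset by blast

lemma linear_Basis_expansion:
  assumes "linear f"
  shows "f v = (\<Sum>b\<in>Basis. (v \<bullet> b) *\<^sub>R f b)"
proof -
  have "f v = f (\<Sum>b\<in>Basis. (v \<bullet> b) *\<^sub>R b)" by (simp add: euclidean_representation)
  then show ?thesis by (simp add: linear_sum[OF assms] linear_scale[OF assms])
qed

lemma smooth_derivative:
  assumes "smooth f"
  shows "smooth (\<lambda>x. frechet_derivative f (at x) v)"
proof -
  have "smooth (\<lambda>x. frechet_derivative f (at x) b)" if "b \<in> Basis" for b
    using assms that Ck_on.simps(2)[of _ UNIV f] unfolding smooth_def by blast
  then have "smooth (\<lambda>x. \<Sum>b\<in>Basis. (v \<bullet> b) *\<^sub>R frechet_derivative f (at x) b)"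
    by (intro smooth_sum smooth_scaleR) auto
  moreover have "frechet_derivative f (at x) v = (\<Sum>b\<in>Basis. (v \<bullet> b) *\<^sub>R frechet_derivative f (at x) b)" for x
    by (rule linear_Basis_expansion[OF has_derivative_linear[OF smooth_has_derivative[OF assms]]])
  ultimately show ?thesis by simp
qed

lemma smooth_realI:
  fixes F :: "real \<Rightarrow> real"
  assumes "\<And>x. (F has_real_derivative f x) (at x)" and "smooth f"
  shows "smooth F"
  unfolding smooth_def
proof
  fix k
  have "(\<lambda>x. f x * (1::real)) = f" by simp
  then have "Ck_on (Suc k) UNIV F"
    using assms by (intro Ck_on_SucI[where f' = "\<lambda>x h. f x * h"])
      (auto simp: smooth_def has_field_derivative_def)
  then show "Ck_on k UNIV F" by (rule Ck_on_Suc_imp)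
qed

text \<open>The family of all \<open>p(1/x) exp(-1/x)\<close>, extended by zero to the left, is closed under
  differentiation.\<close>

definition flat :: "real poly \<Rightarrow> real \<Rightarrow> real" where
  "flat p x = (if x \<le> 0 then 0 else poly p (inverse x) * exp (- inverse x))"

lemma tendsto_poly_exp: "((\<lambda>y. poly p y * exp (- y)) \<longlongrightarrow> 0) at_top" for p :: "real poly"
proof -
  have "((\<lambda>y. \<Sum>i\<le>degree p. coeff p i * (y ^ i / exp y)) \<longlongrightarrow> (\<Sum>i\<le>degree p. coeff p i * 0)) at_top"
    by (intro tendsto_intros tendsto_power_div_exp_0)
  moreover have "(\<lambda>y. \<Sum>i\<le>degree p. coeff p i * (y ^ i / exp y)) = (\<lambda>y. poly p y * exp (- y))"
    by (simp add: poly_altdef sum_distrib_left exp_minus divide_inverse mult_ac)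
  ultimately show ?thesis by simp
qed

text \<open>In terms of \<open>y = inverse x\<close>, differentiating
  \<open>poly p y * exp (- y)\<close> with respect to \<open>x\<close> produces the factor
  \<open>y * y\<close> and the polynomial \<open>p - pderiv p\<close>. At 0 both one-sided
  difference quotients tend to 0.\<close>

lemma flat_derivative:
  "(flat p has_real_derivative flat (monom 1 2 * (p - pderiv p)) x) (at x)"
proof (cases "x = 0")
  case False
  show ?thesis
  proof (cases "x < 0")
    case True
    have "((\<lambda>x. 0) has_real_derivative 0) (at x)" by simp
    then have "(flat p has_real_derivative 0) (at x)"
      by (rule has_field_derivative_transform_within_open[where S = "{..<0}"]) (use True in \<open>auto simp: flat_def\<close>)
    then show ?thesis using True by (simp add: flat_def)
  next
    case False
    then have x: "x > 0" using \<open>x \<noteq> 0\<close> by simp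
    have "((\<lambda>x. poly p (inverse x) * exp (- inverse x)) has_real_derivative
        flat (monom 1 2 * (p - pderiv p)) x) (at x)"
      using x by (auto intro!: derivative_eq_intros DERIV_chain'[OF _ poly_DERIV]
          simp: flat_def poly_monom power2_eq_square algebra_simps)
    then show ?thesis
      by (rule has_field_derivative_transform_within_open[where S = "{0<..}"]) (use x in \<open>auto simp: flat_def\<close>)
  qed
next
  case True
  \<comment> \<open>The factor \<open>1 / h\<close> of the difference quotient is absorbed by
    multiplying the polynomial by its variable.\<close>
  have "((\<lambda>y. poly (pCons 0 p) y * exp (- y)) \<longlongrightarrow> 0) at_top" by (rule tendsto_poly_exp)
  then have "((\<lambda>h. poly (pCons 0 p) (inverse h) * exp (- inverse h)) \<longlongrightarrow> 0) (at_right 0)"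
    by (rule filterlim_compose[OF _ filterlim_inverse_at_top_right])
  then have r: "((\<lambda>h. (flat p (0 + h) - flat p 0) / h) \<longlongrightarrow> 0) (at_right 0)"
    by (rule Lim_transform_eventually)
      (auto simp: flat_def eventually_at_right_field field_simps intro!: exI[of _ 1])
  have l: "((\<lambda>h. (flat p (0 + h) - flat p 0) / h) \<longlongrightarrow> 0) (at_left 0)"
    by (rule Lim_transform_eventually[OF tendsto_const])
      (auto simp: flat_def eventually_at_left_field intro!: exI[of _ "-1"])
  show ?thesis
    using filterlim_split_at[OF l r] True unfolding DERIV_def by (simp add: flat_def)
qed

lemma smooth_flat: "smooth (flat p)"
  unfolding smooth_def
proof
  fix k show "Ck_on k UNIV (flat p)"
  proof (induction k arbitrary: p)
    case 0
    show ?case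
      using flat_derivative by (auto intro!: continuous_at_imp_continuous_on DERIV_isCont)
  next
    case (Suc k)
    have "(\<lambda>x. flat q x * (1::real)) = flat q" for q by simp
    then show ?case
      using flat_derivative Suc by (intro Ck_on_SucI[where f' = "\<lambda>x h. flat (monom 1 2 * (p - pderiv p)) x * h"])
        (auto simp: has_field_derivative_def)
  qed
qed

lemma flat_1: "flat 1 x \<ge> 0" "flat 1 x > 0 \<longleftrightarrow> x > 0" "x \<le> 0 \<Longrightarrow> flat 1 x = 0"
  by (auto simp: flat_def)

section \<open>Smooth steps and cutoff functions\<close>

lemma antiderivative:
  fixes f :: "real \<Rightarrow> real"
  assumes "continuous_on UNIV f"
  obtains F where "\<And>x. (F has_real_derivative f x) (at x)"
proof -
  obtain F where "\<forall>x::real. -\<infinity> < ereal x \<longrightarrow> ereal x < \<infinity> \<longrightarrow> (F has_vector_derivative f x) (at x)"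
    using einterval_antiderivative[of "-\<infinity>" "\<infinity>" f] assms
    by (auto simp: continuous_on_eq_continuous_at)
  then show thesis
    using that[of F] by (simp add: has_real_derivative_iff_has_vector_derivative)
qed

text \<open>A normalised primitive of the product of \<open>flat 1 x\<close> and
  \<open>flat 1 (1 - x)\<close>, which is positive exactly on the open unit interval.\<close>

lemma smooth_step:
  obtains S :: "real \<Rightarrow> real" where "smooth S" "\<And>x. x \<le> 0 \<Longrightarrow> S x = 0" "\<And>x. x \<ge> 1 \<Longrightarrow> S x = 1"
    "\<And>x. 0 \<le> S x" "\<And>x. S x \<le> 1"
proof -
  define f where "f x = flat 1 x * flat 1 (1 - x)" for x
  have f: "smooth f"
    unfolding f_def using smooth_linear[OF bounded_linear_ident]
    by (intro smooth_mult smooth_flat smooth_compose[OF smooth_flat] smooth_diff) auto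
  obtain I where I: "\<And>x. (I has_real_derivative f x) (at x)"
    using antiderivative[OF smooth_continuous[OF f]] by blast
  have mono: "I x \<le> I y" if "x \<le> y" for x y
    using DERIV_nonneg_imp_nondecreasing[OF that, of I] I flat_1(1) by (metis f_def mult_nonneg_nonneg)
  have flat0: "I x = I 0" if "x \<le> 0" for x
  proof -
    have "\<exists>y. DERIV I u :> y \<and> y \<le> 0" if "x \<le> u" "u \<le> 0" for u
      using I[of u] flat_1(3)[of u] that by (intro exI[of _ "f u"]) (auto simp: f_def)
    then have "I 0 \<le> I x" using DERIV_nonpos_imp_nonincreasing[OF that, of I] by blast
    then show ?thesis using mono[OF that] by linarith
  qed
  have flat1: "I x = I 1" if "x \<ge> 1" for x
  proof -
    have "\<exists>y. DERIV I u :> y \<and> y \<le> 0" if "1 \<le> u" "u \<le> x" for u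
      using I[of u] flat_1(3)[of "1 - u"] that by (intro exI[of _ "f u"]) (auto simp: f_def)
    then have "I x \<le> I 1" using DERIV_nonpos_imp_nonincreasing[OF that, of I] by blast
    then show ?thesis using mono[OF that] by linarith
  qed
  have pos: "I 0 < I 1"
  proof (rule DERIV_pos_imp_increasing_open[of 0 1 I])
    fix x :: real assume "0 < x" "x < 1"
    then show "\<exists>y. DERIV I x :> y \<and> 0 < y"
      using I[of x] flat_1(2) by (intro exI[of _ "f x"]) (auto simp: f_def)
  next
    show "continuous_on {0..1} I" using I by (auto intro!: continuous_at_imp_continuous_on DERIV_isCont)
  qed simp
  have between: "I 0 \<le> I x" "I x \<le> I 1" for x
    using flat0[of x] mono[of 0 x] flat1[of x] mono[of x 1] pos by (cases "x \<le> 0"; cases "x \<le> 1"; force)+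
  define S where "S x = (1 / (I 1 - I 0)) * (I x - I 0)" for x
  show thesis
  proof (rule that[of S])
    show "smooth S"
      unfolding S_def using smooth_realI[OF I f] by (intro smooth_mult smooth_diff) auto
    show "S x = 0" if "x \<le> 0" for x using flat0[OF that] by (simp add: S_def)
    show "S x = 1" if "x \<ge> 1" for x using flat1[OF that] pos by (simp add: S_def)
    show "0 \<le> S x" for x using between(1)[of x] pos by (simp add: S_def)
    show "S x \<le> 1" for x using between(2)[of x] pos by (simp add: S_def)
  qed
qed

lemma test_functions_iff: "\<phi> \<in> test_functions \<Omega> \<longleftrightarrow> smooth \<phi> \<and>
     compact (closure {x. \<phi> x \<noteq> 0}) \<and> closure {x. \<phi> x \<noteq> 0} \<subseteq> \<Omega>"
  by (auto simp: test_functions_def smooth_def)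

lemma test_functionsI:
  assumes "smooth \<phi>" "compact K" "K \<subseteq> \<Omega>" "\<And>x. x \<notin> K \<Longrightarrow> \<phi> x = 0"
  shows "\<phi> \<in> test_functions \<Omega>"
proof -
  have "closure {x. \<phi> x \<noteq> 0} \<subseteq> K"
    using assms by (intro closure_minimal compact_imp_closed) auto
  then show ?thesis
    unfolding test_functions_iff using assms compact_Int_closed[OF assms(2) closed_closure, of "{x. \<phi> x \<noteq> 0}"]
    by (auto simp: Int_absorb1)
qed

text \<open>A finite sum of bumps on balls covering \<open>K\<close> is positive on
  \<open>K\<close>. Divided by its minimum over \<open>K\<close> and composed with a smooth step, it
  becomes 1 there, while its support stays in the union of the closed balls.\<close>

lemma smooth_cutoff:
  fixes K :: "'a::euclidean_space set"
  assumes "compact K" "open D" "K \<subseteq> D"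
  obtains \<psi> :: "'a \<Rightarrow> real" where "\<psi> \<in> test_functions D" "\<And>x. x \<in> K \<Longrightarrow> \<psi> x = 1"
    "\<And>x. 0 \<le> \<psi> x" "\<And>x. \<psi> x \<le> 1"
proof (cases "K = {}")
  case True
  show thesis
    by (rule that[of "\<lambda>x. 0"]) (use True in \<open>auto intro!: test_functionsI[of _ "{}"]\<close>)
next
  case False
  have "\<forall>c\<in>K. \<exists>r>0. cball c r \<subseteq> D" using assms open_contains_cball by blast
  then obtain r where r: "\<And>c. c \<in> K \<Longrightarrow> r c > 0" "\<And>c. c \<in> K \<Longrightarrow> cball c (r c) \<subseteq> D" by metis
  obtain F where F: "F \<subseteq> K" "finite F" "K \<subseteq> (\<Union>c\<in>F. ball c (r c))"
  proof (rule compactE_image[OF assms(1), of K "\<lambda>c. ball c (r c)"])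
    show "K \<subseteq> (\<Union>c\<in>K. ball c (r c))" using r(1) by force
  qed auto
  define \<beta> where "\<beta> x = (\<Sum>c\<in>F. flat 1 ((r c)\<^sup>2 - (norm (x - c))\<^sup>2))" for x
  have sm: "smooth \<beta>"
    unfolding \<beta>_def by (intro smooth_sum smooth_compose[OF smooth_flat] smooth_diff smooth_norm_square) auto
  have pos: "\<beta> x > 0" if xK: "x \<in> K" for x
  proof -
    obtain c where c: "c \<in> F" "x \<in> ball c (r c)" using F xK by blast
    then have "(norm (x - c))\<^sup>2 < (r c)\<^sup>2"
      by (intro power_strict_mono) (auto simp: dist_norm norm_minus_commute)
    then have "0 < flat 1 ((r c)\<^sup>2 - (norm (x - c))\<^sup>2)" using flat_1(2) by simp
    also have "\<dots> \<le> \<beta> x"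
      unfolding \<beta>_def using F c flat_1(1) by (intro member_le_sum) auto
    finally show ?thesis .
  qed
  obtain x0 where x0: "x0 \<in> K" "\<And>x. x \<in> K \<Longrightarrow> \<beta> x0 \<le> \<beta> x"
    using continuous_attains_inf[OF assms(1) False smooth_continuous[OF sm]] by blast
  obtain S :: "real \<Rightarrow> real" where S: "smooth S" "\<And>x. x \<le> 0 \<Longrightarrow> S x = 0" "\<And>x. x \<ge> 1 \<Longrightarrow> S x = 1"
    "\<And>x. 0 \<le> S x" "\<And>x. S x \<le> 1" using smooth_step by metis
  define \<psi> where "\<psi> x = S ((1 / \<beta> x0) * \<beta> x)" for x
  show thesis
  proof (rule that[of \<psi>])
    show "\<psi> \<in> test_functions D"
    proof (rule test_functionsI)
      show "smooth \<psi>" unfolding \<psi>_def by (rule smooth_compose[OF S(1) smooth_mult[OF smooth_const sm]])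
      show "compact (\<Union>c\<in>F. cball c (r c))" using F(2) by (rule compact_UN) simp
      show "(\<Union>c\<in>F. cball c (r c)) \<subseteq> D" using F(1) r(2) by (meson UN_least subsetD)
      fix x assume x: "x \<notin> (\<Union>c\<in>F. cball c (r c))"
      have "flat 1 ((r c)\<^sup>2 - (norm (x - c))\<^sup>2) = 0" if "c \<in> F" for c
      proof -
        have "r c \<le> norm (x - c)" using x that by (auto simp: dist_norm norm_minus_commute)
        then have "(r c)\<^sup>2 \<le> (norm (x - c))\<^sup>2" using r(1)[of c] F that by (intro power_mono) auto
        then show ?thesis by (intro flat_1(3)) simp
      qed
      then show "\<psi> x = 0" by (simp add: \<psi>_def \<beta>_def S(2))
    qed
    show "\<psi> x = 1" if "x \<in> K" for x
      using x0(2)[OF that] pos[OF x0(1)] by (simp add: \<psi>_def S(3))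
    show "0 \<le> \<psi> x" "\<psi> x \<le> 1" for x by (simp_all add: \<psi>_def S(4,5))
  qed
qed

section \<open>Integration by parts and the fundamental lemma\<close>

lemma compactly_supported_continuous:
  fixes g :: "'a::euclidean_space \<Rightarrow> 'b::euclidean_space"
  assumes A: "open A" and K: "compact K" "K \<subseteq> A" and g: "continuous_on A g" and 0: "\<And>x. x \<notin> K \<Longrightarrow> g x = 0"
  shows "continuous_on UNIV g" "integrable lborel g"
proof -
  have "continuous_on (- K) g"
    using continuous_on_const[of "- K" 0] by (rule continuous_on_eq) (use 0 in auto)
  then have "continuous_on (A \<union> - K) g"
    using A K g by (intro continuous_on_open_Un) (auto simp: compact_imp_closed open_Compl)
  moreover have "A \<union> - K = UNIV" using K by auto
  ultimately show c: "continuous_on UNIV g" by simp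
  have "(\<lambda>x. indicator K x *\<^sub>R g x) = g" using 0 by (auto simp: indicator_def)
  then show "integrable lborel g"
    using borel_integrable_compact[OF K(1) continuous_on_subset[OF c subset_UNIV]] by simp
qed

lemma has_derivative_real_line:
  fixes f :: "'a::real_normed_vector \<Rightarrow> real"
  assumes "(f has_derivative f') (at (x + s *\<^sub>R v))"
  shows "((\<lambda>s. f (x + s *\<^sub>R v)) has_real_derivative f' v) (at s)"
proof -
  have "((\<lambda>s. x + s *\<^sub>R v) has_derivative (\<lambda>h. h *\<^sub>R v)) (at s)"
    by (auto intro!: derivative_eq_intros)
  from has_derivative_compose[OF this assms]
  have "((\<lambda>s. f (x + s *\<^sub>R v)) has_derivative (\<lambda>h. f' (h *\<^sub>R v))) (at s)" .
  moreover have "f' (h *\<^sub>R v) = f' v * h" for h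
    using linear_scale[OF has_derivative_linear[OF assms], of h v] by simp
  ultimately show ?thesis by (simp add: has_field_derivative_def)
qed

lemma translation_lborel:
  fixes f :: "'a::euclidean_space \<Rightarrow> real"
  assumes "integrable lborel f"
  shows "integrable lborel (\<lambda>x. f (x + c))" "(\<integral>x. f (x + c) \<partial>lborel) = (\<integral>x. f x \<partial>lborel)"
proof -
  have f: "f \<in> borel_measurable borel" using assms by (simp add: borel_measurable_integrable)
  have "integrable (distr lborel borel ((+) c)) f" using assms by (simp add: lborel_distr_plus)
  then show "integrable lborel (\<lambda>x. f (x + c))"
    using integrable_distr_eq[of "(+) c" lborel borel f] f by (simp add: add.commute)
  have "(\<integral>x. f x \<partial>lborel) = (\<integral>x. f x \<partial>distr lborel borel ((+) c))" by (simp add: lborel_distr_plus)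
  also have "\<dots> = (\<integral>x. f (c + x) \<partial>lborel)" by (rule integral_distr) (use f in auto)
  finally show "(\<integral>x. f (x + c) \<partial>lborel) = (\<integral>x. f x \<partial>lborel)" by (simp add: add.commute)
qed

text \<open>By translation invariance every difference quotient in direction \<open>v\<close> has
  integral 0. Dominated convergence carries this over to the derivative, without iterated
  integrals.\<close>

lemma integral_derivative_compact_support:
  fixes f :: "'a::euclidean_space \<Rightarrow> real"
  assumes der: "\<And>x. (f has_derivative f' x) (at x)" and cont: "continuous_on UNIV (\<lambda>x. f' x v)"
    and K: "compact K" and 0: "\<And>x. x \<notin> K \<Longrightarrow> f x = 0"
  shows "(\<integral>x. f' x v \<partial>lborel) = 0"
proof -
  obtain r where r: "\<And>x. x \<in> K \<Longrightarrow> norm x \<le> r"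
    using compact_imp_bounded[OF K] unfolding bounded_iff by blast
  \<comment> \<open>As the step lengths are at most 1, all difference quotients vanish outside this
    ball. The bound \<open>B\<close> is taken on a ball larger by \<open>norm v\<close>, which
    contains the intermediate points of the mean value estimate.\<close>
  define Q where "Q = cball (0::'a) (r + norm v)"
  have "compact ((\<lambda>x. f' x v) ` cball 0 (r + 2 * norm v))"
    by (intro compact_continuous_image continuous_on_subset[OF cont] compact_cball subset_UNIV)
  then have "bounded ((\<lambda>x. f' x v) ` cball 0 (r + 2 * norm v))"
    by (rule compact_imp_bounded)
  then obtain B where B': "\<forall>y\<in>(\<lambda>x. f' x v) ` cball 0 (r + 2 * norm v). norm y \<le> B"
    unfolding bounded_iff by (rule exE)
  have B: "\<bar>f' x v\<bar> \<le> B" if "x \<in> cball 0 (r + 2 * norm v)" for x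
    using bspec[OF B' imageI[OF that]] by simp
  define c where "c n = inverse (real (Suc n))" for n
  have c: "0 < c n" "c n \<le> 1" for n by (auto simp: c_def field_simps)
  define s where "s n x = (f (x + c n *\<^sub>R v) - f x) / c n" for n x
  have fi: "integrable lborel f"
    using der K 0 by (intro compactly_supported_continuous(2)[of UNIV K])
      (auto intro!: continuous_at_imp_continuous_on has_derivative_continuous)
  have s0: "integrable lborel (s n)" "(\<integral>x. s n x \<partial>lborel) = 0" for n
    unfolding s_def using translation_lborel[OF fi, of "c n *\<^sub>R v"] fi by auto
  have sB: "norm (s n x) \<le> B * indicator Q x" for n x
  proof (cases "x \<in> Q")
    case False
    then have "norm x > r + norm v" by (simp add: Q_def)
    moreover have "norm (c n *\<^sub>R v) \<le> norm v" using c[of n] by (simp add: mult_left_le_one_le)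
    moreover have "norm x \<le> norm (x + c n *\<^sub>R v) + norm (c n *\<^sub>R v)"
      using norm_triangle_ineq4[of "x + c n *\<^sub>R v" "c n *\<^sub>R v"] by simp
    ultimately have "r < norm x \<and> r < norm (x + c n *\<^sub>R v)" using norm_ge_zero[of v] by linarith
    then have "x \<notin> K" "x + c n *\<^sub>R v \<notin> K" using r[of x] r[of "x + c n *\<^sub>R v"] by linarith+
    then show ?thesis using False 0 by (simp add: s_def)
  next
    case True
    have "norm (f (x + c n *\<^sub>R v) - f (x + 0 *\<^sub>R v)) \<le> B * norm (c n - 0)"
    proof (rule field_differentiable_bound[where S = "{0..c n}"])
      fix z assume z: "z \<in> {0..c n}"
      show "((\<lambda>s. f (x + s *\<^sub>R v)) has_real_derivative f' (x + z *\<^sub>R v) v) (at z within {0..c n})"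
        using has_derivative_real_line[OF der] by (rule DERIV_subset) simp
      have "norm (z *\<^sub>R v) \<le> norm v" using z c[of n] by (simp add: mult_left_le_one_le)
      moreover have "norm x \<le> r + norm v" using True by (simp add: Q_def)
      ultimately have "norm (x + z *\<^sub>R v) \<le> r + 2 * norm v"
        using norm_triangle_ineq[of x "z *\<^sub>R v"] by linarith
      then show "norm (f' (x + z *\<^sub>R v) v) \<le> B" using B by simp
    qed (use c[of n] in auto)
    then show ?thesis using True c[of n] by (simp add: s_def field_simps)
  qed
  have lim: "(\<lambda>n. s n x) \<longlonglongrightarrow> f' x v" for x
  proof -
    have "((\<lambda>h. (f (x + (0 + h) *\<^sub>R v) - f (x + 0 *\<^sub>R v)) / h) \<longlongrightarrow> f' (x + 0 *\<^sub>R v) v) (at 0)"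
      using has_derivative_real_line[where x = x and s = 0 and v = v, OF der] unfolding DERIV_def .
    moreover have "filterlim c (at 0) sequentially"
      unfolding c_def using LIMSEQ_inverse_real_of_nat by (intro filterlim_atI) auto
    ultimately show ?thesis
      using filterlim_compose[of _ _ "at 0" c sequentially] by (fastforce simp: s_def)
  qed
  have Qi: "integrable lborel (\<lambda>x. B * indicator Q x)"
    unfolding Q_def by (intro integrable_mult_right integrable_real_indicator) (auto simp: emeasure_bounded_finite[OF bounded_cball, simplified])
  have "(\<lambda>n. \<integral>x. s n x \<partial>lborel) \<longlonglongrightarrow> (\<integral>x. f' x v \<partial>lborel)"
    by (rule integral_dominated_convergence[OF _ _ Qi])
      (use lim sB s0(1) cont in \<open>auto intro: borel_measurable_continuous_onI\<close>)
  then have "(\<lambda>n. 0) \<longlonglongrightarrow> (\<integral>x. f' x v \<partial>lborel)" using s0(2) by simp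
  from LIMSEQ_unique[OF tendsto_const this] show ?thesis by simp
qed

lemma integral_lebesgue_on_support:
  fixes g :: "'a::euclidean_space \<Rightarrow> real"
  assumes "\<Omega> \<in> sets lebesgue" "K \<subseteq> \<Omega>" "\<And>x. x \<notin> K \<Longrightarrow> g x = 0" "g \<in> borel_measurable borel"
  shows "(LINT x|lebesgue_on \<Omega>. g x) = (\<integral>x. g x \<partial>lborel)"
proof -
  have "(LINT x|lebesgue_on \<Omega>. g x) = (LINT x|lebesgue. indicator \<Omega> x *\<^sub>R g x)"
    using assms(1) by (subst integral_restrict_space) auto
  also have "(\<lambda>x. indicator \<Omega> x *\<^sub>R g x) = g" using assms(2,3) by (fastforce simp: indicator_def)
  finally show ?thesis using assms(4) by (simp add: integral_completion)
qed

lemma test_function_support: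
  assumes "\<phi> \<in> test_functions A"
  obtains K where "compact K" "K \<subseteq> A" "\<And>x. x \<notin> K \<Longrightarrow> \<phi> x = 0" "\<And>x. x \<notin> K \<Longrightarrow> frechet_derivative \<phi> (at x) = (\<lambda>_. 0)"
proof (rule that)
  let ?K = "closure {x. \<phi> x \<noteq> 0}"
  show "compact ?K" "?K \<subseteq> A" using assms by (auto simp: test_functions_iff)
  show 0: "\<phi> x = 0" if "x \<notin> ?K" for x
    using that closure_subset[of "{x. \<phi> x \<noteq> 0}"] by blast
  show "frechet_derivative \<phi> (at x) = (\<lambda>_. 0)" if "x \<notin> ?K" for x
  proof -
    have "((\<lambda>_. 0) has_derivative (\<lambda>_. 0)) (at x)" by simp
    then have "(\<phi> has_derivative (\<lambda>_. 0)) (at x)"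
    proof (rule has_derivative_transform_within_open)
      show "open (- ?K)" by (simp add: open_Compl)
      show "x \<in> - ?K" using that by simp
      show "0 = \<phi> y" if "y \<in> - ?K" for y using 0[of y] that by simp
    qed
    then show ?thesis by (rule frechet_derivative_at[symmetric])
  qed
qed

text \<open>The product with \<open>\<psi>\<close>, extended by zero, is differentiable everywhere
  although \<open>f\<close> need only be so in \<open>A\<close>; its derivative has integral 0. The
  integrals are taken over a larger set \<open>\<Omega>\<close> because weak gradients on
  \<open>\<Omega>\<close> will be tested with functions supported in a smaller open set.\<close>

lemma integration_by_parts:
  fixes f :: "'a::euclidean_space \<Rightarrow> real"
  assumes A: "open A" "A \<subseteq> \<Omega>" "\<Omega> \<in> sets lebesgue"
    and der: "\<And>x. x \<in> A \<Longrightarrow> (f has_derivative f' x) (at x)" and cont: "continuous_on A (\<lambda>x. f' x v)"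
    and \<psi>: "\<psi> \<in> test_functions A"
  shows "(LINT x|lebesgue_on \<Omega>. f x * frechet_derivative \<psi> (at x) v) = - (LINT x|lebesgue_on \<Omega>. f' x v * \<psi> x)"
proof -
  obtain K where K: "compact K" "K \<subseteq> A" "\<And>x. x \<notin> K \<Longrightarrow> \<psi> x = 0"
     "\<And>x. x \<notin> K \<Longrightarrow> frechet_derivative \<psi> (at x) = (\<lambda>_. 0)"
    using test_function_support[OF \<psi>] by metis
  have sm: "smooth \<psi>" using \<psi> by (simp add: test_functions_iff)
  let ?d = "\<lambda>x. frechet_derivative \<psi> (at x)"
  define D where "D x h = (if x \<in> K then f x * ?d x h + f' x h * \<psi> x else 0)" for x h
  have Dv: "D x h = f x * ?d x h + f' x h * \<psi> x" for x h
    using K by (simp add: D_def)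
  have cf: "continuous_on A f"
    using der by (auto intro!: continuous_at_imp_continuous_on has_derivative_continuous)
  have c1: "continuous_on A (\<lambda>x. f x * ?d x v)" and c2: "continuous_on A (\<lambda>x. f' x v * \<psi> x)"
    by (intro continuous_intros cf cont smooth_continuous sm smooth_derivative[OF sm])+
  have i1: "integrable lborel (\<lambda>x. f x * ?d x v)" and i2: "integrable lborel (\<lambda>x. f' x v * \<psi> x)"
    using compactly_supported_continuous(2)[OF A(1) K(1,2) c1] compactly_supported_continuous(2)[OF A(1) K(1,2) c2] K
    by auto
  have "(\<integral>x. D x v \<partial>lborel) = 0"
  proof (rule integral_derivative_compact_support[where f = "\<lambda>x. f x * \<psi> x"])
    fix x
    show "((\<lambda>x. f x * \<psi> x) has_derivative D x) (at x)"
    proof (cases "x \<in> A")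
      case True
      show ?thesis unfolding Dv[abs_def]
        using has_derivative_mult[OF der[OF True] smooth_has_derivative[OF sm]] by simp
    next
      case False
      have "((\<lambda>_. 0) has_derivative (\<lambda>_. 0)) (at x)" by simp
      then have "((\<lambda>x. f x * \<psi> x) has_derivative (\<lambda>_. 0)) (at x)"
        by (rule has_derivative_transform_within_open[where s = "- K"])
          (use False K in \<open>auto simp: compact_imp_closed open_Compl\<close>)
      moreover have "x \<notin> K" using False K(2) by blast
      ultimately show ?thesis unfolding D_def by simp
    qed
  next
    show "continuous_on UNIV (\<lambda>x. D x v)"
      using compactly_supported_continuous(1)[OF A(1) K(1,2), of "\<lambda>x. D x v"] continuous_on_add[OF c1 c2]
      unfolding Dv using K by auto
  qed (use K in auto)
  then have "(\<integral>x. f x * ?d x v \<partial>lborel) = - (\<integral>x. f' x v * \<psi> x \<partial>lborel)"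
    unfolding Dv using Bochner_Integration.integral_add[OF i1 i2] by simp
  moreover have "(LINT x|lebesgue_on \<Omega>. f x * ?d x v) = (\<integral>x. f x * ?d x v \<partial>lborel)"
    using K A i1 by (intro integral_lebesgue_on_support[of _ K]) auto
  moreover have "(LINT x|lebesgue_on \<Omega>. f' x v * \<psi> x) = (\<integral>x. f' x v * \<psi> x \<partial>lborel)"
    using K A i2 by (intro integral_lebesgue_on_support[of _ K]) auto
  ultimately show ?thesis by simp
qed

text \<open>Cutoffs supported in shrinking neighbourhoods of \<open>K\<close> converge pointwise to
  its indicator. One compact set \<open>K'\<close> contains all their supports, which provides the
  dominating function for limits under the integral.\<close>

lemma cutoff_sequence:
  fixes K :: "'a::euclidean_space set"
  assumes "compact K" "open A" "K \<subseteq> A"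
  obtains \<psi> :: "nat \<Rightarrow> 'a \<Rightarrow> real" and K' where "compact K'" "K' \<subseteq> A" "\<And>n. \<psi> n \<in> test_functions A"
    "\<And>n x. x \<notin> K' \<Longrightarrow> \<psi> n x = 0" "\<And>n x. \<bar>\<psi> n x\<bar> \<le> 1" "\<And>x. (\<lambda>n. \<psi> n x) \<longlonglongrightarrow> indicator K x"
proof -
  obtain d where d: "d > 0" "(\<Union>x\<in>K. cball x d) \<subseteq> A"
    using compact_subset_open_imp_cball_epsilon_subset[OF assms] by blast
  define D where "D n = A \<inter> {x. infdist x K < d / real (Suc n)}" for n
  have oD: "open (D n)" for n
    unfolding D_def using assms(2) by (intro open_Int open_Collect_less continuous_intros) auto
  show thesis
  proof (cases "K = {}")
    case True
    show thesis
      by (rule that[of "{}" "\<lambda>_ _. 0"]) (use True in \<open>auto intro!: test_functionsI[of _ "{}"]\<close>)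
  next
    case False
    have K: "x \<in> D n" if "x \<in> K" for x n using that d assms by (auto simp: D_def)
    have "\<exists>\<psi>::'a \<Rightarrow> real. \<psi> \<in> test_functions (D n) \<and> (\<forall>x\<in>K. \<psi> x = 1) \<and> (\<forall>x. 0 \<le> \<psi> x \<and> \<psi> x \<le> 1)" for n
      using smooth_cutoff[OF assms(1) oD[of n]] K by (metis subsetI)
    then obtain \<psi> :: "nat \<Rightarrow> 'a \<Rightarrow> real" where \<psi>: "\<And>n. \<psi> n \<in> test_functions (D n)" "\<And>n x. x \<in> K \<Longrightarrow> \<psi> n x = 1"
      "\<And>n x. 0 \<le> \<psi> n x" "\<And>n x. \<psi> n x \<le> 1" by metis
    have \<psi>0: "\<psi> n x = 0" if "x \<notin> D n" for n x
      using \<psi>(1)[of n] that closure_subset[of "{x. \<psi> n x \<noteq> 0}"] by (auto simp: test_functions_iff)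
    let ?K' = "{x. infdist x K \<le> d}"
    have DK: "D n \<subseteq> ?K'" for n
    proof -
      have "d / real (Suc n) \<le> d" using d by (simp add: field_simps)
      then show ?thesis by (force simp: D_def)
    qed
    have "?K' \<subseteq> (\<Union>x\<in>K. cball x d)"
    proof
      fix x assume "x \<in> ?K'"
      obtain y where "y \<in> K" "infdist x K = dist x y"
        using infdist_attains_inf[OF compact_imp_closed[OF assms(1)] False] by blast
      then show "x \<in> (\<Union>x\<in>K. cball x d)" using \<open>x \<in> ?K'\<close> by (auto simp: dist_commute)
    qed
    then have K'A: "?K' \<subseteq> A" using d by blast
    show thesis
    proof (rule that[of ?K' \<psi>])
      show "compact ?K'"
        using compact_infdist_le[OF False assms(1) d(1)] .
      show "?K' \<subseteq> A" by (rule K'A)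
      show "\<psi> n \<in> test_functions A" for n using \<psi>(1)[of n] by (auto simp: test_functions_iff D_def)
      show "\<psi> n x = 0" if "x \<notin> ?K'" for n x using \<psi>0 that DK by blast
      show "\<bar>\<psi> n x\<bar> \<le> 1" for n x using \<psi>(3,4) by (simp add: abs_le_iff order_trans[OF _ \<psi>(3)])
      show "(\<lambda>n. \<psi> n x) \<longlonglongrightarrow> indicator K x" for x
      proof (cases "x \<in> K")
        case True
        then show ?thesis using \<psi>(2) by simp
      next
        case xK: False
        then have "infdist x K > 0"
          using infdist_pos_not_in_closed[OF compact_imp_closed[OF assms(1)] False] by auto
        moreover have "(\<lambda>n. d * inverse (real (Suc n))) \<longlonglongrightarrow> d * 0"
          by (intro tendsto_intros LIMSEQ_inverse_real_of_nat)
        ultimately have "eventually (\<lambda>n. d * inverse (real (Suc n)) < infdist x K) sequentially"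
          by (intro order_tendstoD(2)) auto
        then have "eventually (\<lambda>n. \<psi> n x = 0) sequentially"
          by (rule eventually_mono) (use \<psi>0 in \<open>auto simp: D_def divide_inverse\<close>)
        then show ?thesis using xK by (simp add: tendsto_eventually)
      qed
    qed
  qed
qed

text \<open>Cutoffs converging to an indicator show that \<open>h\<close> has integral 0 over each
  compact subset of \<open>A\<close>. If \<open>h\<close> had a sign on a set of positive measure,
  inner regularity would give a compact set of positive measure on which its integral cannot
  vanish.\<close>

lemma fundamental_lemma:
  fixes h :: "'a::euclidean_space \<Rightarrow> real"
  assumes A: "open A" and h: "locally_integrable_on h A"
    and 0: "\<And>\<psi>. \<psi> \<in> test_functions A \<Longrightarrow> (LINT x|lebesgue_on A. h x * \<psi> x) = 0"
  shows "AE x in lebesgue. x \<in> A \<longrightarrow> h x = 0"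
proof -
  have hK: "integrable lebesgue (\<lambda>x. indicator K x * h x)" if "compact K" "K \<subseteq> A" for K
    using h that unfolding locally_integrable_on_def set_integrable_def by simp
  have int0: "(LINT x|lebesgue. indicator K x * h x) = 0" if K: "compact K" "K \<subseteq> A" for K
  proof -
    obtain \<psi> :: "nat \<Rightarrow> 'a \<Rightarrow> real" and K' where \<psi>: "compact K'" "K' \<subseteq> A" "\<And>n. \<psi> n \<in> test_functions A"
      "\<And>n x. x \<notin> K' \<Longrightarrow> \<psi> n x = 0" "\<And>n x. \<bar>\<psi> n x\<bar> \<le> 1" "\<And>x. (\<lambda>n. \<psi> n x) \<longlonglongrightarrow> indicator K x"
      using cutoff_sequence[OF K(1) A K(2)] by metis
    let ?h = "\<lambda>x. indicator K' x * h x"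
    have eq: "indicator A x * (h x * \<psi> n x) = ?h x * \<psi> n x" for n x
      using \<psi>(2,4) by (auto simp: indicator_def)
    have KK': "K \<subseteq> K'"
    proof
      fix x assume "x \<in> K"
      show "x \<in> K'"
      proof (rule ccontr)
        assume "x \<notin> K'"
        then have "(\<lambda>n. \<psi> n x) \<longlonglongrightarrow> 0" using \<psi>(4) by simp
        from LIMSEQ_unique[OF this \<psi>(6)] show False using \<open>x \<in> K\<close> by simp
      qed
    qed
    have m: "\<psi> n \<in> borel_measurable lebesgue" for n
    proof -
      have "smooth (\<psi> n)" using \<psi>(3)[of n] by (simp add: test_functions_iff)
      then have "\<psi> n \<in> borel_measurable borel"
        by (rule borel_measurable_continuous_onI[OF smooth_continuous])
      then have "\<psi> n \<in> borel_measurable lborel" by simp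
      then show ?thesis by (rule measurable_completion)
    qed
    have "(\<lambda>n. LINT x|lebesgue. ?h x * \<psi> n x) \<longlonglongrightarrow> (LINT x|lebesgue. ?h x * indicator K x)"
    proof (rule integral_dominated_convergence[where w = "\<lambda>x. norm (?h x)"])
      show "integrable lebesgue (\<lambda>x. norm (?h x))" using hK[OF \<psi>(1,2)] by (rule integrable_norm)
      have hm: "?h \<in> borel_measurable lebesgue" using hK[OF \<psi>(1,2)] by (rule borel_measurable_integrable)
      show "(\<lambda>x. ?h x * \<psi> n x) \<in> borel_measurable lebesgue" for n
        using hm m by (rule borel_measurable_times)
      show "(\<lambda>x. ?h x * indicator K x) \<in> borel_measurable lebesgue"
        using hm by (rule borel_measurable_times)
          (use lmeasurable_compact[OF K(1)] in \<open>auto simp: fmeasurable_def intro: borel_measurable_indicator\<close>)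
      show "AE x in lebesgue. (\<lambda>n. ?h x * \<psi> n x) \<longlonglongrightarrow> ?h x * indicator K x"
        by (intro AE_I2 tendsto_intros \<psi>(6))
      show "AE x in lebesgue. norm (?h x * \<psi> n x) \<le> norm (?h x)" for n
        using \<psi>(5) by (intro AE_I2) (auto simp: abs_mult mult_left_le)
    qed
    moreover have "(LINT x|lebesgue. ?h x * \<psi> n x) = 0" for n
    proof -
      have "(LINT x|lebesgue_on A. h x * \<psi> n x) = (LINT x|lebesgue. indicator A x *\<^sub>R (h x * \<psi> n x))"
        using A by (subst integral_restrict_space) auto
      then show ?thesis using 0[OF \<psi>(3)] eq by simp
    qed
    moreover have "?h x * indicator K x = indicator K x * h x" for x
      using KK' by (auto simp: indicator_def)
    ultimately have "(\<lambda>n. 0) \<longlonglongrightarrow> (LINT x|lebesgue. indicator K x * h x)" by simp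
    from LIMSEQ_unique[OF tendsto_const this] show ?thesis by simp
  qed
  \<comment> \<open>The factor \<open>s\<close> will be 1 and -1, to treat the positive and the
    negative part at once.\<close>
  have null: "negligible {x \<in> A. s * h x > 0}" if s: "s \<noteq> 0" for s
  proof -
    obtain C :: "nat \<Rightarrow> 'a set" where C: "\<And>n. compact (C n)" "\<And>n. C n \<subseteq> A" "(\<Union>n. C n) = A"
    proof (rule open_Union_compact_subsets[OF A])
      fix C :: "nat \<Rightarrow> 'a set"
      assume "\<And>n. compact (C n)" "\<And>n. C n \<subseteq> A" "(\<Union>n. C n) = A"
      then show thesis by (rule that)
    qed
    have "negligible {x \<in> C n. s * h x > 0}" for n
    proof -
      let ?E = "{x \<in> C n. s * h x > 0}"
      have "(\<lambda>x. indicator (C n) x * h x) \<in> borel_measurable lebesgue"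
        using hK[OF C(1,2)] by (rule borel_measurable_integrable)
      then have "(\<lambda>x. s * (indicator (C n) x * h x)) \<in> borel_measurable lebesgue" by simp
      then have "{x \<in> space lebesgue. 0 < s * (indicator (C n) x * h x)} \<in> sets lebesgue"
        by (rule borel_measurable_less[OF borel_measurable_const])
      also have "{x \<in> space lebesgue. 0 < s * (indicator (C n) x * h x)} = ?E"
        by (auto simp: indicator_def)
      finally have E: "?E \<in> sets lebesgue" .
      have lm: "?E \<in> lmeasurable"
        using E bounded_subset[OF compact_imp_bounded[OF C(1)[of n]], of ?E] by (intro bounded_set_imp_lmeasurable) auto
      show ?thesis
      proof (rule ccontr)
        assume "\<not> negligible ?E"
        then have pos: "measure lebesgue ?E > 0"
          using lm by (simp add: negligible_iff_measure zero_less_measure_iff)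
        \<comment> \<open>Strictly less than the measure of \<open>?E\<close> is left out, so
          \<open>F\<close> cannot be a null set; the vanishing integral over \<open>F\<close> says
          that it is.\<close>
        obtain F where F: "closed F" "F \<subseteq> ?E" "?E - F \<in> lmeasurable" "emeasure lebesgue (?E - F) < ennreal (measure lebesgue ?E)"
          using sets_lebesgue_inner_closed[OF E pos] by blast
        have "F \<subseteq> C n" using F(2) by blast
        then have Fc: "compact F"
          using compact_Int_closed[OF C(1)[of n] F(1)] by (simp add: Int_absorb1)
        have FA: "F \<subseteq> A" using F(2) C(2)[of n] by blast
        have "integrable lebesgue (\<lambda>x. s * (indicator F x * h x))" using hK[OF Fc FA] by simp
        moreover have "(LINT x|lebesgue. s * (indicator F x * h x)) = 0" using int0[OF Fc FA] by simp
        moreover have "0 \<le> s * (indicator F x * h x)" for x using F(2) by (auto simp: indicator_def)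
        ultimately have "AE x in lebesgue. s * (indicator F x * h x) = 0"
          using integral_nonneg_eq_0_iff_AE[of lebesgue "\<lambda>x. s * (indicator F x * h x)"] by simp
        then have "AE x in lebesgue. x \<notin> F"
          by (rule AE_mp) (use F(2) in \<open>auto intro!: AE_I2 simp: indicator_def\<close>)
        then have "F \<in> null_sets lebesgue"
          using fmeasurableD[OF lmeasurable_compact[OF Fc]] AE_iff_null_sets[of F lebesgue] by blast
        then have "emeasure lebesgue (?E - F) = emeasure lebesgue ?E"
          using E by (rule emeasure_Diff_null_set)
        then show False using F(4) emeasure_eq_measure2[OF lm] by simp
      qed
    qed
    then have "negligible (\<Union>n. {x \<in> C n. s * h x > 0})" by (rule negligible_Union_nat)
    then show ?thesis using C(3) by (auto elim: negligible_subset)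
  qed
  have "negligible ({x \<in> A. 1 * h x > 0} \<union> {x \<in> A. - 1 * h x > 0})"
    using null[of 1] null[of "-1"] by (intro negligible_Un) auto
  then have "{x \<in> A. 1 * h x > 0} \<union> {x \<in> A. - 1 * h x > 0} \<in> null_sets lebesgue"
    by (simp add: negligible_iff_null_sets)
  then show ?thesis
    by (rule AE_I') (auto simp: not_less_iff_gr_or_eq)
qed

section \<open>Sawtooth profiles\<close>

text \<open>At a point in tooth number \<open>j\<close>, the earlier teeth are complete and
  contribute the constant \<open>A\<close>, the later ones have not begun, and only
  \<open>g j\<close> is in transition.\<close>

lemma sum_step_profile:
  fixes g :: "nat \<Rightarrow> real"
  assumes "j < N" "\<And>i. i < j \<Longrightarrow> g i = A" "\<And>i. j < i \<Longrightarrow> g i = 0"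
  shows "(\<Sum>i<N. g i) = real j * A + g j"
proof -
  have "(\<Sum>i<N. g i) = (\<Sum>i<Suc j. g i)"
    using assms by (intro sum.mono_neutral_right) auto
  then show ?thesis using assms(2) by simp
qed

text \<open>\<open>\<eta>2\<close> is a smoothed square wave of period \<open>w\<close>: it equals
  \<open>1 - l\<close> on length \<open>l * w\<close> and \<open>- l\<close> on the rest of a
  period, up to transitions of length \<open>\<kappa>\<close>. The unsmoothed wave has mean zero
  over a period, so \<open>\<eta>1\<close> stays of size \<open>w\<close> and its primitive of size
  \<open>2 * R * w\<close>. The set \<open>T\<close> of jump points is fixed before
  \<open>\<kappa>\<close>, because \<open>\<kappa>\<close> will be chosen so that the slabs around
  these points have small volume.\<close>

lemma sawtooth:
  assumes l: "0 < l" "l < 1" and R: "R > 0" and \<delta>: "\<delta> > 0"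
  obtains T :: "real set" where "finite T"
    "\<And>\<kappa>. \<kappa> > 0 \<Longrightarrow> \<exists>\<eta> \<eta>1 \<eta>2. smooth \<eta> \<and> (\<forall>t. (\<eta> has_real_derivative \<eta>1 t) (at t)) \<and>
      (\<forall>t. (\<eta>1 has_real_derivative \<eta>2 t) (at t)) \<and>
      (\<forall>t. \<bar>t\<bar> \<le> R \<longrightarrow> \<bar>\<eta> t\<bar> \<le> \<delta> \<and> \<bar>\<eta>1 t\<bar> \<le> \<delta> \<and> - l \<le> \<eta>2 t \<and> \<eta>2 t \<le> 1 - l \<and>
         (\<eta>2 t = - l \<or> \<eta>2 t = 1 - l \<or> (\<exists>s\<in>T. \<bar>t - s\<bar> \<le> \<kappa>)))"
proof -
  \<comment> \<open>Small enough for both bounds: \<open>w\<close> for the first derivative and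
    \<open>2 * R * w\<close> for the function.\<close>
  define w where "w = \<delta> / (1 + 2 * R)"
  have w: "w > 0" "w \<le> \<delta>" "2 * R * w \<le> \<delta>"
    using R \<delta> by (auto simp: w_def field_simps)
  \<comment> \<open>One tooth more than the length \<open>2 * R\<close> asks for, so that the index
    of the tooth containing \<open>R\<close> is still below \<open>N\<close>.\<close>
  define N where "N = nat \<lceil>2 * R / w\<rceil> + 1"
  define T where "T = (\<lambda>i. - R + real i * w) ` {..<N} \<union> (\<lambda>i. - R + real i * w + l * w) ` {..<N}"
  obtain S :: "real \<Rightarrow> real" where S: "smooth S" "\<And>x. x \<le> 0 \<Longrightarrow> S x = 0" "\<And>x. x \<ge> 1 \<Longrightarrow> S x = 1"
    "\<And>x. 0 \<le> S x" "\<And>x. S x \<le> 1" using smooth_step by metis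
  obtain S0 where S0: "\<And>x. (S0 has_real_derivative S x) (at x)"
    using antiderivative[OF smooth_continuous[OF S(1)]] by blast
  define S1 where "S1 x = S0 x - S0 0" for x
  have S1: "(S1 has_real_derivative S x) (at x)" for x
    unfolding S1_def using DERIV_diff[OF S0[of x] DERIV_const] by simp
  have incr: "0 \<le> S1 v - S1 u" "S1 v - S1 u \<le> v - u" if "u \<le> v" for u v
  proof -
    show "0 \<le> S1 v - S1 u"
      using DERIV_nonneg_imp_nondecreasing[OF that, of S1] S1 S(4) by (metis diff_ge_0_iff_ge)
    have "((\<lambda>x. x - S1 x) has_real_derivative 1 - S x) (at x)" for x
      by (intro DERIV_diff S1 DERIV_ident)
    then have "u - S1 u \<le> v - S1 v"
      using DERIV_nonneg_imp_nondecreasing[OF that, of "\<lambda>x. x - S1 x"] S(5) by (metis diff_ge_0_iff_ge)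
    then show "S1 v - S1 u \<le> v - u" by linarith
  qed
  have S1_0: "S1 u = 0" if "u \<le> 0" for u
  proof -
    have "\<exists>y. DERIV S1 x :> y \<and> y \<le> 0" if "u \<le> x" "x \<le> 0" for x
      using S1[of x] S(2)[OF that(2)] by auto
    then have "S1 0 \<le> S1 u" using DERIV_nonpos_imp_nonincreasing[OF that, of S1] by blast
    moreover have "S1 0 = 0" by (simp add: S1_def)
    ultimately show ?thesis using incr(1)[OF that] by simp
  qed
  have S1_1: "S1 v - S1 u = v - u" if "1 \<le> u" "u \<le> v" for u v
  proof -
    have "\<exists>y. DERIV (\<lambda>x. x - S1 x) x :> y \<and> y \<le> 0" if "u \<le> x" "x \<le> v" for x
      using DERIV_diff[OF DERIV_ident S1[of x]] S(3)[of x] that \<open>1 \<le> u\<close>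
      by (intro exI[of _ "1 - S x"]) auto
    then have "v - S1 v \<le> u - S1 u"
      using DERIV_nonpos_imp_nonincreasing[OF that(2), of "\<lambda>x. x - S1 x"] by blast
    then show ?thesis using incr(2)[OF that(2)] by linarith
  qed
  show thesis
  proof (rule that)
    show "finite T" by (simp add: T_def)
    fix \<kappa>0 :: real assume "\<kappa>0 > 0"
    \<comment> \<open>Each transition ends before the next one begins: a rising ramp has room
      \<open>l * w\<close>, a falling one \<open>(1 - l) * w\<close>.\<close>
    define \<kappa> where "\<kappa> = min \<kappa>0 (min (l * w) ((1 - l) * w))"
    have \<kappa>: "\<kappa> > 0" "\<kappa> \<le> \<kappa>0" "\<kappa> \<le> l * w" "\<kappa> \<le> w - l * w"
      using \<open>\<kappa>0 > 0\<close> l w by (auto simp: \<kappa>_def algebra_simps)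
    define u where "u i t = (t - (- R + real i * w)) / \<kappa>" for i t
    define v where "v i t = (t - (- R + real i * w + l * w)) / \<kappa>" for i t
    have du: "((\<lambda>t. u i t) has_real_derivative 1 / \<kappa>) (at t)" for i t
      unfolding u_def using \<kappa> by (auto intro!: derivative_eq_intros)
    have dv: "((\<lambda>t. v i t) has_real_derivative 1 / \<kappa>) (at t)" for i t
      unfolding v_def using \<kappa> by (auto intro!: derivative_eq_intros)
    define \<eta>1 where "\<eta>1 t = - l * (t + R) + (\<Sum>i<N. \<kappa> * (S1 (u i t) - S1 (v i t)))" for t
    define \<eta>2 where "\<eta>2 t = - l + (\<Sum>i<N. S (u i t) - S (v i t))" for t
    have d1: "(\<eta>1 has_real_derivative \<eta>2 t) (at t)" for t
    proof -
      have "((\<lambda>t. \<kappa> * (S1 (u i t) - S1 (v i t))) has_real_derivative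
          \<kappa> * (S (u i t) * (1 / \<kappa>) - S (v i t) * (1 / \<kappa>))) (at t)" for i
        by (intro DERIV_cmult DERIV_diff DERIV_chain2[OF S1] du dv)
      moreover have "\<kappa> * (S (u i t) * (1 / \<kappa>) - S (v i t) * (1 / \<kappa>)) = S (u i t) - S (v i t)" for i
        using \<kappa> by (simp add: field_simps)
      moreover have "((\<lambda>t. - l * (t + R)) has_real_derivative - l) (at t)"
        by (auto intro!: derivative_eq_intros)
      ultimately show ?thesis
        unfolding \<eta>1_def \<eta>2_def by (intro DERIV_add DERIV_sum) auto
    qed
    have sm2: "smooth \<eta>2"
    proof -
      have "smooth (\<lambda>t. u i t)" "smooth (\<lambda>t. v i t)" for i
        by (rule smooth_realI[OF du smooth_const], rule smooth_realI[OF dv smooth_const])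
      then show ?thesis
        unfolding \<eta>2_def by (intro smooth_add smooth_sum smooth_diff smooth_compose[OF S(1)]) auto
    qed
    have sm1: "smooth \<eta>1" by (rule smooth_realI[OF d1 sm2])
    obtain \<eta>0 where \<eta>0: "\<And>x. (\<eta>0 has_real_derivative \<eta>1 x) (at x)"
      using antiderivative[OF smooth_continuous[OF sm1]] by blast
    define \<eta> where "\<eta> t = \<eta>0 t - \<eta>0 (- R)" for t
    have d0: "(\<eta> has_real_derivative \<eta>1 t) (at t)" for t
      unfolding \<eta>_def using DERIV_diff[OF \<eta>0[of t] DERIV_const] by simp
    have pointwise: "\<bar>\<eta>1 t\<bar> \<le> w \<and> - l \<le> \<eta>2 t \<and> \<eta>2 t \<le> 1 - l \<and>
        (\<eta>2 t = - l \<or> \<eta>2 t = 1 - l \<or> (\<exists>s\<in>T. \<bar>t - s\<bar> \<le> \<kappa>))" if t: "\<bar>t\<bar> \<le> R" for t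
    proof -
      \<comment> \<open>The number of the tooth containing \<open>t\<close>; \<open>x\<close> below
        is the position inside it.\<close>
      define j where "j = nat \<lfloor>(t + R) / w\<rfloor>"
      have "0 \<le> (t + R) / w" using t w by simp
      then have j1: "real j \<le> (t + R) / w" "(t + R) / w < real j + 1"
        unfolding j_def by linarith+
      then have j2: "real j * w \<le> t + R" "t + R < real j * w + w"
        using w by (simp_all add: field_simps)
      have "(t + R) / w \<le> 2 * R / w" using t w by (intro divide_right_mono) auto
      then have jN: "j < N" using j1(1) unfolding N_def by linarith
      define x where "x = t + R - real j * w"
      have x: "0 \<le> x" "x < w" using j2 by (auto simp: x_def)
      have uj: "u j t = x / \<kappa>" and vj: "v j t = (x - l * w) / \<kappa>"
        by (auto simp: u_def v_def x_def algebra_simps)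
      have low: "1 \<le> v i t" "v i t \<le> u i t" if "i < j" for i
      proof -
        have "(real i + 1) * w \<le> real j * w" using that w by (intro mult_right_mono) auto
        then have "\<kappa> \<le> t - (- R + real i * w + l * w)"
          using \<kappa> x by (simp add: x_def algebra_simps)
        then show "1 \<le> v i t" using \<kappa> by (simp add: v_def)
        show "v i t \<le> u i t" unfolding u_def v_def using \<kappa> l w by (intro divide_right_mono) auto
      qed
      have high: "u i t \<le> 0" "v i t \<le> 0" if "j < i" for i
      proof -
        have "(real j + 1) * w \<le> real i * w" using that w by (intro mult_right_mono) auto
        then have "t - (- R + real i * w) \<le> 0" using x by (simp add: x_def algebra_simps)
        moreover have "0 \<le> l * w" using l w by simp
        ultimately show "u i t \<le> 0" "v i t \<le> 0"
          unfolding u_def v_def using \<kappa> by (auto intro!: divide_nonpos_pos)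
      qed
      have uv: "u j t - v j t = l * w / \<kappa>" unfolding uj vj by (simp add: diff_divide_distrib)
      have "(\<Sum>i<N. \<kappa> * (S1 (u i t) - S1 (v i t))) = real j * (l * w) + \<kappa> * (S1 (u j t) - S1 (v j t))"
      proof (rule sum_step_profile[OF jN])
        fix i assume "i < j"
        moreover have "u i t - v i t = l * w / \<kappa>"
          unfolding u_def v_def by (simp add: diff_divide_distrib add_divide_distrib)
        ultimately have "S1 (u i t) - S1 (v i t) = l * w / \<kappa>"
          using S1_1[OF low] by metis
        then show "\<kappa> * (S1 (u i t) - S1 (v i t)) = l * w" using \<kappa> by simp
      next
        fix i assume "j < i"
        then show "\<kappa> * (S1 (u i t) - S1 (v i t)) = 0" using S1_0 high by simp
      qed
      then have e1: "\<eta>1 t = \<kappa> * (S1 (u j t) - S1 (v j t)) - l * x"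
        unfolding \<eta>1_def x_def by (simp add: algebra_simps)
      have "v j t \<le> u j t" unfolding uj vj using \<kappa> l w by (intro divide_right_mono) auto
      from incr[OF this] have "0 \<le> \<kappa> * (S1 (u j t) - S1 (v j t))"
        "\<kappa> * (S1 (u j t) - S1 (v j t)) \<le> \<kappa> * (u j t - v j t)"
        using \<kappa> by (auto intro: mult_left_mono)
      moreover have "\<kappa> * (u j t - v j t) = l * w" unfolding uv using \<kappa> by simp
      moreover have "0 \<le> l * x" "l * x \<le> l * w" "l * w \<le> 1 * w"
        using l x w by (auto intro!: mult_left_mono mult_right_mono)
      ultimately have b1: "\<bar>\<eta>1 t\<bar> \<le> w" unfolding e1 by linarith
      have "(\<Sum>i<N. S (u i t) - S (v i t)) = real j * 0 + (S (u j t) - S (v j t))"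
      proof (rule sum_step_profile[OF jN])
        fix i assume "i < j"
        from low[OF this] show "S (u i t) - S (v i t) = 0" using S(3) by simp
      next
        fix i assume "j < i"
        from high[OF this] show "S (u i t) - S (v i t) = 0" using S(2) by simp
      qed
      then have e2: "\<eta>2 t = S (u j t) - S (v j t) - l" unfolding \<eta>2_def by simp
      have T1: "- R + real j * w \<in> T" "- R + real j * w + l * w \<in> T"
        using jN by (auto simp: T_def)
      \<comment> \<open>Rising ramp, upper plateau, falling ramp and lower plateau of the
        tooth.\<close>
      consider "x \<le> \<kappa>" | "\<kappa> \<le> x" "x \<le> l * w" | "l * w \<le> x" "x \<le> l * w + \<kappa>" | "l * w + \<kappa> \<le> x"
        by linarith
      then have "- l \<le> \<eta>2 t \<and> \<eta>2 t \<le> 1 - l \<and>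
        (\<eta>2 t = - l \<or> \<eta>2 t = 1 - l \<or> (\<exists>s\<in>T. \<bar>t - s\<bar> \<le> \<kappa>))"
      proof cases
        case 1
        then have "x - l * w \<le> 0" using \<kappa> by linarith
        then have "S (v j t) = 0" unfolding vj using \<kappa> by (intro S(2) divide_nonpos_pos)
        moreover have "\<bar>t - (- R + real j * w)\<bar> \<le> \<kappa>" using 1 x by (simp add: x_def)
        ultimately show ?thesis using e2 S(4,5)[of "u j t"] T1 by auto
      next
        case 2
        then have "S (v j t) = 0" "S (u j t) = 1"
          unfolding vj uj using \<kappa> by (auto intro!: S(2,3) divide_nonpos_pos)
        then show ?thesis using e2 by simp
      next
        case 3
        then have "S (u j t) = 1" unfolding uj using \<kappa> by (intro S(3)) simp
        moreover have "\<bar>t - (- R + real j * w + l * w)\<bar> \<le> \<kappa>" using 3 by (simp add: x_def)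
        ultimately show ?thesis using e2 S(4,5)[of "v j t"] T1 by auto
      next
        case 4
        then have "\<kappa> \<le> x - l * w" "\<kappa> \<le> x" using l w \<kappa> by auto
        then have "S (v j t) = 1" "S (u j t) = 1"
          unfolding vj uj using \<kappa> by (auto intro!: S(3))
        then show ?thesis using e2 l by simp
      qed
      then show ?thesis using b1 by blast
    qed
    have b0: "\<bar>\<eta> t\<bar> \<le> \<delta>" if t: "\<bar>t\<bar> \<le> R" for t
    proof -
      have "norm (\<eta> t - \<eta> (- R)) \<le> w * norm (t - (- R))"
      proof (rule field_differentiable_bound[where S = "{- R..R}"])
        show "(\<eta> has_field_derivative \<eta>1 z) (at z within {- R..R})" for z
          using d0 by (rule DERIV_subset) simp
      qed (use pointwise t in auto)
      also have "w * norm (t - (- R)) \<le> w * (2 * R)" using t w by (intro mult_left_mono) auto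
      finally show ?thesis using w by (simp add: \<eta>_def mult_ac)
    qed
    have "\<exists>s\<in>T. \<bar>t - s\<bar> \<le> \<kappa>0" if "\<exists>s\<in>T. \<bar>t - s\<bar> \<le> \<kappa>" for t using that \<kappa>(2) by force
    then have "\<forall>t. \<bar>t\<bar> \<le> R \<longrightarrow> \<bar>\<eta> t\<bar> \<le> \<delta> \<and> \<bar>\<eta>1 t\<bar> \<le> \<delta> \<and> - l \<le> \<eta>2 t \<and> \<eta>2 t \<le> 1 - l \<and>
         (\<eta>2 t = - l \<or> \<eta>2 t = 1 - l \<or> (\<exists>s\<in>T. \<bar>t - s\<bar> \<le> \<kappa>0))"
      using pointwise b0 w(2) by (meson order_trans)
    then show "\<exists>\<eta> \<eta>1 \<eta>2. smooth \<eta> \<and> (\<forall>t. (\<eta> has_real_derivative \<eta>1 t) (at t)) \<and>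
      (\<forall>t. (\<eta>1 has_real_derivative \<eta>2 t) (at t)) \<and>
      (\<forall>t. \<bar>t\<bar> \<le> R \<longrightarrow> \<bar>\<eta> t\<bar> \<le> \<delta> \<and> \<bar>\<eta>1 t\<bar> \<le> \<delta> \<and> - l \<le> \<eta>2 t \<and> \<eta>2 t \<le> 1 - l \<and>
         (\<eta>2 t = - l \<or> \<eta>2 t = 1 - l \<or> (\<exists>s\<in>T. \<bar>t - s\<bar> \<le> \<kappa>0)))"
      using smooth_realI[OF d0 sm1] d0 d1 by blast
  qed
qed

section \<open>Second derivatives and constrained fields\<close>

abbreviation pd :: "'a::euclidean_space \<Rightarrow> ('a \<Rightarrow> 'b::real_normed_vector) \<Rightarrow> 'a \<Rightarrow> 'b" where
  "pd v f \<equiv> \<lambda>x. frechet_derivative f (at x) v"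

lemma pd_eq: "(f has_derivative f') (at x) \<Longrightarrow> pd v f x = f' v"
  using frechet_derivative_at by metis

section \<open>Symmetry of second derivatives\<close>

lemma smooth_pd: "smooth f \<Longrightarrow> smooth (pd v f)"
  by (rule smooth_derivative)

lemma smooth_line_derivative:
  fixes f :: "'a::euclidean_space \<Rightarrow> real"
  assumes "smooth f"
  shows "((\<lambda>s. f (x + s *\<^sub>R v)) has_real_derivative pd v f (x + s *\<^sub>R v)) (at s)"
  by (rule has_derivative_real_line) (rule smooth_has_derivative[OF assms])

text \<open>The mean value theorem, once in direction \<open>b\<close> for a difference in
  \<open>c\<close>, and once in direction \<open>c\<close> for the resulting derivative.\<close>

lemma second_difference:
  fixes f :: "'a::euclidean_space \<Rightarrow> real"
  assumes f: "smooth f" and s: "s > 0"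
  obtains p q where "0 < p" "p < s" "0 < q" "q < s"
    "f (x + s *\<^sub>R b + s *\<^sub>R c) - f (x + s *\<^sub>R b) - f (x + s *\<^sub>R c) + f x = s\<^sup>2 * pd c (pd b f) (x + p *\<^sub>R b + q *\<^sub>R c)"
proof -
  define g where "g p = f (x + s *\<^sub>R c + p *\<^sub>R b) - f (x + p *\<^sub>R b)" for p
  have g: "(g has_real_derivative pd b f (x + s *\<^sub>R c + p *\<^sub>R b) - pd b f (x + p *\<^sub>R b)) (at p)" for p
    unfolding g_def by (intro DERIV_diff smooth_line_derivative f)
  obtain p where p: "0 < p" "p < s" "g s - g 0 = (s - 0) * (pd b f (x + s *\<^sub>R c + p *\<^sub>R b) - pd b f (x + p *\<^sub>R b))"
    using MVT2[OF s g] by blast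
  define k where "k q = pd b f (x + p *\<^sub>R b + q *\<^sub>R c)" for q
  have k: "(k has_real_derivative pd c (pd b f) (x + p *\<^sub>R b + q *\<^sub>R c)) (at q)" for q
    unfolding k_def by (rule smooth_line_derivative[OF smooth_pd[OF f]])
  obtain q where q: "0 < q" "q < s" "k s - k 0 = (s - 0) * pd c (pd b f) (x + p *\<^sub>R b + q *\<^sub>R c)"
    using MVT2[OF s k] by blast
  have "f (x + s *\<^sub>R b + s *\<^sub>R c) - f (x + s *\<^sub>R b) - f (x + s *\<^sub>R c) + f x = g s - g 0"
    by (simp add: g_def add_ac)
  also have "\<dots> = s * (k s - k 0)" using p(3) by (simp add: k_def add_ac)
  also have "\<dots> = s\<^sup>2 * pd c (pd b f) (x + p *\<^sub>R b + q *\<^sub>R c)" using q(3) by (simp add: power2_eq_square)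
  finally show thesis using that p q by blast
qed

text \<open>The second difference is symmetric in \<open>b\<close> and \<open>c\<close>, so the two
  mixed derivatives take a common value at points arbitrarily close to \<open>x\<close>; both are
  continuous.\<close>

lemma second_derivative_symmetric:
  fixes f :: "'a::euclidean_space \<Rightarrow> real"
  assumes f: "smooth f"
  shows "pd c (pd b f) x = pd b (pd c f) x"
proof (rule ccontr)
  let ?g = "pd c (pd b f)" and ?h = "pd b (pd c f)"
  assume ne: "?g x \<noteq> ?h x"
  define e where "e = \<bar>?g x - ?h x\<bar> / 2"
  have e: "e > 0" using ne by (simp add: e_def)
  have cont: "isCont ?g x" "isCont ?h x"
    using smooth_continuous[OF smooth_pd[OF smooth_pd[OF f]], of UNIV]
    by (simp_all add: continuous_on_eq_continuous_at)
  obtain d1 where d1: "d1 > 0" "\<And>y. dist y x < d1 \<Longrightarrow> dist (?g y) (?g x) < e"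
    using cont(1) e unfolding continuous_at_eps_delta by blast
  obtain d2 where d2: "d2 > 0" "\<And>y. dist y x < d2 \<Longrightarrow> dist (?h y) (?h x) < e"
    using cont(2) e unfolding continuous_at_eps_delta by blast
  define s where "s = min d1 d2 / (norm b + norm c + 1)"
  have pos: "norm b + norm c + 1 > 0" using norm_ge_zero[of b] norm_ge_zero[of c] by linarith
  have s: "s > 0" "s * (norm b + norm c + 1) = min d1 d2"
    using d1 d2 pos by (auto simp: s_def)
  have near: "dist (x + p *\<^sub>R b + q *\<^sub>R c) x < min d1 d2" if "0 < p" "p < s" "0 < q" "q < s" for p q
  proof -
    have "norm (p *\<^sub>R b + q *\<^sub>R c) \<le> p * norm b + q * norm c"
      using norm_triangle_ineq[of "p *\<^sub>R b" "q *\<^sub>R c"] that by simp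
    also have "\<dots> \<le> s * norm b + s * norm c"
      using that by (intro add_mono mult_right_mono) auto
    also have "\<dots> < s * (norm b + norm c + 1)" using s(1) by (simp add: algebra_simps)
    finally show ?thesis using s(2) by (simp add: dist_norm add.assoc)
  qed
  obtain p q where p: "0 < p" "p < s" "0 < q" "q < s"
    "f (x + s *\<^sub>R b + s *\<^sub>R c) - f (x + s *\<^sub>R b) - f (x + s *\<^sub>R c) + f x = s\<^sup>2 * ?g (x + p *\<^sub>R b + q *\<^sub>R c)"
    using second_difference[OF f s(1)] by blast
  obtain p' q' where p': "0 < p'" "p' < s" "0 < q'" "q' < s"
    "f (x + s *\<^sub>R c + s *\<^sub>R b) - f (x + s *\<^sub>R c) - f (x + s *\<^sub>R b) + f x = s\<^sup>2 * ?h (x + p' *\<^sub>R c + q' *\<^sub>R b)"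
    using second_difference[OF f s(1)] by blast
  have "f (x + s *\<^sub>R c + s *\<^sub>R b) = f (x + s *\<^sub>R b + s *\<^sub>R c)" by (simp add: add_ac)
  then have "s\<^sup>2 * ?g (x + p *\<^sub>R b + q *\<^sub>R c) = s\<^sup>2 * ?h (x + p' *\<^sub>R c + q' *\<^sub>R b)"
    using p(5) p'(5) by linarith
  then have eq: "?g (x + p *\<^sub>R b + q *\<^sub>R c) = ?h (x + p' *\<^sub>R c + q' *\<^sub>R b)" using s(1) by simp
  have A: "dist (?g (x + p *\<^sub>R b + q *\<^sub>R c)) (?g x) < e" using near[OF p(1-4)] by (intro d1(2)) simp
  have B: "dist (?h (x + p' *\<^sub>R c + q' *\<^sub>R b)) (?h x) < e"
    using near[OF p'(3,4,1,2)] by (intro d2(2)) (simp add: add_ac)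
  have C: "dist (?g x) (?h x) \<le> dist (?g (x + p *\<^sub>R b + q *\<^sub>R c)) (?g x) + dist (?h (x + p' *\<^sub>R c + q' *\<^sub>R b)) (?h x)"
    unfolding eq by (metis dist_triangle3)
  have "dist (?g x) (?h x) < e + e" by (rule order.strict_trans1[OF C add_strict_mono[OF A B]])
  then show False by (simp add: e_def dist_real_def)
qed

section \<open>Product rules, operations on test functions, sets of small volume\<close>

lemma pd_mult:
  fixes f g :: "'a::euclidean_space \<Rightarrow> real"
  assumes "smooth f" "smooth g"
  shows "pd v (\<lambda>x. f x * g x) x = f x * pd v g x + pd v f x * g x"
  by (rule pd_eq[OF has_derivative_mult[OF smooth_has_derivative smooth_has_derivative]]) (rule assms)+

lemma pd_add:
  assumes "smooth f" "smooth g"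
  shows "pd v (\<lambda>x. f x + g x) x = pd v f x + pd v g x"
  by (rule pd_eq[OF has_derivative_add[OF smooth_has_derivative smooth_has_derivative]]) (rule assms)+

lemma pd_ridge:
  fixes \<eta> :: "real \<Rightarrow> real"
  assumes "\<And>t. (\<eta> has_real_derivative \<eta>' t) (at t)"
  shows "pd v (\<lambda>x. \<eta> (b \<bullet> x)) x = \<eta>' (b \<bullet> x) * (b \<bullet> v)"
proof -
  have "((\<lambda>x. b \<bullet> x) has_derivative (\<lambda>h. b \<bullet> h)) (at x)" by (auto intro!: derivative_eq_intros)
  from has_derivative_compose[OF this] assms[of "b \<bullet> x"]
  have "((\<lambda>x. \<eta> (b \<bullet> x)) has_derivative (\<lambda>h. \<eta>' (b \<bullet> x) * (b \<bullet> h))) (at x)"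
    unfolding has_field_derivative_def by fast
  then show ?thesis by (rule pd_eq)
qed

lemma smooth_real_derivative:
  fixes \<eta> :: "real \<Rightarrow> real"
  assumes "smooth \<eta>" "\<And>t. (\<eta> has_real_derivative \<eta>' t) (at t)"
  shows "smooth \<eta>'"
proof -
  have "\<eta>' = pd 1 \<eta>"
  proof
    show "\<eta>' t = pd 1 \<eta> t" for t
      using pd_eq[where v = 1, OF assms(2)[unfolded has_field_derivative_def], of t] by simp
  qed
  then show ?thesis using smooth_pd[OF assms(1)] by simp
qed

lemma smooth_ridge:
  fixes \<eta> :: "real \<Rightarrow> real"
  shows "smooth \<eta> \<Longrightarrow> smooth (\<lambda>x. \<eta> (b \<bullet> x))"
  by (rule smooth_compose[OF _ smooth_inner_left])

lemma test_functions_smooth: "\<phi> \<in> test_functions A \<Longrightarrow> smooth \<phi>"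
  by (simp add: test_functions_iff)

lemma test_functions_pd:
  assumes "\<phi> \<in> test_functions A"
  shows "pd v \<phi> \<in> test_functions A"
proof -
  obtain K where K: "compact K" "K \<subseteq> A" "\<And>x. x \<notin> K \<Longrightarrow> \<phi> x = 0" "\<And>x. x \<notin> K \<Longrightarrow> frechet_derivative \<phi> (at x) = (\<lambda>_. 0)"
    using test_function_support[OF assms] by metis
  show ?thesis
    by (rule test_functionsI[OF smooth_pd[OF test_functions_smooth[OF assms]] K(1,2)]) (simp add: K(4))
qed

lemma test_functions_bounded:
  fixes \<phi> :: "'a::euclidean_space \<Rightarrow> 'b::real_normed_vector"
  assumes "\<phi> \<in> test_functions A"
  obtains M where "M \<ge> 0" "\<And>x. norm (\<phi> x) \<le> M"
proof -
  obtain K where K: "compact K" "K \<subseteq> A" "\<And>x. x \<notin> K \<Longrightarrow> \<phi> x = 0"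
    using test_function_support[OF assms] by metis
  have "compact (\<phi> ` K)"
    by (intro compact_continuous_image smooth_continuous test_functions_smooth[OF assms] K)
  then have "bounded (\<phi> ` K)" by (rule compact_imp_bounded)
  then obtain M where M: "\<forall>y\<in>\<phi> ` K. norm y \<le> M" unfolding bounded_iff by (rule exE)
  show thesis
  proof (rule that[of "max 0 M"])
    show "norm (\<phi> x) \<le> max 0 M" for x
      using bspec[OF M imageI[of x K \<phi>]] K(3)[of x] by (cases "x \<in> K") auto
  qed simp
qed

lemma compact_inner_approximation:
  fixes D :: "'a::euclidean_space set"
  assumes "open D" "bounded D" "e > 0"
  obtains K where "compact K" "K \<subseteq> D" "measure lebesgue D - measure lebesgue K < e"
proof -
  have D: "D \<in> lmeasurable" using assms by (intro bounded_set_imp_lmeasurable) auto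
  obtain K where K: "closed K" "K \<subseteq> D" "D - K \<in> lmeasurable" "emeasure lebesgue (D - K) < ennreal e"
    using sets_lebesgue_inner_closed[OF fmeasurableD[OF D] assms(3)] by blast
  have c: "compact K" using K assms by (meson bounded_subset compact_eq_bounded_closed)
  have "measure lebesgue (D - K) = measure lebesgue D - measure lebesgue K"
    using lmeasurable_compact[OF c] D K by (intro measurable_measure_Diff) auto
  moreover have "measure lebesgue (D - K) < e"
    using K(4) emeasure_eq_measure2[OF K(3)] assms(3) by (simp add: ennreal_less_iff)
  ultimately show thesis using that[OF c K(2)] by simp
qed

text \<open>As the thickness tends to 0, the slabs shrink to finitely many hyperplanes, which are
  null sets since \<open>b \<noteq> 0\<close>; the measure is continuous from above.\<close>

lemma thin_slabs:
  fixes K :: "'a::euclidean_space set"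
  assumes "compact K" "finite T" "b \<noteq> 0" "e > 0"
  obtains \<kappa> where "\<kappa> > 0" "{x \<in> K. \<exists>s\<in>T. \<bar>b \<bullet> x - s\<bar> \<le> \<kappa>} \<in> lmeasurable"
     "measure lebesgue {x \<in> K. \<exists>s\<in>T. \<bar>b \<bullet> x - s\<bar> \<le> \<kappa>} < e"
proof -
  define E where "E n = {x \<in> K. \<exists>s\<in>T. \<bar>b \<bullet> x - s\<bar> \<le> inverse (real (Suc n))}" for n
  have "E n = K \<inter> (\<Union>s\<in>T. {x. \<bar>b \<bullet> x - s\<bar> \<le> inverse (real (Suc n))})" for n by (auto simp: E_def)
  moreover have "closed (\<Union>s\<in>T. {x. \<bar>b \<bullet> x - s\<bar> \<le> c})" for c
    by (intro closed_UN assms(2) ballI closed_Collect_le continuous_intros)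
  ultimately have Em: "E n \<in> lmeasurable" for n
    using assms(1) by (simp add: lmeasurable_compact compact_Int_closed)
  have dec: "decseq E"
  proof (rule decseq_SucI)
    fix n
    have "inverse (real (Suc (Suc n))) \<le> inverse (real (Suc n))" by simp
    then show "E (Suc n) \<subseteq> E n" unfolding E_def by (smt (verit) Collect_mono_iff)
  qed
  have "(\<Inter>n. E n) \<subseteq> (\<Union>s\<in>T. {x. b \<bullet> x = s})"
  proof
    fix x assume x: "x \<in> (\<Inter>n. E n)"
    show "x \<in> (\<Union>s\<in>T. {x. b \<bullet> x = s})"
    proof (rule ccontr)
      assume "x \<notin> (\<Union>s\<in>T. {x. b \<bullet> x = s})"
      then have ne: "b \<bullet> x \<noteq> s" if "s \<in> T" for s using that by blast
      define d where "d = Min (insert 1 ((\<lambda>s. \<bar>b \<bullet> x - s\<bar>) ` T))"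
      have "d > 0" unfolding d_def using assms(2) ne by (subst Min_gr_iff) auto
      moreover have "\<forall>s\<in>T. d \<le> \<bar>b \<bullet> x - s\<bar>" unfolding d_def using assms(2) by (auto intro: Min_le)
      ultimately have d: "d > 0" "\<forall>s\<in>T. d \<le> \<bar>b \<bullet> x - s\<bar>" by auto
      obtain n where "inverse (real (Suc n)) < d" using d(1) reals_Archimedean by blast
      moreover have "x \<in> E n" using x by blast
      then obtain s where "s \<in> T" "\<bar>b \<bullet> x - s\<bar> \<le> inverse (real (Suc n))" unfolding E_def by blast
      moreover have "d \<le> \<bar>b \<bullet> x - s\<bar>" using d(2) \<open>s \<in> T\<close> by blast
      ultimately show False by linarith
    qed
  qed
  moreover have "negligible (\<Union>s\<in>T. {x. b \<bullet> x = s})"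
    using assms by (intro negligible_Union) (auto simp: negligible_hyperplane)
  ultimately have "negligible (\<Inter>n. E n)" by (rule negligible_subset[rotated])
  then have "measure lebesgue (\<Inter>n. E n) = 0" by (rule negligible_imp_measure0)
  moreover have "(\<lambda>n. measure lebesgue (E n)) \<longlonglongrightarrow> measure lebesgue (\<Inter>n. E n)"
    by (rule Lim_measure_decseq) (use fmeasurableD[OF Em] fmeasurableD2[OF Em] dec in \<open>simp_all add: image_subset_iff\<close>)
  ultimately have "eventually (\<lambda>n. measure lebesgue (E n) < e) sequentially"
    using assms(4) by (intro order_tendstoD(2)) auto
  then obtain n where "measure lebesgue (E n) < e" unfolding eventually_sequentially by blast
  then show thesis using that[of "inverse (real (Suc n))"] Em[of n] unfolding E_def by simp
qed

lemma norm_matrix_columns: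
  fixes A :: "real^'n^'m"
  shows "norm A \<le> (\<Sum>j\<in>UNIV. norm (A *v axis j 1))"
proof -
  have "A = (\<Sum>j\<in>UNIV. outer (A *v axis j 1) (axis j 1))"
    by (simp add: vec_eq_iff matrix_vector_mult_basis column_def) (simp add: axis_def if_distrib cong: if_cong)
  then have "norm A \<le> (\<Sum>j\<in>UNIV. norm (outer (A *v axis j 1) (axis j (1::real))))"
    by (metis norm_sum)
  then show ?thesis by (simp add: norm_outer)
qed


lemma test_functions_mult_smooth:
  fixes \<psi> f :: "'a::euclidean_space \<Rightarrow> real"
  assumes "\<psi> \<in> test_functions D" "smooth f"
  shows "(\<lambda>x. \<psi> x * f x) \<in> test_functions D"
proof -
  obtain K where K: "compact K" "K \<subseteq> D" "\<And>x. x \<notin> K \<Longrightarrow> \<psi> x = 0"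
    using test_function_support[OF assms(1)] by metis
  show ?thesis
    by (rule test_functionsI[OF smooth_mult[OF test_functions_smooth[OF assms(1)] assms(2)] K(1,2)]) (simp add: K(3))
qed

lemma test_functions_scaleR:
  fixes f :: "'a::euclidean_space \<Rightarrow> real"
  assumes "f \<in> test_functions D"
  shows "(\<lambda>x. f x *\<^sub>R a) \<in> test_functions D"
proof -
  obtain K where K: "compact K" "K \<subseteq> D" "\<And>x. x \<notin> K \<Longrightarrow> f x = 0"
    using test_function_support[OF assms(1)] by metis
  show ?thesis
    by (rule test_functionsI[OF smooth_scaleR[OF test_functions_smooth[OF assms] smooth_const] K(1,2)]) (simp add: K(3))
qed

lemma test_functions_add:
  assumes "f \<in> test_functions D" "g \<in> test_functions D"
  shows "(\<lambda>x. f x + g x) \<in> test_functions D"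
proof -
  obtain K where K: "compact K" "K \<subseteq> D" "\<And>x. x \<notin> K \<Longrightarrow> f x = 0"
    using test_function_support[OF assms(1)] by metis
  obtain K' where K': "compact K'" "K' \<subseteq> D" "\<And>x. x \<notin> K' \<Longrightarrow> g x = 0"
    using test_function_support[OF assms(2)] by metis
  show ?thesis
    by (rule test_functionsI[OF smooth_add[OF assms[THEN test_functions_smooth]] compact_Un[OF K(1) K'(1)]])
      (use K K' in auto)
qed

lemma jacobian_mult:
  fixes f :: "real^'n \<Rightarrow> real^'m"
  assumes "(f has_derivative f') (at x)"
  shows "jacobian f (at x) *v h = f' h"
proof -
  have "f differentiable (at x)" using assms by (auto simp: differentiable_def)
  then have "(f has_derivative (\<lambda>h. jacobian f (at x) *v h)) (at x)" by (simp add: jacobian_works)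
  from has_derivative_unique[OF this assms] show ?thesis by (simp add: fun_eq_iff)
qed

lemma smooth_jacobian_mult:
  fixes f :: "real^'n \<Rightarrow> real^'m"
  assumes "smooth f"
  shows "jacobian f (at x) *v h = pd h f x"
  by (rule jacobian_mult[OF smooth_has_derivative[OF assms]])

lemma matrix_component:
  fixes A :: "real^'n^'m"
  shows "A $ i $ j = (A *v axis j 1) $ i"
  by (simp add: matrix_vector_mult_basis column_def)

lemma continuous_jacobian:
  fixes f :: "real^'n \<Rightarrow> real^'m"
  assumes "smooth f"
  shows "continuous_on S (\<lambda>x. jacobian f (at x))"
proof -
  have "continuous_on S (\<lambda>x. \<chi> i j. pd (axis j 1) f x $ i)"
    by (intro continuous_intros smooth_continuous[OF smooth_pd[OF assms]])
  then show ?thesis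
  proof (rule continuous_on_eq)
    fix x
    have "(\<chi> i j. pd (axis j 1) f x $ i) $ i $ j = jacobian f (at x) $ i $ j" for i j
      unfolding matrix_component[of "jacobian f (at x)"] smooth_jacobian_mult[OF assms] by simp
    then show "(\<chi> i j. pd (axis j 1) f x $ i) = jacobian f (at x)" unfolding vec_eq_iff by blast
  qed
qed

lemma inner_matrix_columns:
  fixes L A :: "real^'n^'m"
  shows "L \<bullet> A = (\<Sum>j\<in>UNIV. (L *v axis j 1) \<bullet> (A *v axis j 1))"
  unfolding inner_vec_def matrix_vector_mult_basis column_def by (subst sum.swap) simp

text \<open>With \<open>F = \<psi>(x) \<eta>(b \<bullet> x)\<close>, the map \<open>w = (\<partial>\<^sub>b F) a - (\<partial>\<^sub>c F) r\<close> satisfies the linear constraint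
  exactly, because it reduces to \<open>\<partial>\<^sub>c \<partial>\<^sub>b F = \<partial>\<^sub>b \<partial>\<^sub>c F\<close> when \<open>c\<close> and \<open>b\<close> are the images of \<open>a\<close> and \<open>r\<close>
  under the transpose of \<open>L\<close>.\<close>

lemma constrained_field:
  fixes F :: "real^'n \<Rightarrow> real" and L :: "real^'n^'m"
  assumes F: "smooth F"
    and a: "\<And>x. a \<bullet> (L *v x) = c \<bullet> x" and r: "\<And>x. r \<bullet> (L *v x) = b \<bullet> x"
  defines "w \<equiv> \<lambda>x. pd b F x *\<^sub>R a + pd c F x *\<^sub>R (- r)"
  shows "smooth w" "jacobian w (at x) *v h = pd h (pd b F) x *\<^sub>R a - pd h (pd c F) x *\<^sub>R r"
    "L \<bullet> jacobian w (at x) = 0"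
proof -
  show "smooth w"
    unfolding w_def by (intro smooth_add smooth_scaleR smooth_pd F smooth_const)
  have "(w has_derivative (\<lambda>h. pd h (pd b F) x *\<^sub>R a + pd h (pd c F) x *\<^sub>R (- r))) (at x)"
    unfolding w_def
    by (intro has_derivative_add has_derivative_scaleR_left smooth_has_derivative smooth_pd F)
  from jacobian_mult[OF this]
  have j: "jacobian w (at x) *v h = pd h (pd b F) x *\<^sub>R a - pd h (pd c F) x *\<^sub>R r" for h by simp
  then show "jacobian w (at x) *v h = pd h (pd b F) x *\<^sub>R a - pd h (pd c F) x *\<^sub>R r" .
  have expand: "pd d G x = (\<Sum>j\<in>UNIV. d $ j * pd (axis j 1) G x)" if "smooth G" for G :: "real^'n \<Rightarrow> real" and d
  proof -
    have lin: "linear (frechet_derivative G (at x))"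
      by (rule has_derivative_linear[OF smooth_has_derivative[OF that]])
    have "pd d G x = frechet_derivative G (at x) (\<Sum>j\<in>UNIV. d $ j *\<^sub>R axis j 1)"
      by (simp add: basis_expansion flip: scalar_mult_eq_scaleR)
    then show ?thesis by (simp add: linear_sum[OF lin] linear_scale[OF lin])
  qed
  have dot: "(L *v e) \<bullet> (p *\<^sub>R a - q *\<^sub>R r) = p * (c \<bullet> e) - q * (b \<bullet> e)" for e p q
    unfolding inner_diff_right inner_scaleR_right inner_commute[of "L *v e"] a r ..
  have "L \<bullet> jacobian w (at x) = (\<Sum>j\<in>UNIV. c $ j * pd (axis j 1) (pd b F) x) - (\<Sum>j\<in>UNIV. b $ j * pd (axis j 1) (pd c F) x)"
    unfolding inner_matrix_columns j sum_subtractf[symmetric] dot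
    by (intro sum.cong) (simp_all add: inner_axis mult.commute)
  also have "\<dots> = pd c (pd b F) x - pd b (pd c F) x"
    by (intro arg_cong2[of _ _ _ _ "(-)"] expand[symmetric] smooth_pd F)
  also have "\<dots> = 0" using second_derivative_symmetric[OF F] by simp
  finally show "L \<bullet> jacobian w (at x) = 0" .
qed

section \<open>Oscillating building blocks\<close>

text \<open>Two nearly exact linear relations determine the two volumes: they add up to that of
  \<open>D\<close>, and the integral of \<open>\<theta>\<close> balances \<open>1 - l\<close> times
  the first against \<open>l\<close> times the second. An error \<open>e\<close> comes from the
  integral, another from the set where \<open>\<theta>\<close> is in between, and a third from the
  sum of the volumes.\<close>

lemma two_level_measure_bounds:
  fixes \<theta> :: "'a::euclidean_space \<Rightarrow> real"
  assumes l: "0 < l" "l < 1"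
    and D: "D \<in> lmeasurable" and KB: "compact KB" "KB \<subseteq> D" and KC: "compact KC" "KC \<subseteq> D" "KB \<inter> KC = {}"
    and \<theta>B: "\<And>x. x \<in> KB \<Longrightarrow> \<theta> x = 1 - l" and \<theta>C: "\<And>x. x \<in> KC \<Longrightarrow> \<theta> x = - l"
    and \<theta>1: "\<And>x. \<bar>\<theta> x\<bar> \<le> 1" and \<theta>0: "\<And>x. x \<notin> D \<Longrightarrow> \<theta> x = 0"
    and int: "integrable lebesgue \<theta>" "\<bar>LINT x|lebesgue. \<theta> x\<bar> \<le> e"
    and full: "measure lebesgue D - measure lebesgue KB - measure lebesgue KC \<le> e"
  shows "l * measure lebesgue D - 3 * e \<le> measure lebesgue KB"
    "(1 - l) * measure lebesgue D - 3 * e \<le> measure lebesgue KC"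
proof -
  let ?m = "measure lebesgue"
  have KBm: "KB \<in> lmeasurable" and KCm: "KC \<in> lmeasurable" using KB KC by (auto intro: lmeasurable_compact)
  let ?E = "D - KB - KC"
  have Em: "?E \<in> lmeasurable" using D KBm KCm by auto
  have "?m ?E = ?m (D - KB) - ?m KC"
    using D KBm KCm KB KC by (intro measurable_measure_Diff) auto
  also have "?m (D - KB) = ?m D - ?m KB" using D KBm KB by (intro measurable_measure_Diff) auto
  finally have E: "?m ?E = ?m D - ?m KB - ?m KC" by simp
  define g where "g x = (1 - l) * indicator KB x - l * indicator KC x" for x :: 'a
  have ind: "integrable lebesgue (indicator S :: 'a \<Rightarrow> real)" "(LINT x|lebesgue. indicator S x) = ?m S"
    if "S \<in> lmeasurable" for S
    using that by (auto simp: fmeasurable_def)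
  have gi: "integrable lebesgue g" "(LINT x|lebesgue. g x) = (1 - l) * ?m KB - l * ?m KC"
    unfolding g_def using ind[OF KBm] ind[OF KCm] by auto
  have pt: "\<bar>\<theta> x - g x\<bar> \<le> indicator ?E x" for x
  proof -
    consider "x \<in> KB" | "x \<in> KC" | "x \<in> ?E" | "x \<notin> D" by blast
    then show ?thesis
    proof cases
      case 1 then show ?thesis using KC \<theta>B by (auto simp: g_def indicator_def)
    next
      case 2 then show ?thesis using KC \<theta>C by (auto simp: g_def indicator_def)
    next
      case 3 then show ?thesis using \<theta>1[of x] by (simp add: g_def)
    next
      case 4
      then have "x \<notin> KB" "x \<notin> KC" using KB KC by auto
      then show ?thesis using \<theta>0[OF 4] 4 by (simp add: g_def)
    qed
  qed
  have "\<bar>(LINT x|lebesgue. \<theta> x) - (LINT x|lebesgue. g x)\<bar> = \<bar>LINT x|lebesgue. \<theta> x - g x\<bar>"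
    using int gi by simp
  also have "\<dots> \<le> (LINT x|lebesgue. \<bar>\<theta> x - g x\<bar>)" by (rule integral_abs_bound)
  also have "\<dots> \<le> (LINT x|lebesgue. indicator ?E x)"
    using int gi ind[OF Em] pt by (intro integral_mono) auto
  finally have "\<bar>(1 - l) * ?m KB - l * ?m KC\<bar> \<le> 2 * e"
    using int(2) full E ind[OF Em] gi by linarith
  then have A: "- 2 * e \<le> (1 - l) * ?m KB - l * ?m KC" "(1 - l) * ?m KB - l * ?m KC \<le> 2 * e" by linarith+
  have e0: "e \<ge> 0" using int(2) by linarith
  have "l * (?m D - e) \<le> l * (?m KB + ?m KC)" using full l by (intro mult_left_mono) auto
  moreover have "l * e \<le> 1 * e" using l e0 by (intro mult_right_mono) auto
  ultimately show "l * ?m D - 3 * e \<le> ?m KB" using A by (simp add: algebra_simps)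
  have "(1 - l) * (?m D - e) \<le> (1 - l) * (?m KB + ?m KC)" using full l by (intro mult_left_mono) auto
  moreover have "(1 - l) * e \<le> 1 * e" using l e0 by (intro mult_right_mono) auto
  ultimately show "(1 - l) * ?m D - 3 * e \<le> ?m KC" using A by (simp add: algebra_simps)
qed

text \<open>For \<open>F x = \<psi> x * \<eta> (b \<bullet> x)\<close> the only large second
  derivatives come from differentiating \<open>\<eta>\<close> twice; they contribute
  \<open>\<theta> x = \<psi> x * \<eta>2 (b \<bullet> x)\<close> times \<open>outer a b\<close>. All
  other terms contain \<open>\<eta>\<close> or \<open>\<eta>1\<close>, which are small compared with
  the derivatives of \<open>\<psi>\<close>, because the cutoff is fixed before the
  oscillation.\<close>

lemma building_block:
  fixes L :: "real^'n^'m" and a :: "real^'m" and b :: "real^'n"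
  assumes b: "norm b = 1" and ab: "a \<bullet> (L *v b) = 0" and r: "\<And>x. r \<bullet> (L *v x) = b \<bullet> x"
    and D: "open D" "bounded D" and l: "0 < l" "l < 1" and \<delta>: "\<delta> > 0"
  obtains w \<theta> KB KC where "w \<in> test_functions D" "\<And>x. L \<bullet> jacobian w (at x) = 0" "\<And>x. norm (w x) \<le> \<delta>"
    "\<And>x. norm (jacobian w (at x) - \<theta> x *\<^sub>R outer a b) \<le> \<delta>" "\<And>x. - l \<le> \<theta> x \<and> \<theta> x \<le> 1 - l"
    "compact KB" "KB \<subseteq> D" "\<And>x. x \<in> KB \<Longrightarrow> \<theta> x = 1 - l" "l * measure lebesgue D - \<delta> \<le> measure lebesgue KB"
    "compact KC" "KC \<subseteq> D" "\<And>x. x \<in> KC \<Longrightarrow> \<theta> x = - l" "(1 - l) * measure lebesgue D - \<delta> \<le> measure lebesgue KC"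
proof -
  let ?m = "measure lebesgue"
  have Dm: "D \<in> lmeasurable" using D by (intro bounded_set_imp_lmeasurable) auto
  define c where "c = transpose L *v a"
  have c: "a \<bullet> (L *v x) = c \<bullet> x" for x
    unfolding c_def by (simp add: dot_lmul_matrix transpose_matrix_vector flip: vector_transpose_matrix)
  have cb: "c \<bullet> b = 0" using c[of b] ab by simp
  \<comment> \<open>Matches the factor 3 in \<open>two_level_measure_bounds\<close>.\<close>
  define e where "e = \<delta> / 3"
  have e: "e > 0" using \<delta> by (simp add: e_def)
  obtain K where K: "compact K" "K \<subseteq> D" "?m D - ?m K < e / 2"
    using compact_inner_approximation[OF D, of "e / 2"] e by auto
  obtain \<psi> :: "real^'n \<Rightarrow> real" where \<psi>: "\<psi> \<in> test_functions D" "\<And>x. x \<in> K \<Longrightarrow> \<psi> x = 1"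
    "\<And>x. 0 \<le> \<psi> x" "\<And>x. \<psi> x \<le> 1"
    using smooth_cutoff[OF K(1) D(1) K(2)] by metis
  note \<psi>s = test_functions_smooth[OF \<psi>(1)]
  have bd: "\<exists>M\<ge>0. \<forall>x. \<bar>f x\<bar> \<le> M" if "f \<in> test_functions D" for f :: "real^'n \<Rightarrow> real"
    using test_functions_bounded[OF that] by (metis real_norm_def)
  \<comment> \<open>The finitely many derivatives of the cutoff that occur in \<open>w\<close> and
    its gradient, for which a common bound \<open>M\<close> is wanted.\<close>
  define Q where "Q = {pd b \<psi>, pd c \<psi>} \<union> (\<lambda>j. pd (axis j 1) \<psi>) ` UNIV \<union>
     (\<lambda>j. pd (axis j 1) (pd b \<psi>)) ` UNIV \<union> (\<lambda>j. pd (axis j 1) (pd c \<psi>)) ` UNIV"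
  have Qf: "finite Q" by (simp add: Q_def)
  have Qt: "f \<in> test_functions D" if "f \<in> Q" for f
    using that by (auto simp: Q_def intro: test_functions_pd \<psi>(1))
  obtain B where B: "\<And>f. f \<in> Q \<Longrightarrow> B f \<ge> 0" "\<And>f x. f \<in> Q \<Longrightarrow> \<bar>f x\<bar> \<le> B f"
    using bd[OF Qt] by metis
  define M where "M = 1 + sum B Q"
  have sB: "0 \<le> sum B Q" using B by (intro sum_nonneg) auto
  then have M1: "M \<ge> 1" by (simp add: M_def)
  have M: "\<bar>f x\<bar> \<le> M" if "f \<in> Q" for f x
    using B(2)[OF that, of x] member_le_sum[OF that, of B] B(1) Qf by (fastforce simp: M_def)
  obtain R0 where R0: "\<And>x. x \<in> D \<Longrightarrow> norm x \<le> R0" using D(2) unfolding bounded_iff by blast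
  define R where "R = \<bar>R0\<bar> + 1"
  have R: "R > 0" "\<bar>b \<bullet> x\<bar> \<le> R" if "x \<in> D" for x
    using R0[OF that] Cauchy_Schwarz_ineq2[of b x] b by (auto simp: R_def)
  have R1: "R > 0" by (simp add: R_def)
  \<comment> \<open>Dominates the coefficients of \<open>\<epsilon>\<close> in the three error
    estimates: for the gradient, for the size of \<open>w\<close>, and for the integral of
    \<open>\<theta>\<close>.\<close>
  define C where "C = real CARD('n) * (3 * M * norm a + 2 * M * norm r) + 2 * M * norm a + M * norm r + M * ?m D + 1"
  have C1: "C \<ge> 1" using M1 by (simp add: C_def)
  define \<epsilon> where "\<epsilon> = min \<delta> e / C"
  have \<epsilon>: "\<epsilon> > 0" using \<delta> e C1 by (simp add: \<epsilon>_def)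
  have \<epsilon>C: "\<epsilon> * C = min \<delta> e" using C1 by (simp add: \<epsilon>_def)
  obtain T :: "real set" where T: "finite T"
    "\<And>\<kappa>. \<kappa> > 0 \<Longrightarrow> \<exists>\<eta> \<eta>1 \<eta>2. smooth \<eta> \<and> (\<forall>t. (\<eta> has_real_derivative \<eta>1 t) (at t)) \<and>
      (\<forall>t. (\<eta>1 has_real_derivative \<eta>2 t) (at t)) \<and>
      (\<forall>t. \<bar>t\<bar> \<le> R \<longrightarrow> \<bar>\<eta> t\<bar> \<le> \<epsilon> \<and> \<bar>\<eta>1 t\<bar> \<le> \<epsilon> \<and> - l \<le> \<eta>2 t \<and> \<eta>2 t \<le> 1 - l \<and>
         (\<eta>2 t = - l \<or> \<eta>2 t = 1 - l \<or> (\<exists>s\<in>T. \<bar>t - s\<bar> \<le> \<kappa>)))"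
    by (rule sawtooth[OF l R1 \<epsilon>]) (rule that; assumption)+
  have b0: "b \<noteq> 0" using b by auto
  obtain \<kappa> where \<kappa>: "\<kappa> > 0" "{x \<in> K. \<exists>s\<in>T. \<bar>b \<bullet> x - s\<bar> \<le> \<kappa>} \<in> lmeasurable"
     "?m {x \<in> K. \<exists>s\<in>T. \<bar>b \<bullet> x - s\<bar> \<le> \<kappa>} < e / 2"
    using thin_slabs[OF K(1) T(1) b0, of "e / 2"] e by auto
  obtain \<eta> \<eta>1 \<eta>2 where \<eta>: "smooth \<eta>" "\<And>t. (\<eta> has_real_derivative \<eta>1 t) (at t)"
    "\<And>t. (\<eta>1 has_real_derivative \<eta>2 t) (at t)"
    and \<eta>R: "\<And>t. \<bar>t\<bar> \<le> R \<Longrightarrow> \<bar>\<eta> t\<bar> \<le> \<epsilon> \<and> \<bar>\<eta>1 t\<bar> \<le> \<epsilon> \<and> - l \<le> \<eta>2 t \<and> \<eta>2 t \<le> 1 - l \<and>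
         (\<eta>2 t = - l \<or> \<eta>2 t = 1 - l \<or> (\<exists>s\<in>T. \<bar>t - s\<bar> \<le> \<kappa>))"
    using T(2)[OF \<kappa>(1)] by blast
  have \<eta>1s: "smooth \<eta>1" by (rule smooth_real_derivative[OF \<eta>(1,2)])
  have \<eta>2s: "smooth \<eta>2" by (rule smooth_real_derivative[OF \<eta>1s \<eta>(3)])
  note rs = smooth_ridge[OF \<eta>(1), of b] smooth_ridge[OF \<eta>1s, of b] smooth_ridge[OF \<eta>2s, of b]
  define F where "F x = \<psi> x * \<eta> (b \<bullet> x)" for x
  have F: "F \<in> test_functions D" unfolding F_def by (rule test_functions_mult_smooth[OF \<psi>(1) rs(1)])
  note Fs = test_functions_smooth[OF F]
  define w where "w = (\<lambda>x. pd b F x *\<^sub>R a + pd c F x *\<^sub>R (- r))"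
  define \<theta> where "\<theta> x = \<psi> x * \<eta>2 (b \<bullet> x)" for x
  note field = constrained_field[OF Fs c r, folded w_def]
  have bb: "b \<bullet> b = 1" using b by (simp add: norm_eq_1)
  have pF: "pd v F x = \<psi> x * (\<eta>1 (b \<bullet> x) * (b \<bullet> v)) + pd v \<psi> x * \<eta> (b \<bullet> x)" for v x
    unfolding F_def pd_mult[OF \<psi>s rs(1)] pd_ridge[OF \<eta>(2)] ..
  have p1: "pd v (\<lambda>x. \<psi> x * \<eta>1 (b \<bullet> x)) x = \<psi> x * (\<eta>2 (b \<bullet> x) * (b \<bullet> v)) + pd v \<psi> x * \<eta>1 (b \<bullet> x)" for v x
    unfolding pd_mult[OF \<psi>s rs(2)] pd_ridge[OF \<eta>(3)] ..
  have p2: "pd v (\<lambda>x. pd d \<psi> x * \<eta> (b \<bullet> x)) x = pd d \<psi> x * (\<eta>1 (b \<bullet> x) * (b \<bullet> v)) + pd v (pd d \<psi>) x * \<eta> (b \<bullet> x)" for v d x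
    unfolding pd_mult[OF smooth_pd[OF \<psi>s] rs(1)] pd_ridge[OF \<eta>(2)] ..
  have bF: "pd b F = (\<lambda>x. \<psi> x * \<eta>1 (b \<bullet> x) + pd b \<psi> x * \<eta> (b \<bullet> x))"
    unfolding pF bb by simp
  have bc: "b \<bullet> c = 0" using cb by (simp add: inner_commute)
  \<comment> \<open>Since \<open>c\<close> is orthogonal to \<open>b\<close>, differentiation along
    \<open>c\<close> hits the cutoff only. The correction along \<open>r\<close> therefore contains
    no term with \<open>\<eta>2\<close> and is small together with its gradient.\<close>
  have cF: "pd c F = (\<lambda>x. pd c \<psi> x * \<eta> (b \<bullet> x))"
    unfolding pF bc by simp
  have s1: "smooth (\<lambda>x. \<psi> x * \<eta>1 (b \<bullet> x))" "smooth (\<lambda>x. pd b \<psi> x * \<eta> (b \<bullet> x))"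
    by (intro smooth_mult \<psi>s rs smooth_pd)+
  have hb: "pd h (pd b F) x = \<theta> x * (b \<bullet> h) + (pd h \<psi> x * \<eta>1 (b \<bullet> x)
      + pd b \<psi> x * (\<eta>1 (b \<bullet> x) * (b \<bullet> h)) + pd h (pd b \<psi>) x * \<eta> (b \<bullet> x))" for h x
    unfolding bF pd_add[OF s1] p1 p2 \<theta>_def by (simp add: algebra_simps)
  have hc: "pd h (pd c F) x = pd c \<psi> x * (\<eta>1 (b \<bullet> x) * (b \<bullet> h)) + pd h (pd c \<psi>) x * \<eta> (b \<bullet> x)" for h x
    unfolding cF p2 ..
  have off: "f x = 0" if "f \<in> test_functions D" "x \<notin> D" for f :: "real^'n \<Rightarrow> real" and x
    using test_function_support[OF that(1)] that(2) by (metis subsetD)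
  have small: "\<forall>y. \<bar>f y * g y\<bar> \<le> M * \<epsilon>" if f: "f \<in> Q" and g: "\<forall>x\<in>D. \<bar>g x\<bar> \<le> \<epsilon>" for f g :: "real^'n \<Rightarrow> real"
  proof
    fix y show "\<bar>f y * g y\<bar> \<le> M * \<epsilon>"
  proof (cases "y \<in> D")
    case True
    then show ?thesis unfolding abs_mult using M[OF f, of y] bspec[OF g True] M1 by (intro mult_mono) auto
  next
    case False
    then show ?thesis using off[OF Qt[OF f] False] M1 \<epsilon> by simp
  qed
  qed
  have g0: "\<bar>\<eta> (b \<bullet> x)\<bar> \<le> \<epsilon>" and g1: "\<bar>\<eta>1 (b \<bullet> x)\<bar> \<le> \<epsilon>" if "x \<in> D" for x
    using \<eta>R[OF R(2)[OF that]] by auto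
  have g2: "\<bar>\<eta>1 (b \<bullet> x) * (b \<bullet> axis j 1)\<bar> \<le> \<epsilon>" if "x \<in> D" for x j
  proof -
    have "\<bar>b \<bullet> axis j 1\<bar> \<le> 1" using Cauchy_Schwarz_ineq2[of b "axis j 1"] b by simp
    then have "\<bar>\<eta>1 (b \<bullet> x)\<bar> * \<bar>b \<bullet> axis j 1\<bar> \<le> \<epsilon> * 1" using g1[OF that] \<epsilon> by (intro mult_mono) auto
    then show ?thesis by (simp add: abs_mult)
  qed
  have g0': "\<forall>x\<in>D. \<bar>\<eta> (b \<bullet> x)\<bar> \<le> \<epsilon>" and g1': "\<forall>x\<in>D. \<bar>\<eta>1 (b \<bullet> x)\<bar> \<le> \<epsilon>"
    and g2': "\<forall>x\<in>D. \<bar>\<eta>1 (b \<bullet> x) * (b \<bullet> axis j 1)\<bar> \<le> \<epsilon>" for j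
    using g0 g1 g2 by blast+
  have Qin: "pd b \<psi> \<in> Q" "pd c \<psi> \<in> Q" "pd (axis j 1) \<psi> \<in> Q" "pd (axis j 1) (pd b \<psi>) \<in> Q" "pd (axis j 1) (pd c \<psi>) \<in> Q" for j
    by (auto simp: Q_def)
  have err: "norm (jacobian w (at x) - \<theta> x *\<^sub>R outer a b) \<le> \<delta>" for x
  proof -
    have "norm ((jacobian w (at x) - \<theta> x *\<^sub>R outer a b) *v axis j 1) \<le> 3 * (M * \<epsilon>) * norm a + 2 * (M * \<epsilon>) * norm r" for j
    proof -
      let ?h = "axis j 1 :: real^'n"
      define p where "p = pd ?h \<psi> x * \<eta>1 (b \<bullet> x) + pd b \<psi> x * (\<eta>1 (b \<bullet> x) * (b \<bullet> ?h)) + pd ?h (pd b \<psi>) x * \<eta> (b \<bullet> x)"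
      define q where "q = pd c \<psi> x * (\<eta>1 (b \<bullet> x) * (b \<bullet> ?h)) + pd ?h (pd c \<psi>) x * \<eta> (b \<bullet> x)"
      have "(jacobian w (at x) - \<theta> x *\<^sub>R outer a b) *v ?h = p *\<^sub>R a - q *\<^sub>R r"
        unfolding matrix_vector_mult_diff_rdistrib field(2) scaleR_matrix_vector_assoc[symmetric] outer_mult_vec hb hc p_def q_def
        by (simp add: algebra_simps)
      moreover have "norm (p *\<^sub>R a - q *\<^sub>R r) \<le> \<bar>p\<bar> * norm a + \<bar>q\<bar> * norm r"
        using norm_triangle_ineq4[of "p *\<^sub>R a" "q *\<^sub>R r"] by simp
      moreover have "\<bar>p\<bar> \<le> 3 * (M * \<epsilon>)"
        using small[OF Qin(3)[of j] g1', THEN spec, of x] small[OF Qin(1) g2'[of j], THEN spec, of x] small[OF Qin(4)[of j] g0', THEN spec, of x]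
        unfolding p_def by linarith
      moreover have "\<bar>q\<bar> \<le> 2 * (M * \<epsilon>)"
        using small[OF Qin(2) g2'[of j], THEN spec, of x] small[OF Qin(5)[of j] g0', THEN spec, of x]
        unfolding q_def by linarith
      ultimately show ?thesis
        using mult_right_mono[of "\<bar>p\<bar>" "3 * (M * \<epsilon>)" "norm a"] mult_right_mono[of "\<bar>q\<bar>" "2 * (M * \<epsilon>)" "norm r"] by simp
    qed
    then have "norm (jacobian w (at x) - \<theta> x *\<^sub>R outer a b) \<le> (\<Sum>j\<in>(UNIV::'n set). 3 * (M * \<epsilon>) * norm a + 2 * (M * \<epsilon>) * norm r)"
      by (intro order_trans[OF norm_matrix_columns] sum_mono) auto
    also have "\<dots> = \<epsilon> * (real CARD('n) * (3 * M * norm a + 2 * M * norm r))" by (simp add: algebra_simps)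
    also have "\<dots> \<le> \<epsilon> * C" using \<epsilon> M1 by (intro mult_left_mono) (auto simp: C_def)
    finally show ?thesis using \<epsilon>C by simp
  qed
  have ub: "norm (w x) \<le> \<delta>" for x
  proof -
    have \<psi>1: "\<bar>\<psi> x * \<eta>1 (b \<bullet> x)\<bar> \<le> M * \<epsilon>"
    proof (cases "x \<in> D")
      case True
      then show ?thesis unfolding abs_mult using \<psi>(3,4)[of x] g1[OF True] M1 by (intro mult_mono) auto
    next
      case False
      then show ?thesis using off[OF \<psi>(1) False] M1 \<epsilon> by simp
    qed
    have "\<bar>pd b F x\<bar> \<le> 2 * (M * \<epsilon>)"
      unfolding fun_cong[OF bF] using \<psi>1 small[OF Qin(1) g0', THEN spec, of x] by linarith
    moreover have "\<bar>pd c F x\<bar> \<le> M * \<epsilon>"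
      unfolding fun_cong[OF cF] by (rule small[OF Qin(2) g0', THEN spec])
    moreover have "norm (w x) \<le> \<bar>pd b F x\<bar> * norm a + \<bar>pd c F x\<bar> * norm r"
      unfolding w_def using norm_triangle_ineq[of "pd b F x *\<^sub>R a" "pd c F x *\<^sub>R (- r)"] by simp
    ultimately have "norm (w x) \<le> 2 * (M * \<epsilon>) * norm a + M * \<epsilon> * norm r"
      using mult_right_mono[of "\<bar>pd b F x\<bar>" "2 * (M * \<epsilon>)" "norm a"] mult_right_mono[of "\<bar>pd c F x\<bar>" "M * \<epsilon>" "norm r"] by simp
    also have "\<dots> = \<epsilon> * (2 * M * norm a + M * norm r)" by (simp add: algebra_simps)
    also have "\<dots> \<le> \<epsilon> * C" using \<epsilon> M1 by (intro mult_left_mono) (auto simp: C_def)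
    finally show ?thesis using \<epsilon>C by simp
  qed
  have \<theta>b: "- l \<le> \<theta> x \<and> \<theta> x \<le> 1 - l" for x
  proof (cases "x \<in> D")
    case True
    from \<eta>R[OF R(2)[OF True]] have h: "- l \<le> \<eta>2 (b \<bullet> x)" "\<eta>2 (b \<bullet> x) \<le> 1 - l" by auto
    have "\<psi> x * \<eta>2 (b \<bullet> x) \<le> \<psi> x * (1 - l)" "\<psi> x * (- l) \<le> \<psi> x * \<eta>2 (b \<bullet> x)"
      by (rule mult_left_mono[OF h(2) \<psi>(3)], rule mult_left_mono[OF h(1) \<psi>(3)])
    moreover have "\<psi> x * (1 - l) \<le> 1 * (1 - l)" "\<psi> x * l \<le> 1 * l"
      by (rule mult_right_mono[OF \<psi>(4)], use l in simp)+
    ultimately show ?thesis by (simp add: \<theta>_def)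
  next
    case False
    then show ?thesis using off[OF \<psi>(1) False] l by (simp add: \<theta>_def)
  qed
  have \<theta>s: "smooth \<theta>" unfolding \<theta>_def by (intro smooth_mult \<psi>s rs)
  define KB where "KB = K \<inter> {x. \<theta> x = 1 - l}"
  define KC where "KC = K \<inter> {x. \<theta> x = - l}"
  have KBC: "compact KB" "compact KC" unfolding KB_def KC_def
    by (intro compact_Int_closed K closed_Collect_eq smooth_continuous[OF \<theta>s] continuous_on_const)+
  have sub: "KB \<subseteq> D" "KC \<subseteq> D" using K by (auto simp: KB_def KC_def)
  let ?E = "{x \<in> K. \<exists>s\<in>T. \<bar>b \<bullet> x - s\<bar> \<le> \<kappa>}"
  have "K \<subseteq> KB \<union> KC \<union> ?E"
  proof
    fix x assume x: "x \<in> K"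
    then have "x \<in> D" using K by blast
    from \<eta>R[OF R(2)[OF this]] show "x \<in> KB \<union> KC \<union> ?E"
      using x \<psi>(2)[OF x] by (auto simp: KB_def KC_def \<theta>_def)
  qed
  moreover note lm = lmeasurable_compact[OF KBC(1)] lmeasurable_compact[OF KBC(2)] \<kappa>(2)
  ultimately have "?m K \<le> ?m (KB \<union> KC \<union> ?E)"
    using lmeasurable_compact[OF K(1)] by (intro measure_mono_fmeasurable) auto
  also have "\<dots> \<le> ?m (KB \<union> KC) + ?m ?E" using lm by (intro measure_Un_le) auto
  also have "?m (KB \<union> KC) \<le> ?m KB + ?m KC" using lm by (intro measure_Un_le) auto
  finally have full: "?m D - ?m KB - ?m KC \<le> e" using K(3) \<kappa>(3) by linarith
  have pdi: "pd b (\<lambda>x. \<psi> x * \<eta>1 (b \<bullet> x)) x = \<theta> x + pd b \<psi> x * \<eta>1 (b \<bullet> x)" for x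
    unfolding p1 bb \<theta>_def by simp
  obtain S where S: "compact S" "S \<subseteq> D" "\<And>x. x \<notin> S \<Longrightarrow> \<psi> x = 0" "\<And>x. x \<notin> S \<Longrightarrow> frechet_derivative \<psi> (at x) = (\<lambda>_. 0)"
    using test_function_support[OF \<psi>(1)] by metis
  have i1: "integrable lborel \<theta>"
    by (rule compactly_supported_continuous(2)[OF open_UNIV S(1) subset_UNIV smooth_continuous[OF \<theta>s]]) (simp add: \<theta>_def S(3))
  have i2: "integrable lborel (\<lambda>x. pd b \<psi> x * \<eta>1 (b \<bullet> x))"
    by (rule compactly_supported_continuous(2)[OF open_UNIV S(1) subset_UNIV smooth_continuous[OF smooth_mult[OF smooth_pd[OF \<psi>s] rs(2)]]]) (simp add: S(4))
  \<comment> \<open>Up to a term with \<open>\<eta>1\<close>, the function \<open>\<theta>\<close>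
    is a derivative of a compactly supported function, so its integral is nearly 0.\<close>
  have "(\<integral>x. pd b (\<lambda>x. \<psi> x * \<eta>1 (b \<bullet> x)) x \<partial>lborel) = 0"
    by (rule integral_derivative_compact_support[OF smooth_has_derivative[OF s1(1)] smooth_continuous[OF smooth_pd[OF s1(1)]] S(1)])
      (simp add: S(3))
  then have "(\<integral>x. \<theta> x \<partial>lborel) = - (\<integral>x. pd b \<psi> x * \<eta>1 (b \<bullet> x) \<partial>lborel)"
    unfolding pdi using i1 i2 by simp
  moreover have "\<bar>\<integral>x. pd b \<psi> x * \<eta>1 (b \<bullet> x) \<partial>lborel\<bar> \<le> M * \<epsilon> * ?m D"
  proof -
    have Db: "emeasure lborel D < \<infinity>" using D(2) by (rule emeasure_bounded_finite)
    have iD: "integrable lborel (\<lambda>x. M * \<epsilon> * indicator D x)"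
      using Db D(1) by (intro integrable_mult_right integrable_real_indicator) auto
    have "\<bar>\<integral>x. pd b \<psi> x * \<eta>1 (b \<bullet> x) \<partial>lborel\<bar> \<le> (\<integral>x. \<bar>pd b \<psi> x * \<eta>1 (b \<bullet> x)\<bar> \<partial>lborel)" by (rule integral_abs_bound)
    also have "\<dots> \<le> (\<integral>x. M * \<epsilon> * indicator D x \<partial>lborel)"
    proof (rule integral_mono[OF integrable_abs[OF i2] iD])
      fix x
      show "\<bar>pd b \<psi> x * \<eta>1 (b \<bullet> x)\<bar> \<le> M * \<epsilon> * indicator D x"
        using small[OF Qin(1) g1', THEN spec, of x] off[OF Qt[OF Qin(1)], of x] by (cases "x \<in> D") auto
    qed
    also have "\<dots> = M * \<epsilon> * measure lborel D" using D(1) by simp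
    also have "measure lborel D = ?m D" using D(1) by (simp add: measure_completion)
    finally show ?thesis .
  qed
  moreover have "M * \<epsilon> * ?m D \<le> e"
  proof -
    have "M * \<epsilon> * ?m D = \<epsilon> * (M * ?m D)" by simp
    also have "\<dots> \<le> \<epsilon> * C" using \<epsilon> M1 by (intro mult_left_mono) (auto simp: C_def)
    finally show ?thesis using \<epsilon>C by simp
  qed
  ultimately have int: "integrable lebesgue \<theta>" "\<bar>LINT x|lebesgue. \<theta> x\<bar> \<le> e"
    using i1 smooth_continuous[OF \<theta>s, of UNIV] by (auto simp: integrable_completion integral_completion)
  have "KB \<inter> KC = {}" by (auto simp: KB_def KC_def)
  note meas = two_level_measure_bounds[OF l Dm KBC(1) sub(1) KBC(2) sub(2) this, of \<theta> e]
  have hyps: "\<bar>\<theta> x\<bar> \<le> 1" "x \<notin> D \<Longrightarrow> \<theta> x = 0" for x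
    using \<theta>b[of x] l off[OF \<psi>(1), of x] by (auto simp: \<theta>_def)
  have vals: "x \<in> KB \<Longrightarrow> \<theta> x = 1 - l" "x \<in> KC \<Longrightarrow> \<theta> x = - l" for x by (auto simp: KB_def KC_def)
  have mB: "l * ?m D - \<delta> \<le> ?m KB" and mC: "(1 - l) * ?m D - \<delta> \<le> ?m KC"
    using meas[OF vals hyps int full] by (auto simp: e_def)
  have wt: "w \<in> test_functions D"
    unfolding w_def by (intro test_functions_add test_functions_scaleR test_functions_pd F)
  show thesis
    by (rule that[OF wt field(3) ub err \<theta>b KBC(1) sub(1) vals(1) mB KBC(2) sub(2) vals(2) mC])
qed

section \<open>Perturbations of affine maps\<close>

lemma test_function_off:
  fixes w :: "real^'n \<Rightarrow> real^'m"
  assumes "w \<in> test_functions D" "x \<notin> D"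
  shows "w x = 0" "jacobian w (at x) = 0"
proof -
  obtain K where K: "compact K" "K \<subseteq> D" "\<And>x. x \<notin> K \<Longrightarrow> w x = 0" "\<And>x. x \<notin> K \<Longrightarrow> frechet_derivative w (at x) = (\<lambda>_. 0)"
    using test_function_support[OF assms(1)] by metis
  have "x \<notin> K" using K(2) assms(2) by blast
  show "w x = 0" by (rule K(3)[OF \<open>x \<notin> K\<close>])
  show "jacobian w (at x) = 0"
    unfolding jacobian_def K(4)[OF \<open>x \<notin> K\<close>] by (simp add: matrix_def vec_eq_iff)
qed

lemma test_functions_mono: "w \<in> test_functions D \<Longrightarrow> D \<subseteq> D' \<Longrightarrow> w \<in> test_functions D'"
  unfolding test_functions_iff by (elim conjE, intro conjI) (assumption | erule (1) order_trans)+

lemma zero_test_function: "(\<lambda>x. 0) \<in> test_functions D"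
  by (rule test_functionsI[OF smooth_const compact_empty empty_subsetI]) simp

lemma jacobian_const_zero: "jacobian (\<lambda>x::real^'n. 0::real^'m) (at x) = 0"
  by (rule test_function_off(2)[OF zero_test_function, of x "{}"]) simp

lemma jacobian_add:
  fixes f g :: "real^'n \<Rightarrow> real^'m"
  assumes "f differentiable (at x)" "g differentiable (at x)"
  shows "jacobian (\<lambda>x. f x + g x) (at x) = jacobian f (at x) + jacobian g (at x)"
proof -
  have "((\<lambda>x. f x + g x) has_derivative (\<lambda>h. jacobian f (at x) *v h + jacobian g (at x) *v h)) (at x)"
    using assms by (intro has_derivative_add) (simp_all add: jacobian_works)
  from jacobian_mult[OF this] show ?thesis
    unfolding matrix_eq by (simp add: matrix_vector_mult_add_rdistrib)
qed

lemma measurable_jacobian_preimage: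
  fixes G :: "real^'n \<Rightarrow> real^'n^'m"
  assumes "open D" "bounded D" "continuous_on D G" "closed F"
  shows "{x \<in> D. G x \<in> F} \<in> lmeasurable"
proof -
  obtain C where C: "closed C" "D \<inter> G -` F = D \<inter> C"
    using continuous_closedin_preimage[OF assms(3,4)] unfolding closedin_closed by blast
  have "{x \<in> D. G x \<in> F} = D \<inter> C" using C(2) by auto
  moreover have "D \<in> lmeasurable" using assms by (intro bounded_set_imp_lmeasurable) auto
  then have "D \<inter> C \<in> lmeasurable"
    by (rule fmeasurable_Int_fmeasurable) (use C(1) in simp)
  ultimately show ?thesis by simp
qed

context hull_setting
begin

text \<open>The points of \<open>Sg\<close> whose distance to the part of \<open>Sg\<close> outside
  \<open>S\<close> is at least \<open>r\<close>. Written with open balls removed, the set is visibly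
  closed, which makes preimages under continuous gradients measurable.\<close>

definition deep :: "(real^'n^'m) set \<Rightarrow> real \<Rightarrow> (real^'n^'m) set" where
  "deep S r = Sg - (\<Union>y\<in>Sg - S. ball y r)"

lemma closed_deep: "closed (deep S r)"
  unfolding deep_def by (intro closed_Diff closed_Sg open_UN) auto

lemma deep_iff: "x \<in> deep S r \<longleftrightarrow> x \<in> Sg \<and> (\<forall>y\<in>Sg. dist y x < r \<longrightarrow> y \<in> S)"
  unfolding deep_def Diff_iff UN_iff mem_ball by blast

lemma deep_mem: "x \<in> deep S r \<Longrightarrow> r > 0 \<Longrightarrow> x \<in> S"
  using dist_self[of x] unfolding deep_iff by metis

lemma deep_shift:
  assumes "x \<in> deep S r" "y \<in> Sg" "dist y x \<le> r - r'"
  shows "y \<in> deep S r'"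
  unfolding deep_iff
proof (intro conjI ballI impI)
  fix u assume "u \<in> Sg" "dist u y < r'"
  then have "dist u x < r" using dist_triangle[of u x y] assms(3) by linarith
  then show "u \<in> S" using assms(1) \<open>u \<in> Sg\<close> unfolding deep_iff by blast
qed (rule assms)

text \<open>The margin \<open>r\<close> makes both gradient conditions survive replacing \<open>z\<close> by a continuous gradient that is
  nearly equal to \<open>z\<close>. In terms of the introduction, \<open>p z\<close> is the infimum of all \<open>q\<close> with \<open>good z q\<close>.\<close>

definition admissible ::
    "real^'n^'m \<Rightarrow> real \<Rightarrow> real \<Rightarrow> (real^'n) set \<Rightarrow> real \<Rightarrow> (real^'n \<Rightarrow> real^'m) \<Rightarrow> bool" where
  "admissible z q r D e w \<longleftrightarrow> w \<in> test_functions D \<and> (\<forall>x. L \<bullet> jacobian w (at x) = 0) \<and> (\<forall>x. norm (w x) \<le> e) \<and>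
     (\<forall>x\<in>D. z + jacobian w (at x) \<in> deep H r) \<and>
     (1 - q - e) * measure lebesgue D \<le> measure lebesgue {x \<in> D. z + jacobian w (at x) \<in> deep U r}"

text \<open>The margin \<open>r\<close> comes before \<open>D\<close> and \<open>e\<close> in the
  quantifiers: it may depend on \<open>z\<close> only, because in \<open>iteration_step\<close> the
  size of a ball is chosen according to \<open>r\<close>.\<close>

definition good :: "real^'n^'m \<Rightarrow> real \<Rightarrow> bool" where
  "good z q \<longleftrightarrow> (\<exists>r>0. \<forall>D e. open D \<and> bounded D \<and> e > 0 \<longrightarrow> (\<exists>w. admissible z q r D e w))"

lemma goodE:
  assumes "good z q"
  obtains r where "r > 0" "\<And>D e. open D \<Longrightarrow> bounded D \<Longrightarrow> e > 0 \<Longrightarrow> \<exists>w. admissible z q r D e w"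
  using assms unfolding good_def by blast

lemma admissibleD:
  assumes "admissible z q r D e w"
  shows "w \<in> test_functions D" "L \<bullet> jacobian w (at x) = 0" "norm (w x) \<le> e"
    "x \<in> D \<Longrightarrow> z + jacobian w (at x) \<in> deep H r"
    "(1 - q - e) * measure lebesgue D \<le> measure lebesgue {x \<in> D. z + jacobian w (at x) \<in> deep U r}"
  using assms unfolding admissible_def by simp_all

lemma admissibleI:
  assumes "w \<in> test_functions D" "\<And>x. L \<bullet> jacobian w (at x) = 0" "\<And>x. norm (w x) \<le> e"
    "\<And>x. x \<in> D \<Longrightarrow> z + jacobian w (at x) \<in> deep H r"
    "(1 - q - e) * measure lebesgue D \<le> measure lebesgue {x \<in> D. z + jacobian w (at x) \<in> deep U r}"
  shows "admissible z q r D e w"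
  using assms unfolding admissible_def by simp

lemma good_mono:
  assumes "good z q" "q \<le> q'"
  shows "good z q'"
proof -
  obtain r where r: "r > 0" "\<And>D e. open D \<Longrightarrow> bounded D \<Longrightarrow> e > 0 \<Longrightarrow> \<exists>w. admissible z q r D e w"
    using goodE[OF assms(1)] by blast
  show ?thesis
    unfolding good_def
  proof (intro exI[of _ r] conjI allI impI r(1), elim conjE)
    fix D :: "(real^'n) set" and e :: real assume D: "open D" "bounded D" "e > 0"
    obtain w where w: "admissible z q r D e w" using r(2)[OF D] by blast
    have "(1 - q' - e) * measure lebesgue D \<le> (1 - q - e) * measure lebesgue D"
      using assms(2) by (intro mult_right_mono) auto
    then have "admissible z q' r D e w"
      using admissibleD[OF w] by (intro admissibleI) auto
    then show "\<exists>w. admissible z q' r D e w" by blast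
  qed
qed

text \<open>The zero perturbation works, either because \<open>z\<close> is already in
  \<open>U\<close> with a margin or because the whole volume may fail.\<close>

lemma good_trivial:
  assumes "r > 0" "z \<in> deep H r" "q \<ge> 0" "z \<in> deep U r \<or> q \<ge> 1"
  shows "good z q"
  unfolding good_def
proof (intro exI[of _ r] conjI allI impI assms(1), elim conjE)
  fix D :: "(real^'n) set" and e :: real assume D: "open D" "bounded D" "e > 0"
  have "(1 - q - e) * measure lebesgue D \<le> measure lebesgue {x \<in> D. z \<in> deep U r}"
  proof (cases "z \<in> deep U r")
    case True
    have "(1 - q - e) * measure lebesgue D \<le> 1 * measure lebesgue D"
      using D assms(3) by (intro mult_right_mono) auto
    then show ?thesis using True by simp
  next
    case False
    then have "(1 - q - e) * measure lebesgue D \<le> 0" using assms(4) D by (intro mult_nonpos_nonneg) auto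
    then show ?thesis using False by simp
  qed
  then have "admissible z q r D e (\<lambda>x. 0)"
    using assms(2) D(3) by (intro admissibleI zero_test_function) (simp_all add: jacobian_const_zero)
  then show "\<exists>w. admissible z q r D e w" by blast
qed

lemma good_one:
  assumes "z \<in> H"
  shows "good z 1"
proof -
  obtain r where "r > 0" "\<forall>y\<in>Sg. dist y z < r \<longrightarrow> y \<in> H" using H_nbhd[OF assms] by blast
  then show ?thesis using assms H_subset by (intro good_trivial[of r]) (auto simp: deep_iff)
qed

lemma good_zero:
  assumes "z \<in> U"
  shows "good z 0"
proof -
  obtain r where "r > 0" "\<forall>y\<in>Sg. dist y z < r \<longrightarrow> y \<in> U" using U_nbhd[OF assms] by blast
  then show ?thesis using assms U_subset U_subset_H by (intro good_trivial[of r]) (auto simp: deep_iff)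
qed

section \<open>Convexity of the failing fraction along rank-one segments\<close>

text \<open>The adjoint of a left inverse of \<open>L\<close>, applied to \<open>b\<close>. It
  supplies the direction of the correction in \<open>building_block\<close>.\<close>

lemma dual_vector:
  obtains r where "\<And>x. r \<bullet> (L *v x) = b \<bullet> x"
proof -
  obtain g where g: "linear g" "g \<circ> (*v) L = id"
    using linear_injective_left_inverse[OF matrix_vector_mul_linear[of L] inj_L] by blast
  have "adjoint g b \<bullet> (L *v x) = b \<bullet> x" for x
    using adjoint_works[OF g(1), of "L *v x" b] g(2) by (simp add: fun_eq_iff inner_commute)
  then show thesis by (rule that)
qed

text \<open>A building block moves the gradient \<open>A\<close> close to \<open>B\<close> on about
  the fraction \<open>c\<close> of \<open>D\<close> and close to \<open>C\<close> on about
  \<open>1 - c\<close>. On open sets around these places, perturbations admissible for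
  \<open>B\<close> and \<open>C\<close> are added, so the failing fractions are averaged with the
  same weights. In the transition zones the gradient stays close to the segment from
  \<open>C\<close> to \<open>B\<close>, which lies in \<open>H\<close>.\<close>

lemma good_step_unit:
  assumes B: "B \<in> H" "good B qB" "0 \<le> qB" "qB \<le> 1" and C: "C \<in> H" "good C qC" "0 \<le> qC" "qC \<le> 1"
    and BC: "B - C = outer a b" and b: "norm b = 1" and a: "a \<noteq> 0" and c: "0 < c" "c < 1"
  shows "good (c *\<^sub>R B + (1 - c) *\<^sub>R C) (c * qB + (1 - c) * qC)"
proof -
  let ?m = "measure lebesgue" and ?O = "outer a b"
  define A where "A = c *\<^sub>R B + (1 - c) *\<^sub>R C"
  have S: "B \<in> Sg" "C \<in> Sg" using B C H_subset by auto
  then have AS: "A \<in> Sg" unfolding A_def by (rule Sg_convex_comb)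
  have ab: "a \<bullet> (L *v b) = 0" using Sg_diff[OF S] unfolding BC inner_outer .
  obtain r where r: "\<And>x. r \<bullet> (L *v x) = b \<bullet> x" using dual_vector by blast
  obtain rB where rB: "rB > 0" "\<And>D e. open D \<Longrightarrow> bounded D \<Longrightarrow> e > 0 \<Longrightarrow> \<exists>w. admissible B qB rB D e w"
    using goodE[OF B(2)] by blast
  obtain rC where rC: "rC > 0" "\<And>D e. open D \<Longrightarrow> bounded D \<Longrightarrow> e > 0 \<Longrightarrow> \<exists>w. admissible C qC rC D e w"
    using goodE[OF C(2)] by blast
  \<comment> \<open>Compactness of the segment gives one margin \<open>d\<close> in \<open>H\<close>
    for all its points, as required in the transition zones.\<close>
  define Seg where "Seg = (\<lambda>s. s *\<^sub>R B + (1 - s) *\<^sub>R C) ` {0..1}"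
  have "compact Seg" unfolding Seg_def by (intro compact_continuous_image continuous_intros) auto
  moreover have "Seg \<subseteq> H" unfolding Seg_def using H_segment[OF B(1) C(1) BC] by auto
  ultimately obtain d where d: "d > 0" "\<And>x y. x \<in> Seg \<Longrightarrow> y \<in> Sg \<Longrightarrow> dist y x < d \<Longrightarrow> y \<in> H"
    using compact_nbhd[OF _ _ H_nbhd, of Seg] by metis
  have O0: "norm ?O > 0" using a b by (simp add: norm_outer)
  \<comment> \<open>Half of each available margin is spent on the error of the building block, and
    half is kept. The bound by \<open>norm ?O\<close> keeps the regions near \<open>B\<close> and
    near \<open>C\<close> disjoint.\<close>
  define \<rho> where "\<rho> = min (min rB rC) (min d (norm ?O)) / 2"
  have \<rho>: "\<rho> > 0" "\<rho> \<le> rB - \<rho>" "\<rho> \<le> rC - \<rho>" "\<rho> \<le> d - \<rho>" "\<rho> + \<rho> \<le> norm ?O"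
    using rB rC d O0 by (auto simp: \<rho>_def)
  have "good A (c * qB + (1 - c) * qC)"
    unfolding good_def
  proof (intro exI[of _ \<rho>] conjI allI impI \<rho>(1), elim conjE)
    fix D :: "(real^'n) set" and e :: real assume D: "open D" "bounded D" and e: "e > 0"
    show "\<exists>w. admissible A (c * qB + (1 - c) * qC) \<rho> D e w"
    proof (cases "D = {}")
      case True
      then have "admissible A (c * qB + (1 - c) * qC) \<rho> D e (\<lambda>x. 0)"
        using e by (intro admissibleI zero_test_function) (simp_all add: jacobian_const_zero)
      then show ?thesis by blast
    next
      case False
      have Dm: "D \<in> lmeasurable" using D by (intro bounded_set_imp_lmeasurable) auto
      have "\<not> negligible D" using open_not_negligible[OF D(1) False] .
      then have D0: "?m D > 0" using Dm by (simp add: negligible_iff_measure zero_less_measure_iff)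
      \<comment> \<open>The three bounds serve the size of the perturbation, the closeness of
        gradients, and the loss of volume.\<close>
      define \<delta> where "\<delta> = min (min (e / 4) (\<rho> / 2)) (e * ?m D / 4)"
      have \<delta>: "\<delta> > 0" "\<delta> \<le> e / 4" "\<delta> < \<rho>" "\<delta> \<le> e * ?m D / 4"
        using e \<rho> D0 unfolding \<delta>_def by auto
      obtain w \<theta> KB KC where w: "w \<in> test_functions D" "\<And>x. L \<bullet> jacobian w (at x) = 0" "\<And>x. norm (w x) \<le> \<delta>"
        "\<And>x. norm (jacobian w (at x) - \<theta> x *\<^sub>R ?O) \<le> \<delta>" "\<And>x. - c \<le> \<theta> x \<and> \<theta> x \<le> 1 - c"
        and KB: "compact KB" "KB \<subseteq> D" "\<And>x. x \<in> KB \<Longrightarrow> \<theta> x = 1 - c" "c * ?m D - \<delta> \<le> ?m KB"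
        and KC: "compact KC" "KC \<subseteq> D" "\<And>x. x \<in> KC \<Longrightarrow> \<theta> x = - c" "(1 - c) * ?m D - \<delta> \<le> ?m KC"
        by (rule building_block[OF b ab r D c \<delta>(1)]) (rule that; assumption)
      have ws: "smooth w" by (rule test_functions_smooth[OF w(1)])
      \<comment> \<open>The compact sets \<open>KB\<close> and \<open>KC\<close> are enlarged to
        open ones, on which admissible perturbations are available.\<close>
      define DB where "DB = D \<inter> {x. norm (jacobian w (at x) - (1 - c) *\<^sub>R ?O) < \<rho>}"
      define DC where "DC = D \<inter> {x. norm (jacobian w (at x) - (- c) *\<^sub>R ?O) < \<rho>}"
      have oD: "open DB" "open DC" unfolding DB_def DC_def
        by (intro open_Int D open_Collect_less continuous_intros continuous_jacobian[OF ws])+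
      have bD: "bounded DB" "bounded DC" using D(2) by (auto simp: DB_def DC_def intro: bounded_subset)
      have mD: "DB \<in> lmeasurable" "DC \<in> lmeasurable" using oD bD by (auto intro!: bounded_set_imp_lmeasurable)
      have disj: "DB \<inter> DC = {}"
      proof (rule ccontr)
        assume "DB \<inter> DC \<noteq> {}"
        then obtain x where x: "norm (jacobian w (at x) - (1 - c) *\<^sub>R ?O) < \<rho>" "norm (jacobian w (at x) - (- c) *\<^sub>R ?O) < \<rho>"
          by (auto simp: DB_def DC_def)
        have "?O = (jacobian w (at x) - (- c) *\<^sub>R ?O) - (jacobian w (at x) - (1 - c) *\<^sub>R ?O)"
          by (simp add: algebra_simps)
        then have "norm ?O \<le> norm (jacobian w (at x) - (- c) *\<^sub>R ?O) + norm (jacobian w (at x) - (1 - c) *\<^sub>R ?O)"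
          using norm_triangle_ineq4 by metis
        then show False using x \<rho>(5) by linarith
      qed
      have KD: "KB \<subseteq> DB" "KC \<subseteq> DC"
      proof -
        show "KB \<subseteq> DB"
        proof
          fix x assume x: "x \<in> KB"
          have "norm (jacobian w (at x) - (1 - c) *\<^sub>R ?O) < \<rho>"
            using w(4)[of x] \<delta>(3) unfolding KB(3)[OF x] by linarith
          then show "x \<in> DB" using x KB(2) unfolding DB_def by blast
        qed
        show "KC \<subseteq> DC"
        proof
          fix x assume x: "x \<in> KC"
          have "norm (jacobian w (at x) - (- c) *\<^sub>R ?O) < \<rho>"
            using w(4)[of x] \<delta>(3) unfolding KC(3)[OF x] by linarith
          then show "x \<in> DC" using x KC(2) unfolding DC_def by blast
        qed
      qed
      have e4: "e / 4 > 0" using e by simp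
      obtain wB where "admissible B qB rB DB (e / 4) wB" using rB(2)[OF oD(1) bD(1) e4] by blast
      note wB = admissibleD[OF this]
      obtain wC where "admissible C qC rC DC (e / 4) wC" using rC(2)[OF oD(2) bD(2) e4] by blast
      note wC = admissibleD[OF this]
      have wBs: "smooth wB" and wCs: "smooth wC" using wB(1) wC(1) by (auto intro: test_functions_smooth)
      define W where "W x = (w x + wB x) + wC x" for x
      have DBC: "DB \<subseteq> D" "DC \<subseteq> D" by (auto simp: DB_def DC_def)
      have Wt: "W \<in> test_functions D" unfolding W_def
        by (intro test_functions_add w(1) test_functions_mono[OF wB(1) DBC(1)] test_functions_mono[OF wC(1) DBC(2)])
      have jW: "jacobian W (at x) = jacobian w (at x) + jacobian wB (at x) + jacobian wC (at x)" for x
        unfolding W_def by (simp add: jacobian_add smooth_differentiable ws wBs wCs smooth_add)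
      have LW: "L \<bullet> jacobian W (at x) = 0" for x
        unfolding jW inner_add_right w(2) wB(2) wC(2) by simp
      have ASx: "A + jacobian W (at x) \<in> Sg" for x by (rule Sg_add[OF AS LW])
      have nW: "norm (W x) \<le> e" for x
        using norm_triangle_ineq[of "w x + wB x" "wC x"] norm_triangle_ineq[of "w x" "wB x"]
          w(3)[of x] wB(3)[of x] wC(3)[of x] \<delta>(2) e unfolding W_def by linarith
      have AB: "A + (1 - c) *\<^sub>R ?O = B" and AC: "A + (- c) *\<^sub>R ?O = C"
        unfolding A_def BC[symmetric] by (simp_all add: algebra_simps)
      have dB: "dist (A + jacobian W (at x)) (B + jacobian wB (at x)) \<le> \<rho>" if "x \<in> DB" for x
      proof -
        have "jacobian wC (at x) = 0" using test_function_off[OF wC(1)] disj that by blast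
        then have "A + jacobian W (at x) - (B + jacobian wB (at x)) = jacobian w (at x) - (1 - c) *\<^sub>R ?O"
          unfolding jW AB[symmetric] by simp
        then show ?thesis using that unfolding dist_norm DB_def by simp
      qed
      have dC: "dist (A + jacobian W (at x)) (C + jacobian wC (at x)) \<le> \<rho>" if "x \<in> DC" for x
      proof -
        have "jacobian wB (at x) = 0" using test_function_off[OF wB(1)] disj that by blast
        then have "A + jacobian W (at x) - (C + jacobian wC (at x)) = jacobian w (at x) - (- c) *\<^sub>R ?O"
          unfolding jW AC[symmetric] by simp
        then show ?thesis using that unfolding dist_norm DC_def by simp
      qed
      have inH: "A + jacobian W (at x) \<in> deep H \<rho>" if "x \<in> D" for x
      proof -
        consider "x \<in> DB" | "x \<in> DC" | "x \<notin> DB" "x \<notin> DC" by blast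
        then show ?thesis
        proof cases
          case 1
          show ?thesis using dB[OF 1] \<rho>(2) by (intro deep_shift[OF wB(4)[OF 1] ASx]) auto
        next
          case 2
          show ?thesis using dC[OF 2] \<rho>(3) by (intro deep_shift[OF wC(4)[OF 2] ASx]) auto
        next
          case 3
          let ?s = "(c + \<theta> x) *\<^sub>R B + (1 - (c + \<theta> x)) *\<^sub>R C"
          have "?s \<in> Seg" unfolding Seg_def using w(5)[of x] by (intro imageI) auto
          then have "?s \<in> deep H d"
            using d(2) Sg_convex_comb[OF S] unfolding deep_iff by blast
          moreover have "?s = A + \<theta> x *\<^sub>R ?O" unfolding A_def BC[symmetric] by (simp add: algebra_simps)
          moreover have "jacobian wB (at x) = 0" "jacobian wC (at x) = 0"
            using test_function_off(2)[OF wB(1) 3(1)] test_function_off(2)[OF wC(1) 3(2)] by auto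
          ultimately have "dist (A + jacobian W (at x)) ?s \<le> d - \<rho>"
            using w(4)[of x] \<delta>(3) \<rho>(4) unfolding jW dist_norm by simp
          then show ?thesis using \<open>?s \<in> deep H d\<close> by (intro deep_shift[OF _ ASx])
        qed
      qed
      let ?GB = "{x \<in> DB. B + jacobian wB (at x) \<in> deep U rB}" and ?GC = "{x \<in> DC. C + jacobian wC (at x) \<in> deep U rC}"
      let ?G = "{x \<in> D. A + jacobian W (at x) \<in> deep U \<rho>}"
      have sub: "?GB \<union> ?GC \<subseteq> ?G"
      proof
        fix x assume "x \<in> ?GB \<union> ?GC"
        then show "x \<in> ?G"
        proof
          assume x: "x \<in> ?GB"
          then have "A + jacobian W (at x) \<in> deep U \<rho>"
            using dB[of x] \<rho>(2) by (intro deep_shift[OF _ ASx, of "B + jacobian wB (at x)" U rB]) auto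
          then show ?thesis using x DBC by auto
        next
          assume x: "x \<in> ?GC"
          then have "A + jacobian W (at x) \<in> deep U \<rho>"
            using dC[of x] \<rho>(3) by (intro deep_shift[OF _ ASx, of "C + jacobian wC (at x)" U rC]) auto
          then show ?thesis using x DBC by auto
        qed
      qed
      have GBm: "?GB \<in> lmeasurable" and GCm: "?GC \<in> lmeasurable" and Gm: "?G \<in> lmeasurable"
        by (intro measurable_jacobian_preimage oD bD D closed_deep continuous_intros continuous_jacobian
            wBs wCs test_functions_smooth[OF Wt])+
      have "?m ?GB + ?m ?GC = ?m (?GB \<union> ?GC)"
      proof -
        have "?GB \<inter> ?GC = {}" using disj by blast
        then show ?thesis using measure_Un3[OF GBm GCm] by (simp only: measure_empty diff_zero)
      qed
      also have "\<dots> \<le> ?m ?G" using sub GBm GCm Gm by (intro measure_mono_fmeasurable) auto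
      finally have GG: "?m ?GB + ?m ?GC \<le> ?m ?G" .
      have "?m DB + ?m DC = ?m (DB \<union> DC)"
        using measure_Un3[OF mD] by (simp only: disj measure_empty diff_zero)
      also have "\<dots> \<le> ?m D" using DBC mD Dm by (intro measure_mono_fmeasurable) auto
      finally have DD: "?m DB + ?m DC \<le> ?m D" .
      have KBle: "c * ?m D - \<delta> \<le> ?m DB"
        using KB(4) measure_mono_fmeasurable[OF KD(1) fmeasurableD[OF lmeasurable_compact[OF KB(1)]] mD(1)] by linarith
      have KCle: "(1 - c) * ?m D - \<delta> \<le> ?m DC"
        using KC(4) measure_mono_fmeasurable[OF KD(2) fmeasurableD[OF lmeasurable_compact[OF KC(1)]] mD(2)] by linarith
      have "(1 - qB) * (c * ?m D - \<delta>) \<le> (1 - qB) * ?m DB" using KBle B(4) by (intro mult_left_mono) auto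
      moreover have "(1 - qB) * \<delta> \<le> 1 * \<delta>" using \<delta>(1) B(3) by (intro mult_right_mono) auto
      ultimately have 1: "(1 - qB) * (c * ?m D) - \<delta> \<le> (1 - qB) * ?m DB" by (simp add: right_diff_distrib)
      have "(1 - qC) * ((1 - c) * ?m D - \<delta>) \<le> (1 - qC) * ?m DC" using KCle C(4) by (intro mult_left_mono) auto
      moreover have "(1 - qC) * \<delta> \<le> 1 * \<delta>" using \<delta>(1) C(3) by (intro mult_right_mono) auto
      ultimately have 2: "(1 - qC) * ((1 - c) * ?m D) - \<delta> \<le> (1 - qC) * ?m DC" by (simp add: right_diff_distrib)
      have 3: "(e / 4) * (?m DB + ?m DC) \<le> (e / 4) * ?m D" using DD e by (intro mult_left_mono) auto
      \<comment> \<open>The volume lost is at most \<open>2 * \<delta>\<close> in the building block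
        and \<open>e / 4\<close> of \<open>D\<close> in the two perturbations, less than the
        fraction \<open>e\<close> in total.\<close>
      have "(1 - (c * qB + (1 - c) * qC) - e) * ?m D
          = (1 - qB) * (c * ?m D) + (1 - qC) * ((1 - c) * ?m D) - e * ?m D" by (simp add: algebra_simps)
      also have "\<dots> \<le> (1 - qB) * ?m DB + (1 - qC) * ?m DC - (e / 4) * (?m DB + ?m DC)"
        using 1 2 3 \<delta>(4) mult_pos_pos[OF e D0] by linarith
      also have "\<dots> = (1 - qB - e / 4) * ?m DB + (1 - qC - e / 4) * ?m DC" by (simp add: algebra_simps)
      also have "\<dots> \<le> ?m ?G" using wB(5) wC(5) GG by linarith
      finally have "admissible A (c * qB + (1 - c) * qC) \<rho> D e W"
        by (intro admissibleI Wt LW nW inH)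
      then show ?thesis by blast
    qed
  qed
  then show ?thesis by (simp add: A_def)
qed

text \<open>A vanishing \<open>outer a b\<close> means equal end points, where the better of the two
  fractions is at most their mean. Otherwise the norm of \<open>b\<close> is moved to
  \<open>a\<close>.\<close>

lemma good_step:
  assumes B: "B \<in> H" "good B qB" "0 \<le> qB" "qB \<le> 1" and C: "C \<in> H" "good C qC" "0 \<le> qC" "qC \<le> 1"
    and BC: "B - C = outer a b" and c: "0 < c" "c < 1"
  shows "good (c *\<^sub>R B + (1 - c) *\<^sub>R C) (c * qB + (1 - c) * qC)"
proof (cases "a = 0 \<or> b = 0")
  case True
  then have "B = C" using BC by (auto simp: vec_eq_iff)
  then have eq: "c *\<^sub>R B + (1 - c) *\<^sub>R C = B" by (simp add: algebra_simps)
  show ?thesis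
  proof (cases "qB \<le> qC")
    case True
    then have "(1 - c) * qB \<le> (1 - c) * qC" using c by (intro mult_left_mono) auto
    then have "qB \<le> c * qB + (1 - c) * qC" by (simp add: algebra_simps)
    then show ?thesis using good_mono[OF B(2)] eq by simp
  next
    case False
    then have "c * qC \<le> c * qB" using c by (intro mult_left_mono) auto
    then have "qC \<le> c * qB + (1 - c) * qC" by (simp add: algebra_simps)
    then show ?thesis using good_mono[OF C(2)] eq \<open>B = C\<close> by simp
  qed
next
  case False
  have "B - C = outer (norm b *\<^sub>R a) ((1 / norm b) *\<^sub>R b)"
    using BC False by (simp add: vec_eq_iff)
  then show ?thesis
    by (rule good_step_unit[OF B C]) (use False c in auto)
qed

text \<open>Restricting the infimum to fractions in the unit interval gives \<open>p\<close> the
  bounds that \<open>vanishing_on_H\<close> asks for. The infimum need not be attained, so every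
  positive \<open>q\<close> is reached, but not 0.\<close>

theorem good_everywhere:
  assumes z: "z \<in> H" and q: "q > 0"
  shows "good z q"
proof -
  define Q where "Q x = {q. 0 \<le> q \<and> q \<le> 1 \<and> good x q}" for x
  define p where "p x = Inf (Q x)" for x
  have ne: "1 \<in> Q x" if "x \<in> H" for x using good_one[OF that] by (simp add: Q_def)
  have bdd: "bdd_below (Q x)" for x by (rule bdd_belowI[of _ 0]) (simp add: Q_def)
  have approx: "\<exists>q\<in>Q x. q < p x + e" if "x \<in> H" "e > 0" for x e
    using cInf_lessD[of "Q x" "p x + e"] ne[OF that(1)] that(2) unfolding p_def by auto
  have "p z = 0"
  proof (rule vanishing_on_H[OF _ _ _ z])
    show "0 \<le> p x \<and> p x \<le> 1" if "x \<in> H" for x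
      unfolding p_def using ne[OF that] bdd by (auto intro: cInf_lower cInf_greatest simp: Q_def)
    show "p x = 0" if "x \<in> U" for x
    proof -
      have "0 \<in> Q x" using good_zero[OF that] by (simp add: Q_def)
      then have "p x \<le> 0" unfolding p_def using bdd by (rule cInf_lower)
      moreover have "Q x \<noteq> {}" using \<open>0 \<in> Q x\<close> by blast
      then have "0 \<le> p x" unfolding p_def by (rule cInf_greatest) (simp add: Q_def)
      ultimately show ?thesis by simp
    qed
    fix x y a b c assume x: "x \<in> H" and y: "y \<in> H" and xy: "x - y = outer a b" and c: "0 < c" "c < (1::real)"
    show "p (c *\<^sub>R x + (1 - c) *\<^sub>R y) \<le> c * p x + (1 - c) * p y"
    proof (rule field_le_epsilon)
      fix e :: real assume e: "e > 0"
      obtain qx where qx: "qx \<in> Q x" "qx < p x + e" using approx[OF x e] by blast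
      obtain qy where qy: "qy \<in> Q y" "qy < p y + e" using approx[OF y e] by blast
      have g: "good (c *\<^sub>R x + (1 - c) *\<^sub>R y) (c * qx + (1 - c) * qy)"
        using qx(1) qy(1) by (intro good_step[OF x _ _ _ y _ _ _ xy c]) (auto simp: Q_def)
      have "c * qx + (1 - c) * qy \<le> c * 1 + (1 - c) * 1"
        using qx(1) qy(1) c by (intro add_mono mult_left_mono) (auto simp: Q_def)
      then have "c * qx + (1 - c) * qy \<in> Q (c *\<^sub>R x + (1 - c) *\<^sub>R y)"
        using g qx(1) qy(1) c by (auto simp: Q_def)
      then have "p (c *\<^sub>R x + (1 - c) *\<^sub>R y) \<le> c * qx + (1 - c) * qy"
        unfolding p_def using bdd by (rule cInf_lower)
      also have "\<dots> \<le> c * (p x + e) + (1 - c) * (p y + e)"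
        using qx(2) qy(2) c by (intro add_mono mult_left_mono) auto
      finally show "p (c *\<^sub>R x + (1 - c) *\<^sub>R y) \<le> c * p x + (1 - c) * p y + e"
        by (simp add: algebra_simps)
    qed
  qed
  then obtain q' where "q' \<in> Q z" "q' < q" using approx[OF z q] by auto
  then show ?thesis using good_mono[of z q' q] by (simp add: Q_def)
qed

end

section \<open>Iteration\<close>

text \<open>Vitali's covering theorem exhausts \<open>O'\<close> by countably many disjoint balls up
  to a null set; finitely many of them already have almost the full measure. Finiteness keeps sums
  of perturbations within the test functions.\<close>

lemma finite_disjoint_balls:
  fixes O' :: "'a::euclidean_space set"
  assumes O: "open O'" "bounded O'" and P: "\<And>x. x \<in> O' \<Longrightarrow> \<exists>d>0. \<forall>s. 0 < s \<and> s < d \<longrightarrow> P x s"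
    and sub: "\<And>x s. P x s \<Longrightarrow> ball x s \<subseteq> O'" and e: "e > 0"
  obtains F where "finite F" "\<And>x s. (x, s) \<in> F \<Longrightarrow> x \<in> O' \<and> 0 < s \<and> P x s"
    "pairwise (\<lambda>i j. disjnt (ball (fst i) (snd i)) (ball (fst j) (snd j))) F"
    "measure lebesgue O' - e < measure lebesgue (\<Union>i\<in>F. ball (fst i) (snd i))"
proof -
  define K where "K = {(x, s). x \<in> O' \<and> 0 < s \<and> P x s}"
  let ?b = "\<lambda>i::'a \<times> real. ball (fst i) (snd i)"
  have Om: "O' \<in> lmeasurable" using O by (intro bounded_set_imp_lmeasurable) auto
  have cover: "\<exists>i. i \<in> K \<and> x \<in> ?b i \<and> snd i < d" if x: "x \<in> O'" and d: "0 < d" for x d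
  proof -
    obtain d' where d': "d' > 0" "\<forall>s. 0 < s \<and> s < d' \<longrightarrow> P x s" using P[OF x] by blast
    define s where "s = min d d' / 2"
    have s: "0 < s" "s < d" "s < d'" using d d'(1) by (auto simp: s_def)
    then have "(x, s) \<in> K" using d'(2) x by (simp add: K_def)
    then show ?thesis using s by (intro exI[of _ "(x, s)"]) simp
  qed
  obtain C where C: "countable C" "C \<subseteq> K" "pairwise (\<lambda>i j. disjnt (?b i) (?b j)) C"
     "negligible (O' - (\<Union>i\<in>C. ?b i))"
    using Vitali_covering_theorem_balls[of O' K fst snd, OF cover] by blast
  \<comment> \<open>The intersection with \<open>C\<close> makes the definition right for empty
    \<open>C\<close> too, where \<open>from_nat_into\<close> returns an arbitrary value.\<close>
  define B where "B n = (\<Union>i\<in>C \<inter> from_nat_into C ` {..<n}. ?b i)" for n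
  have UB: "(\<Union>n. B n) = (\<Union>i\<in>C. ?b i)"
  proof
    show "(\<Union>i\<in>C. ?b i) \<subseteq> (\<Union>n. B n)"
    proof
      fix x assume "x \<in> (\<Union>i\<in>C. ?b i)"
      then obtain i where i: "i \<in> C" "x \<in> ?b i" by blast
      obtain n where n: "from_nat_into C n = i"
        using subset_range_from_nat_into[OF C(1)] i(1) by blast
      then have "x \<in> B (Suc n)" unfolding B_def using i by blast
      then show "x \<in> (\<Union>n. B n)" by blast
    qed
  qed (auto simp: B_def)
  have UO: "(\<Union>i\<in>C. ?b i) \<subseteq> O'"
  proof
    fix x assume "x \<in> (\<Union>i\<in>C. ?b i)"
    then obtain i where i: "i \<in> C" "x \<in> ?b i" by blast
    then have "P (fst i) (snd i)" using C(2) by (auto simp: K_def)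
    then show "x \<in> O'" using sub i(2) by blast
  qed
  have Bo: "open (B n)" for n unfolding B_def by (intro open_UN) auto
  have BO: "B n \<subseteq> O'" for n using UO UB by blast
  have Bm: "B n \<in> lmeasurable" for n
    using Bo bounded_subset[OF O(2) BO] by (intro bounded_set_imp_lmeasurable) auto
  have "incseq B" unfolding B_def incseq_def by (intro allI impI UN_mono Int_mono image_mono) auto
  moreover have Um: "(\<Union>n. B n) \<in> lmeasurable"
  proof -
    have "open (\<Union>n. B n)" using Bo by blast
    moreover have "bounded (\<Union>n. B n)" using UO unfolding UB by (rule bounded_subset[OF O(2)])
    ultimately show ?thesis by (intro bounded_set_imp_lmeasurable) auto
  qed
  ultimately have "(\<lambda>n. measure lebesgue (B n)) \<longlonglongrightarrow> measure lebesgue (\<Union>n. B n)"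
    using fmeasurableD[OF Bm] fmeasurableD2[OF Um] by (intro Lim_measure_incseq) (simp_all add: image_subset_iff)
  moreover have "measure lebesgue (\<Union>n. B n) = measure lebesgue O'"
  proof -
    have "measure lebesgue (O' - (\<Union>n. B n)) = measure lebesgue O' - measure lebesgue (\<Union>n. B n)"
      using Om Um UO UB by (intro measurable_measure_Diff) auto
    moreover have "measure lebesgue (O' - (\<Union>n. B n)) = 0"
      unfolding UB by (rule negligible_imp_measure0[OF C(4)])
    ultimately show ?thesis by simp
  qed
  ultimately have "eventually (\<lambda>n. measure lebesgue O' - e < measure lebesgue (B n)) sequentially"
    using e by (intro order_tendstoD(1)) auto
  then obtain n where n: "measure lebesgue O' - e < measure lebesgue (B n)" unfolding eventually_sequentially by blast
  show thesis
  proof (rule that)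
    show "finite (C \<inter> from_nat_into C ` {..<n})" by simp
    show "x \<in> O' \<and> 0 < s \<and> P x s" if "(x, s) \<in> C \<inter> from_nat_into C ` {..<n}" for x s
      using that C(2) by (auto simp: K_def)
    show "pairwise (\<lambda>i j. disjnt (?b i) (?b j)) (C \<inter> from_nat_into C ` {..<n})"
      using C(3) by (rule pairwise_subset) auto
    show "measure lebesgue O' - e < measure lebesgue (\<Union>i\<in>C \<inter> from_nat_into C ` {..<n}. ?b i)"
      using n by (simp add: B_def)
  qed
qed

lemma test_functions_sum:
  assumes "finite F" "\<And>i. i \<in> F \<Longrightarrow> w i \<in> test_functions D"
  shows "(\<lambda>x. \<Sum>i\<in>F. w i x) \<in> test_functions D"
  using assms by (induction F rule: finite_induct) (auto intro: test_functions_add zero_test_function)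

lemma jacobian_sum:
  fixes w :: "'i \<Rightarrow> real^'n \<Rightarrow> real^'m"
  assumes "finite F" "\<And>i. i \<in> F \<Longrightarrow> smooth (w i)"
  shows "jacobian (\<lambda>x. \<Sum>i\<in>F. w i x) (at x) = (\<Sum>i\<in>F. jacobian (w i) (at x))"
  using assms
proof (induction F rule: finite_induct)
  case (insert i F)
  have "smooth (\<lambda>x. \<Sum>i\<in>F. w i x)" using insert by (intro smooth_sum) auto
  then show ?case using insert by (simp add: jacobian_add smooth_differentiable)
qed (simp add: jacobian_const_zero)

lemma sum_single_support:
  assumes "finite F" "i \<in> F" "\<And>j. j \<in> F \<Longrightarrow> j \<noteq> i \<Longrightarrow> f j = 0"
  shows "sum f F = f i"
proof -
  have "sum f F = sum f {i}" by (rule sum.mono_neutral_right) (use assms in auto)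
  then show ?thesis by simp
qed

context hull_setting
begin

lemma iteration_step:
  assumes O: "open O'" "bounded O'" and cont: "continuous_on O' J" and JH: "\<And>x. x \<in> O' \<Longrightarrow> J x \<in> H" and e: "e > 0"
  obtains w K where "w \<in> test_functions O'" "\<And>x. norm (w x) \<le> e" "\<And>x. x \<in> O' \<Longrightarrow> J x + jacobian w (at x) \<in> H"
    "compact K" "K \<subseteq> O'" "\<And>x. x \<in> K \<Longrightarrow> J x + jacobian w (at x) \<in> U" "measure lebesgue (O' - K) \<le> e"
proof -
  let ?m = "measure lebesgue"
  have Om: "O' \<in> lmeasurable" using O by (intro bounded_set_imp_lmeasurable) auto
  define M where "M = ?m O' + 1"
  have M: "M > 0" "?m O' \<le> M" by (simp_all add: M_def add_nonneg_pos)
  \<comment> \<open>Each ball loses at most the fraction \<open>q + e' \<le> 2 * q\<close>, hence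
    all balls together at most \<open>e / 2\<close>. The summand 1 in \<open>M\<close> avoids
    division by zero.\<close>
  define q where "q = e / (4 * M)"
  have q1: "q > 0" "2 * q * M = e / 2" using e M by (simp_all add: q_def)
  have "2 * q * ?m O' \<le> 2 * q * M" using q1(1) M(2) by (intro mult_left_mono) auto
  then have q: "q > 0" "2 * q * ?m O' \<le> e / 2" using q1 by auto
  define e' where "e' = min e q"
  have e': "e' > 0" "e' \<le> e" "e' \<le> q" using e q by (auto simp: e'_def)
  have "\<forall>z\<in>H. \<exists>r>0. \<forall>D e. open D \<and> bounded D \<and> e > 0 \<longrightarrow> (\<exists>w. admissible z q r D e w)"
    using good_everywhere[OF _ q(1)] unfolding good_def by blast
  then obtain rr where rr: "\<And>z. z \<in> H \<Longrightarrow> rr z > 0"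
    "\<And>z D e. z \<in> H \<Longrightarrow> open D \<Longrightarrow> bounded D \<Longrightarrow> e > 0 \<Longrightarrow> \<exists>w. admissible z q (rr z) D e w"
    by metis
  define P where "P x s \<longleftrightarrow> x \<in> O' \<and> ball x s \<subseteq> O' \<and> (\<forall>y\<in>ball x s. dist (J y) (J x) \<le> rr (J x) / 2)" for x s
  have P: "\<exists>d>0. \<forall>s. 0 < s \<and> s < d \<longrightarrow> P x s" if x: "x \<in> O'" for x
  proof -
    obtain d1 where d1: "d1 > 0" "ball x d1 \<subseteq> O'" using O(1) x open_contains_ball by blast
    have "rr (J x) / 2 > 0" using rr(1)[OF JH[OF x]] by simp
    then obtain d2 where d2: "d2 > 0" "\<And>y. y \<in> O' \<Longrightarrow> dist y x < d2 \<Longrightarrow> dist (J y) (J x) < rr (J x) / 2"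
      using cont x unfolding continuous_on_iff by meson
    have "P x s" if s: "0 < s" "s < min d1 d2" for s
    proof -
      have sub: "ball x s \<subseteq> O'" using d1(2) s(2) subset_ball[of s d1 x] by auto
      have "dist (J y) (J x) \<le> rr (J x) / 2" if "y \<in> ball x s" for y
      proof -
        have "y \<in> O'" using sub that by blast
        then show ?thesis using d2(2)[of y] that s(2) by (simp add: dist_commute less_imp_le)
      qed
      then show ?thesis using sub x by (simp add: P_def)
    qed
    then show ?thesis using d1(1) d2(1) by (intro exI[of _ "min d1 d2"]) auto
  qed
  have Psub: "ball x s \<subseteq> O'" if "P x s" for x s using that unfolding P_def by blast
  have e4: "e / 4 > 0" using e by simp
  obtain F where F: "finite F" "\<And>x s. (x, s) \<in> F \<Longrightarrow> x \<in> O' \<and> 0 < s \<and> P x s"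
    "pairwise (\<lambda>i j. disjnt (ball (fst i) (snd i)) (ball (fst j) (snd j))) F"
    "?m O' - e / 4 < ?m (\<Union>i\<in>F. ball (fst i) (snd i))"
  proof (rule finite_disjoint_balls[OF O P Psub e4])
    fix F assume "finite F" "\<And>x s. (x, s) \<in> F \<Longrightarrow> x \<in> O' \<and> 0 < s \<and> P x s"
      "pairwise (\<lambda>i j. disjnt (ball (fst i) (snd i)) (ball (fst j) (snd j))) F"
      "?m O' - e / 4 < ?m (\<Union>i\<in>F. ball (fst i) (snd i))"
    then show thesis by (rule that)
  qed
  let ?b = "\<lambda>i::(real^'n) \<times> real. ball (fst i) (snd i)"
  let ?z = "\<lambda>i::(real^'n) \<times> real. J (fst i)"
  have FP: "fst i \<in> O'" "?b i \<subseteq> O'" "\<And>y. y \<in> ?b i \<Longrightarrow> dist (J y) (?z i) \<le> rr (?z i) / 2" if "i \<in> F" for i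
    using F(2)[of "fst i" "snd i"] that by (auto simp: P_def)
  have zH: "?z i \<in> H" if "i \<in> F" for i using FP(1)[OF that] JH by blast
  have "\<forall>i\<in>F. \<exists>w. admissible (?z i) q (rr (?z i)) (?b i) e' w"
    using rr(2)[OF zH open_ball bounded_ball e'(1)] by blast
  then obtain ww where ww: "\<And>i. i \<in> F \<Longrightarrow> admissible (?z i) q (rr (?z i)) (?b i) e' (ww i)" by metis
  have wt: "ww i \<in> test_functions (?b i)" if "i \<in> F" for i using admissibleD(1)[OF ww[OF that]] .
  have wsm: "smooth (ww i)" if "i \<in> F" for i by (rule test_functions_smooth[OF wt[OF that]])
  define w where "w x = (\<Sum>i\<in>F. ww i x)" for x
  have other: "x \<notin> ?b j" if "i \<in> F" "x \<in> ?b i" "j \<in> F" "j \<noteq> i" for i j x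
    using F(3) that unfolding pairwise_def disjnt_def by blast
  have wx: "w x = ww i x" "jacobian w (at x) = jacobian (ww i) (at x)" if i: "i \<in> F" "x \<in> ?b i" for i x
  proof -
    show "w x = ww i x" unfolding w_def
      using test_function_off(1)[OF wt other[OF i]] by (intro sum_single_support[OF F(1) i(1)]) auto
    have "jacobian w (at x) = (\<Sum>i\<in>F. jacobian (ww i) (at x))"
      unfolding w_def by (rule jacobian_sum[OF F(1) wsm])
    also have "\<dots> = jacobian (ww i) (at x)"
      using test_function_off(2)[OF wt other[OF i]] by (intro sum_single_support[OF F(1) i(1)]) auto
    finally show "jacobian w (at x) = jacobian (ww i) (at x)" .
  qed
  have w0: "w x = 0" "jacobian w (at x) = 0" if x: "\<And>i. i \<in> F \<Longrightarrow> x \<notin> ?b i" for x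
  proof -
    show "w x = 0" unfolding w_def using test_function_off(1)[OF wt x] by (intro sum.neutral) auto
    have "jacobian w (at x) = (\<Sum>i\<in>F. jacobian (ww i) (at x))"
      unfolding w_def by (rule jacobian_sum[OF F(1) wsm])
    also have "\<dots> = 0" using test_function_off(2)[OF wt x] by (intro sum.neutral) auto
    finally show "jacobian w (at x) = 0" .
  qed
  have wtest: "w \<in> test_functions O'"
    unfolding w_def by (rule test_functions_sum[OF F(1) test_functions_mono[OF wt FP(2)]])
  have wn: "norm (w x) \<le> e" for x
  proof (cases "\<exists>i\<in>F. x \<in> ?b i")
    case True
    then obtain i where i: "i \<in> F" "x \<in> ?b i" by blast
    show ?thesis unfolding wx(1)[OF i] using admissibleD(3)[OF ww[OF i(1)], of x] e'(2) by linarith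
  next
    case False
    then have "w x = 0" by (intro w0) blast
    then show ?thesis using e by simp
  qed
  have close: "dist (J x + jacobian w (at x)) (?z i + jacobian (ww i) (at x)) \<le> rr (?z i) - rr (?z i) / 2"
    if i: "i \<in> F" "x \<in> ?b i" for i x
    using FP(3)[OF i] unfolding wx(2)[OF i] by (simp add: dist_norm)
  have inSg: "J x + jacobian w (at x) \<in> Sg" if x: "x \<in> O'" for x
  proof (cases "\<exists>i\<in>F. x \<in> ?b i")
    case True
    then obtain i where i: "i \<in> F" "x \<in> ?b i" by blast
    have "J x \<in> Sg" using JH[OF x] H_subset by blast
    then show ?thesis unfolding wx(2)[OF i] using admissibleD(2)[OF ww[OF i(1)]] by (intro Sg_add)
  next
    case False
    then have "jacobian w (at x) = 0" by (intro w0) blast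
    then show ?thesis using JH[OF x] H_subset by auto
  qed
  have wH: "J x + jacobian w (at x) \<in> H" if x: "x \<in> O'" for x
  proof (cases "\<exists>i\<in>F. x \<in> ?b i")
    case True
    then obtain i where i: "i \<in> F" "x \<in> ?b i" by blast
    have "J x + jacobian w (at x) \<in> deep H (rr (?z i) / 2)"
      by (rule deep_shift[OF admissibleD(4)[OF ww[OF i(1)] i(2)] inSg[OF x] close[OF i]])
    then show ?thesis by (rule deep_mem) (use rr(1)[OF zH[OF i(1)]] in simp)
  next
    case False
    then have "jacobian w (at x) = 0" by (intro w0) blast
    then show ?thesis using JH[OF x] by simp
  qed
  let ?G = "\<lambda>i. {x \<in> ?b i. ?z i + jacobian (ww i) (at x) \<in> deep U (rr (?z i))}"
  have Gm: "?G i \<in> lmeasurable" if "i \<in> F" for i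
    by (intro measurable_jacobian_preimage open_ball bounded_ball closed_deep continuous_intros
        continuous_jacobian test_functions_smooth[OF wt[OF that]])
  define G where "G = (\<Union>i\<in>F. ?G i)"
  have GU: "J x + jacobian w (at x) \<in> U" if x: "x \<in> G" for x
  proof -
    obtain i where i: "i \<in> F" "x \<in> ?b i" "?z i + jacobian (ww i) (at x) \<in> deep U (rr (?z i))"
      using x unfolding G_def by blast
    have "x \<in> O'" using FP(2)[OF i(1)] i(2) by blast
    then have "J x + jacobian w (at x) \<in> deep U (rr (?z i) / 2)"
      by (intro deep_shift[OF i(3) inSg close[OF i(1,2)]])
    then show ?thesis by (rule deep_mem) (use rr(1)[OF zH[OF i(1)]] in simp)
  qed
  have GO: "G \<subseteq> O'" unfolding G_def using FP(2) by blast
  have Gm': "G \<in> lmeasurable" unfolding G_def using F(1) Gm by (intro fmeasurable.finite_UN)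
  have mG: "?m G = (\<Sum>i\<in>F. ?m (?G i))"
    unfolding G_def
  proof (rule measure_UNION')
    show "pairwise (\<lambda>i j. disjnt (?G i) (?G j)) F"
      using F(3) unfolding pairwise_def disjnt_def by blast
  qed (use F(1) Gm in auto)
  have mB: "?m (\<Union>i\<in>F. ?b i) = (\<Sum>i\<in>F. ?m (?b i))"
    by (rule measure_UNION') (use F in auto)
  have bO: "?m (\<Union>i\<in>F. ?b i) \<le> ?m O'"
    using FP(2) Om F(1) by (intro measure_mono_fmeasurable) auto
  have "(\<Sum>i\<in>F. (1 - 2 * q) * ?m (?b i)) \<le> (\<Sum>i\<in>F. ?m (?G i))"
  proof (rule sum_mono)
    fix i assume i: "i \<in> F"
    have "(1 - 2 * q) * ?m (?b i) \<le> (1 - q - e') * ?m (?b i)"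
      using e'(3) by (intro mult_right_mono) auto
    also have "\<dots> \<le> ?m (?G i)" by (rule admissibleD(5)[OF ww[OF i]])
    finally show "(1 - 2 * q) * ?m (?b i) \<le> ?m (?G i)" .
  qed
  then have "(1 - 2 * q) * ?m (\<Union>i\<in>F. ?b i) \<le> ?m G"
    unfolding mG mB sum_distrib_left .
  moreover have "2 * q * ?m (\<Union>i\<in>F. ?b i) \<le> 2 * q * ?m O'" using bO q by (intro mult_left_mono) auto
  ultimately have big: "?m O' - 3 * e / 4 \<le> ?m G"
    using F(4) q(2) by (simp add: left_diff_distrib)
  \<comment> \<open>A compact part of \<open>G\<close> is settled and not \<open>G\<close> itself,
    so that the unsettled rest is open and the step can be repeated. The volume lost is at most
    \<open>e / 4\<close> outside the balls, \<open>e / 2\<close> inside them, and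
    \<open>e / 4\<close> here.\<close>
  obtain K where K: "closed K" "K \<subseteq> G" "G - K \<in> lmeasurable" "emeasure lebesgue (G - K) < ennreal (e / 4)"
    using sets_lebesgue_inner_closed[OF fmeasurableD[OF Gm'] e4] by blast
  have "K \<subseteq> O'" using K(2) GO by blast
  then have Kc: "compact K" using K(1) bounded_subset[OF O(2)] compact_eq_bounded_closed by blast
  have Km: "K \<in> lmeasurable" by (rule lmeasurable_compact[OF Kc])
  have "?m (G - K) = ?m G - ?m K" using Km Gm' K(2) by (intro measurable_measure_Diff) auto
  moreover have "?m (G - K) < e / 4"
    using K(4) emeasure_eq_measure2[OF K(3)] e by (simp add: ennreal_less_iff)
  moreover have "?m (O' - K) = ?m O' - ?m K" using Km Om \<open>K \<subseteq> O'\<close> by (intro measurable_measure_Diff) auto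
  ultimately have "?m (O' - K) \<le> e" using big by linarith
  then show thesis
    using that[OF wtest wn wH Kc \<open>K \<subseteq> O'\<close> GU] K(2) by blast
qed

text \<open>\<open>Os n\<close> is the open set on which the gradient may still change after stage
  \<open>n\<close>. Later perturbations are supported in it, so a gradient that has reached
  \<open>U\<close> outside \<open>Os n\<close> is final.\<close>

lemma iteration:
  assumes O: "open O0" "bounded O0" and cont: "continuous_on O0 J" and JH: "\<And>x. x \<in> O0 \<Longrightarrow> J x \<in> H" and e: "e > 0"
  obtains Os :: "nat \<Rightarrow> (real^'n) set" and \<phi> :: "nat \<Rightarrow> real^'n \<Rightarrow> real^'m"
  where "\<And>n. open (Os n)" "\<And>n. Os n \<subseteq> O0" "\<And>n. Os (Suc n) \<subseteq> Os n" "\<And>n. measure lebesgue (Os (Suc n)) \<le> (1/2)^n"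
    "\<phi> 0 = (\<lambda>x. 0)" "\<And>n. \<phi> n \<in> test_functions O0"
    "\<And>n x. norm (\<phi> (Suc n) x - \<phi> n x) \<le> e * (1/2)^n"
    "\<And>n x. x \<notin> Os n \<Longrightarrow> jacobian (\<phi> (Suc n)) (at x) = jacobian (\<phi> n) (at x)"
    "\<And>n x. x \<in> O0 \<Longrightarrow> J x + jacobian (\<phi> n) (at x) \<in> H"
    "\<And>n x. x \<in> O0 - Os n \<Longrightarrow> J x + jacobian (\<phi> n) (at x) \<in> U"
proof -
  define P where "P n s \<longleftrightarrow> (case s of (S, \<psi>) \<Rightarrow> open S \<and> S \<subseteq> O0 \<and> \<psi> \<in> test_functions O0 \<and>
     (\<forall>x\<in>O0. J x + jacobian \<psi> (at x) \<in> H) \<and> (\<forall>x\<in>O0 - S. J x + jacobian \<psi> (at x) \<in> U) \<and>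
     (n = 0 \<longrightarrow> \<psi> = (\<lambda>x. 0)))" for n :: nat and s :: "(real^'n) set \<times> (real^'n \<Rightarrow> real^'m)"
  define Q where "Q n s s' \<longleftrightarrow> (case s of (S, \<psi>) \<Rightarrow> case s' of (S', \<psi>') \<Rightarrow>
     S' \<subseteq> S \<and> measure lebesgue S' \<le> (1/2)^n \<and> (\<forall>x. norm (\<psi>' x - \<psi> x) \<le> e * (1/2)^n) \<and>
     (\<forall>x. x \<notin> S \<longrightarrow> jacobian \<psi>' (at x) = jacobian \<psi> (at x)))"
     for n :: nat and s s' :: "(real^'n) set \<times> (real^'n \<Rightarrow> real^'m)"
  have "\<exists>s. \<forall>n. P n (s n) \<and> Q n (s n) (s (Suc n))"
  proof (rule dependent_nat_choice)
    show "\<exists>s. P 0 s"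
      using O JH zero_test_function by (intro exI[of _ "(O0, \<lambda>x. 0)"]) (simp add: P_def jacobian_const_zero)
  next
    fix s n assume "P n s"
    obtain S \<psi> where s: "s = (S, \<psi>)" by (cases s)
    have S: "open S" "S \<subseteq> O0" "\<psi> \<in> test_functions O0" "\<And>x. x \<in> O0 \<Longrightarrow> J x + jacobian \<psi> (at x) \<in> H"
      "\<And>x. x \<in> O0 \<Longrightarrow> x \<notin> S \<Longrightarrow> J x + jacobian \<psi> (at x) \<in> U"
      using \<open>P n s\<close> unfolding s P_def by auto
    have \<psi>s: "smooth \<psi>" by (rule test_functions_smooth[OF S(3)])
    \<comment> \<open>One number serves as bound for the next increment and for the volume that
      remains unsettled.\<close>
    define d where "d = min ((1/2)^n) (e * (1/2)^n)"
    have d: "d > 0" using e by (simp add: d_def)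
    have c: "continuous_on S (\<lambda>x. J x + jacobian \<psi> (at x))"
      using continuous_on_subset[OF cont S(2)] continuous_jacobian[OF \<psi>s] by (intro continuous_on_add)
    obtain w K where w: "w \<in> test_functions S" "\<And>x. norm (w x) \<le> d"
      "\<And>x. x \<in> S \<Longrightarrow> J x + jacobian \<psi> (at x) + jacobian w (at x) \<in> H"
      and K: "compact K" "K \<subseteq> S" "\<And>x. x \<in> K \<Longrightarrow> J x + jacobian \<psi> (at x) + jacobian w (at x) \<in> U"
        "measure lebesgue (S - K) \<le> d"
      using iteration_step[OF S(1) bounded_subset[OF O(2) S(2)] c S(4)[OF subsetD[OF S(2)]] d] by metis
    define \<psi>' where "\<psi>' x = \<psi> x + w x" for x
    have j: "jacobian \<psi>' (at x) = jacobian \<psi> (at x) + jacobian w (at x)" for x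
      unfolding \<psi>'_def using \<psi>s test_functions_smooth[OF w(1)] by (simp add: jacobian_add smooth_differentiable)
    have off: "jacobian w (at x) = 0" if "x \<notin> S" for x by (rule test_function_off(2)[OF w(1) that])
    have 1: "J x + jacobian \<psi>' (at x) \<in> H" if "x \<in> O0" for x
      using w(3)[of x] S(4)[OF that] off[of x] unfolding j by (cases "x \<in> S") (simp_all add: add.assoc)
    have 2: "J x + jacobian \<psi>' (at x) \<in> U" if "x \<in> O0" "x \<notin> S - K" for x
      using K(3)[of x] S(5)[OF that(1)] that(2) off[of x] unfolding j by (cases "x \<in> S") (simp_all add: add.assoc)
    have 3: "\<psi>' \<in> test_functions O0"
      unfolding \<psi>'_def by (intro test_functions_add S(3) test_functions_mono[OF w(1) S(2)])
    have 4: "open (S - K)" using S(1) compact_imp_closed[OF K(1)] by (rule open_Diff)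
    have "P (Suc n) (S - K, \<psi>')" unfolding P_def using 1 2 3 4 S(2) by auto
    moreover have "Q n s (S - K, \<psi>')"
      unfolding Q_def s using w(2) K(4) off j by (auto simp: \<psi>'_def d_def)
    ultimately show "\<exists>s'. P (Suc n) s' \<and> Q n s s'" by blast
  qed
  then obtain s where s: "\<And>n. P n (s n)" "\<And>n. Q n (s n) (s (Suc n))" by blast
  define Os where "Os n = fst (s n)" for n
  define \<phi> where "\<phi> n = snd (s n)" for n
  have sn: "s n = (Os n, \<phi> n)" for n by (simp add: Os_def \<phi>_def)
  note PP = s(1)[unfolded sn P_def prod.case] and QQ = s(2)[unfolded sn Q_def prod.case]
  show thesis
    by (rule that[of Os \<phi>]) (use PP QQ in blast)+
qed

end

section \<open>Weak gradients and limits\<close>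

lemma LinfI:
  fixes f :: "'a::euclidean_space \<Rightarrow> 'b::euclidean_space"
  assumes "f \<in> borel_measurable (lebesgue_on \<Omega>)" "AE x in lebesgue_on \<Omega>. norm (f x) \<le> C"
  shows "f \<in> Linf \<Omega>" "Linf_norm \<Omega> f \<le> ereal C"
proof -
  have "(\<lambda>x. ereal (norm (f x))) \<in> borel_measurable (lebesgue_on \<Omega>)" using assms(1) by measurable
  moreover have "AE x in lebesgue_on \<Omega>. ereal (norm (f x)) \<le> ereal C" using assms(2) by simp
  ultimately show b: "Linf_norm \<Omega> f \<le> ereal C" unfolding Linf_norm_def by (rule esssup_I)
  have "ereal C < \<infinity>" by simp
  then show "f \<in> Linf \<Omega>" unfolding Linf_def using assms(1) b by (metis (mono_tags, lifting) le_less_trans mem_Collect_eq)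
qed

lemma LinfE:
  assumes "f \<in> Linf \<Omega>"
  obtains C where "AE x in lebesgue_on \<Omega>. norm (f x) \<le> C" "f \<in> borel_measurable (lebesgue_on \<Omega>)"
proof -
  have m: "f \<in> borel_measurable (lebesgue_on \<Omega>)" and fin: "Linf_norm \<Omega> f < \<infinity>" using assms by (auto simp: Linf_def)
  obtain C where C: "Linf_norm \<Omega> f \<le> ereal C" using fin by (cases "Linf_norm \<Omega> f") auto
  have "AE x in lebesgue_on \<Omega>. ereal (norm (f x)) \<le> Linf_norm \<Omega> f" unfolding Linf_norm_def by (rule esssup_AE)
  then have "AE x in lebesgue_on \<Omega>. norm (f x) \<le> C"
  proof (rule eventually_mono)
    fix x assume "ereal (norm (f x)) \<le> Linf_norm \<Omega> f"
    then have "ereal (norm (f x)) \<le> ereal C" using C by (rule order_trans)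
    then show "norm (f x) \<le> C" by simp
  qed
  then show thesis using m by (rule that)
qed

lemma locally_integrable_iff:
  "locally_integrable_on f \<Omega> \<longleftrightarrow> (\<forall>K. compact K \<and> K \<subseteq> \<Omega> \<longrightarrow> integrable lebesgue (\<lambda>x. indicator K x *\<^sub>R f x))"
  by (simp add: locally_integrable_on_def set_integrable_def)

lemma locally_integrable_bounded_linear:
  assumes "bounded_linear T" "locally_integrable_on f \<Omega>"
  shows "locally_integrable_on (\<lambda>x. T (f x)) \<Omega>"
  unfolding locally_integrable_iff
proof (intro allI impI)
  fix K assume "compact K \<and> K \<subseteq> \<Omega>"
  then have "integrable lebesgue (\<lambda>x. indicator K x *\<^sub>R f x)" using assms(2) unfolding locally_integrable_iff by blast
  from integrable_bounded_linear[OF assms(1) this]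
  show "integrable lebesgue (\<lambda>x. indicator K x *\<^sub>R T (f x))"
    by (simp add: linear_scale[OF bounded_linear.linear[OF assms(1)]])
qed

lemma locally_integrable_add:
  assumes "locally_integrable_on f \<Omega>" "locally_integrable_on g \<Omega>"
  shows "locally_integrable_on (\<lambda>x. f x + g x) \<Omega>"
  unfolding locally_integrable_iff
proof (intro allI impI)
  fix K assume "compact K \<and> K \<subseteq> \<Omega>"
  then have "integrable lebesgue (\<lambda>x. indicator K x *\<^sub>R f x)" "integrable lebesgue (\<lambda>x. indicator K x *\<^sub>R g x)"
    using assms unfolding locally_integrable_iff by blast+
  from Bochner_Integration.integrable_add[OF this]
  show "integrable lebesgue (\<lambda>x. indicator K x *\<^sub>R (f x + g x))" by (simp add: scaleR_add_right)
qed

text \<open>Truncations to an exhausting sequence of compact subsets are integrable and converge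
  pointwise.\<close>

lemma locally_integrable_measurable:
  fixes f :: "'a::euclidean_space \<Rightarrow> 'b::euclidean_space"
  assumes "open \<Omega>" "locally_integrable_on f \<Omega>"
  shows "f \<in> borel_measurable (lebesgue_on \<Omega>)"
proof -
  obtain C :: "nat \<Rightarrow> 'a set" where C: "\<And>n. compact (C n)" "\<And>n. C n \<subseteq> \<Omega>" "(\<Union>n. C n) = \<Omega>"
    "\<And>n. C n \<subseteq> interior (C (Suc n))"
  proof (rule open_Union_compact_subsets[OF assms(1)])
    fix C :: "nat \<Rightarrow> 'a set"
    assume "\<And>n. compact (C n)" "\<And>n. C n \<subseteq> \<Omega>" "\<And>n. C n \<subseteq> interior (C (Suc n))" "(\<Union>n. C n) = \<Omega>"
    then show thesis by (intro that[of C])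
  qed
  have "C n \<subseteq> C (Suc n)" for n using C(4)[of n] interior_subset by blast
  then have mono: "C n \<subseteq> C m" if "n \<le> m" for n m using lift_Suc_mono_le[of C n m] that by blast
  have "(\<lambda>x. indicator \<Omega> x *\<^sub>R f x) \<in> borel_measurable lebesgue"
  proof (rule borel_measurable_LIMSEQ_metric)
    show "(\<lambda>x. indicator (C n) x *\<^sub>R f x) \<in> borel_measurable lebesgue" for n
      using assms(2) C(1,2)[of n] unfolding locally_integrable_iff by (blast intro: borel_measurable_integrable)
    show "(\<lambda>n. indicator (C n) x *\<^sub>R f x) \<longlonglongrightarrow> indicator \<Omega> x *\<^sub>R f x" for x
    proof (cases "x \<in> \<Omega>")
      case True
      then obtain n where "x \<in> C n" using C(3) by blast
      then have "indicator (C m) x *\<^sub>R f x = indicator \<Omega> x *\<^sub>R f x" if "m \<ge> n" for m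
        using mono[OF that] True by auto
      then show ?thesis by (intro tendsto_eventually) (auto simp: eventually_sequentially)
    next
      case False
      then have "x \<notin> C n" for n using C(2) by blast
      then show ?thesis using False by simp
    qed
  qed
  then show ?thesis using assms(1) by (simp add: borel_measurable_restrict_space_iff)
qed

lemma bounded_locally_integrable:
  fixes f :: "'a::euclidean_space \<Rightarrow> 'b::euclidean_space"
  assumes "\<Omega> \<in> sets lebesgue" "f \<in> borel_measurable (lebesgue_on \<Omega>)" "\<And>x. norm (f x) \<le> C"
  shows "locally_integrable_on f \<Omega>"
  unfolding locally_integrable_iff
proof (intro allI impI, elim conjE)
  fix K assume K: "compact K" "K \<subseteq> \<Omega>"
  have Km: "K \<in> lmeasurable" by (rule lmeasurable_compact[OF K(1)])
  have "(\<lambda>x. indicator \<Omega> x *\<^sub>R f x) \<in> borel_measurable lebesgue"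
    using assms by (simp add: borel_measurable_restrict_space_iff)
  then have "(\<lambda>x. indicator K x *\<^sub>R (indicator \<Omega> x *\<^sub>R f x)) \<in> borel_measurable lebesgue"
    by (rule borel_measurable_scaleR[OF borel_measurable_indicator[OF fmeasurableD[OF Km]]])
  moreover have "(\<lambda>x. indicator K x *\<^sub>R (indicator \<Omega> x *\<^sub>R f x)) = (\<lambda>x. indicator K x *\<^sub>R f x)"
    using K(2) by (auto simp: indicator_def fun_eq_iff)
  ultimately have m: "(\<lambda>x. indicator K x *\<^sub>R f x) \<in> borel_measurable lebesgue" by simp
  have "integrable lebesgue (\<lambda>x. C * indicator K x)"
    using Km by (intro integrable_mult_right integrable_real_indicator) (auto simp: fmeasurable_def)
  then show "integrable lebesgue (\<lambda>x. indicator K x *\<^sub>R f x)"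
  proof (rule Bochner_Integration.integrable_bound[OF _ m])
    show "AE x in lebesgue. norm (indicator K x *\<^sub>R f x) \<le> norm (C * indicator K x)"
      using assms(3) by (intro AE_I2) (auto simp: indicator_def intro: order_trans[OF _ abs_ge_self])
  qed
qed

lemma integrable_times_compact_support:
  fixes f g :: "'a::euclidean_space \<Rightarrow> real"
  assumes "\<Omega> \<in> sets lebesgue" "locally_integrable_on f \<Omega>" "continuous_on UNIV g"
    and K: "compact K" "K \<subseteq> \<Omega>" "\<And>x. x \<notin> K \<Longrightarrow> g x = 0"
  shows "integrable (lebesgue_on \<Omega>) (\<lambda>x. f x * g x)"
proof -
  have "compact (g ` K)" by (rule compact_continuous_image[OF continuous_on_subset[OF assms(3) subset_UNIV] K(1)])
  then have "bounded (g ` K)" by (rule compact_imp_bounded)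
  then obtain M where M: "\<forall>y\<in>g ` K. norm y \<le> M" unfolding bounded_iff by (rule exE)
  have i: "integrable lebesgue (\<lambda>x. indicator K x *\<^sub>R f x)" using assms(2) K unfolding locally_integrable_iff by blast
  have "g \<in> borel_measurable lborel" using borel_measurable_continuous_onI[OF assms(3)] by simp
  then have gm: "g \<in> borel_measurable lebesgue" by (rule measurable_completion)
  have "integrable lebesgue (\<lambda>x. M *\<^sub>R (indicator K x *\<^sub>R f x))" using i by (rule integrable_scaleR_right)
  then have "integrable lebesgue (\<lambda>x. (indicator K x *\<^sub>R f x) * g x)"
  proof (rule Bochner_Integration.integrable_bound)
    show "(\<lambda>x. (indicator K x *\<^sub>R f x) * g x) \<in> borel_measurable lebesgue"
      by (rule borel_measurable_times[OF borel_measurable_integrable[OF i] gm])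
    show "AE x in lebesgue. norm ((indicator K x *\<^sub>R f x) * g x) \<le> norm (M *\<^sub>R (indicator K x *\<^sub>R f x))"
    proof (intro AE_I2)
      fix x
      show "norm ((indicator K x *\<^sub>R f x) * g x) \<le> norm (M *\<^sub>R (indicator K x *\<^sub>R f x))"
      proof (cases "x \<in> K")
        case True
        then have "\<bar>g x\<bar> \<le> \<bar>M\<bar>" using bspec[OF M imageI[OF True]] by simp
        then have "\<bar>f x\<bar> * \<bar>g x\<bar> \<le> \<bar>f x\<bar> * \<bar>M\<bar>" by (rule mult_left_mono) simp
        then show ?thesis using True by (simp add: abs_mult mult.commute)
      qed simp
    qed
  qed
  moreover have "(\<lambda>x. (indicator K x *\<^sub>R f x) * g x) = (\<lambda>x. indicator \<Omega> x *\<^sub>R (f x * g x))"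
  proof
    fix x show "(indicator K x *\<^sub>R f x) * g x = indicator \<Omega> x *\<^sub>R (f x * g x)"
      using K(2) K(3)[of x] by (cases "x \<in> K") auto
  qed
  ultimately show ?thesis using assms(1) by (subst integrable_restrict_space) auto
qed

lemma integrable_times_test:
  fixes f :: "'a::euclidean_space \<Rightarrow> real"
  assumes "\<Omega> \<in> sets lebesgue" "locally_integrable_on f \<Omega>" "\<psi> \<in> test_functions \<Omega>"
  shows "integrable (lebesgue_on \<Omega>) (\<lambda>x. f x * \<psi> x)" "integrable (lebesgue_on \<Omega>) (\<lambda>x. f x * pd v \<psi> x)"
proof -
  note s = test_functions_smooth[OF assms(3)]
  obtain K where K: "compact K" "K \<subseteq> \<Omega>" "\<And>x. x \<notin> K \<Longrightarrow> \<psi> x = 0" "\<And>x. x \<notin> K \<Longrightarrow> frechet_derivative \<psi> (at x) = (\<lambda>_. 0)"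
    using test_function_support[OF assms(3)] by metis
  show "integrable (lebesgue_on \<Omega>) (\<lambda>x. f x * \<psi> x)"
    by (rule integrable_times_compact_support[OF assms(1,2) smooth_continuous[OF s] K(1-3)])
  show "integrable (lebesgue_on \<Omega>) (\<lambda>x. f x * pd v \<psi> x)"
    by (rule integrable_times_compact_support[OF assms(1,2) smooth_continuous[OF smooth_pd[OF s]] K(1,2)]) (simp add: K(4))
qed

section \<open>Weak gradients: sums, classical derivatives, limits\<close>

lemma weak_gradientD:
  assumes "has_weak_gradient u G \<Omega>"
  shows "locally_integrable_on (\<lambda>x. u x $ i) \<Omega>" "locally_integrable_on (\<lambda>x. G x $ i $ j) \<Omega>"
    "\<psi> \<in> test_functions \<Omega> \<Longrightarrow> (LINT x|lebesgue_on \<Omega>. u x $ i * pd (axis j 1) \<psi> x) = - (LINT x|lebesgue_on \<Omega>. G x $ i $ j * \<psi> x)"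
proof -
  have u: "locally_integrable_on u \<Omega>" and G: "locally_integrable_on G \<Omega>"
    using assms unfolding has_weak_gradient_def by blast+
  show "locally_integrable_on (\<lambda>x. u x $ i) \<Omega>" by (rule locally_integrable_bounded_linear[OF bounded_linear_vec_nth u])
  show "locally_integrable_on (\<lambda>x. G x $ i $ j) \<Omega>"
    by (rule locally_integrable_bounded_linear[OF bounded_linear_vec_nth locally_integrable_bounded_linear[OF bounded_linear_vec_nth G]])
  show "\<psi> \<in> test_functions \<Omega> \<Longrightarrow> (LINT x|lebesgue_on \<Omega>. u x $ i * pd (axis j 1) \<psi> x) = - (LINT x|lebesgue_on \<Omega>. G x $ i $ j * \<psi> x)"
    using assms unfolding has_weak_gradient_def by blast
qed

lemma has_weak_gradient_add:
  assumes \<Omega>: "\<Omega> \<in> sets lebesgue" and u: "has_weak_gradient u G \<Omega>" and w: "has_weak_gradient w W \<Omega>"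
  shows "has_weak_gradient (\<lambda>x. u x + w x) (\<lambda>x. G x + W x) \<Omega>"
  unfolding has_weak_gradient_def
proof (intro conjI ballI allI)
  show "locally_integrable_on (\<lambda>x. u x + w x) \<Omega>" "locally_integrable_on (\<lambda>x. G x + W x) \<Omega>"
    using u w unfolding has_weak_gradient_def by (blast intro: locally_integrable_add)+
  fix \<psi> :: "real^'a \<Rightarrow> real" and i j assume \<psi>: "\<psi> \<in> test_functions \<Omega>"
  note iu = integrable_times_test[OF \<Omega> weak_gradientD(1)[OF u] \<psi>] integrable_times_test[OF \<Omega> weak_gradientD(2)[OF u] \<psi>]
  note iw = integrable_times_test[OF \<Omega> weak_gradientD(1)[OF w] \<psi>] integrable_times_test[OF \<Omega> weak_gradientD(2)[OF w] \<psi>]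
  have "(LINT x|lebesgue_on \<Omega>. (u x + w x) $ i * pd (axis j 1) \<psi> x)
      = (LINT x|lebesgue_on \<Omega>. u x $ i * pd (axis j 1) \<psi> x) + (LINT x|lebesgue_on \<Omega>. w x $ i * pd (axis j 1) \<psi> x)"
    unfolding vector_add_component distrib_right by (rule Bochner_Integration.integral_add[OF iu(2) iw(2)])
  also have "\<dots> = - ((LINT x|lebesgue_on \<Omega>. G x $ i $ j * \<psi> x) + (LINT x|lebesgue_on \<Omega>. W x $ i $ j * \<psi> x))"
    unfolding weak_gradientD(3)[OF u \<psi>] weak_gradientD(3)[OF w \<psi>] by simp
  also have "(LINT x|lebesgue_on \<Omega>. G x $ i $ j * \<psi> x) + (LINT x|lebesgue_on \<Omega>. W x $ i $ j * \<psi> x)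
      = (LINT x|lebesgue_on \<Omega>. (G x + W x) $ i $ j * \<psi> x)"
    unfolding vector_add_component distrib_right by (rule Bochner_Integration.integral_add[OF iu(3) iw(3), symmetric])
  finally show "(LINT x|lebesgue_on \<Omega>. (u x + w x) $ i * pd (axis j 1) \<psi> x) = - (LINT x|lebesgue_on \<Omega>. (G x + W x) $ i $ j * \<psi> x)" .
qed

lemma component_has_derivative:
  fixes f :: "real^'n \<Rightarrow> real^'m"
  assumes "f differentiable (at x)"
  shows "((\<lambda>x. f x $ i) has_derivative (\<lambda>h. (jacobian f (at x) *v h) $ i)) (at x)"
  using assms by (intro bounded_linear.has_derivative[OF bounded_linear_vec_nth]) (simp add: jacobian_works)

text \<open>For test functions supported in \<open>O'\<close>, classical integration by parts and
  the definition of the weak gradient give the same left-hand side; the fundamental lemma then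
  applies to the difference of the two gradients, entry by entry.\<close>

lemma weak_gradient_classical:
  fixes v :: "real^'n \<Rightarrow> real^'m"
  assumes \<Omega>: "open \<Omega>" and O: "open O'" "O' \<subseteq> \<Omega>" and v: "has_weak_gradient v Dv \<Omega>"
    and d: "\<And>x. x \<in> O' \<Longrightarrow> v differentiable (at x)" and c: "continuous_on O' (\<lambda>x. jacobian v (at x))"
  shows "AE x in lebesgue. x \<in> O' \<longrightarrow> Dv x = jacobian v (at x)"
proof -
  have \<Omega>s: "\<Omega> \<in> sets lebesgue" "O' \<in> sets lebesgue" using \<Omega> O by auto
  have "AE x in lebesgue. x \<in> O' \<longrightarrow> Dv x $ i $ j - jacobian v (at x) $ i $ j = 0" for i j
  proof (rule fundamental_lemma[OF O(1)])
    have cij: "continuous_on O' (\<lambda>x. jacobian v (at x) $ i $ j)" by (intro continuous_intros c)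
    have l1: "locally_integrable_on (\<lambda>x. Dv x $ i $ j) O'"
      using weak_gradientD(2)[OF v, of i j] O(2) unfolding locally_integrable_on_def by blast
    have l2: "locally_integrable_on (\<lambda>x. - (jacobian v (at x) $ i $ j)) O'"
      unfolding locally_integrable_iff
    proof (intro allI impI, elim conjE)
      fix K assume K: "compact K" "K \<subseteq> O'"
      have "integrable lborel (\<lambda>x. indicator K x *\<^sub>R (- (jacobian v (at x) $ i $ j)))"
        by (rule borel_integrable_compact[OF K(1)]) (intro continuous_intros continuous_on_subset[OF c K(2)])
      then show "integrable lebesgue (\<lambda>x. indicator K x *\<^sub>R (- (jacobian v (at x) $ i $ j)))"
        using integrable_completion[of "\<lambda>x. indicator K x *\<^sub>R (- (jacobian v (at x) $ i $ j))" lborel] by (simp add: borel_measurable_integrable)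
    qed
    show "locally_integrable_on (\<lambda>x. Dv x $ i $ j - jacobian v (at x) $ i $ j) O'"
      using locally_integrable_add[OF l1 l2] by simp
    fix \<psi> :: "real^'n \<Rightarrow> real" assume \<psi>: "\<psi> \<in> test_functions O'"
    then have \<psi>': "\<psi> \<in> test_functions \<Omega>" using O(2) by (rule test_functions_mono)
    have "(LINT x|lebesgue_on \<Omega>. v x $ i * pd (axis j 1) \<psi> x) = - (LINT x|lebesgue_on \<Omega>. (jacobian v (at x) *v axis j 1) $ i * \<psi> x)"
      by (rule integration_by_parts[OF O \<Omega>s(1) component_has_derivative[OF d] _ \<psi>])
        (use cij in \<open>auto simp flip: matrix_component\<close>)
    then have eq: "(LINT x|lebesgue_on \<Omega>. Dv x $ i $ j * \<psi> x) = (LINT x|lebesgue_on \<Omega>. jacobian v (at x) $ i $ j * \<psi> x)"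
      unfolding weak_gradientD(3)[OF v \<psi>'] matrix_component[symmetric] by simp
    have off: "\<psi> x = 0" if "x \<notin> O'" for x
      using test_function_support[OF \<psi>] that by (metis subsetD)
    \<comment> \<open>The weak formulation integrates over \<open>\<Omega>\<close>, the fundamental
      lemma over \<open>O'\<close>; the support of \<open>\<psi>\<close> reconciles them.\<close>
    have restr: "(LINT x|lebesgue_on \<Omega>. h x * \<psi> x) = (LINT x|lebesgue_on O'. h x * \<psi> x)" for h :: "real^'n \<Rightarrow> real"
    proof -
      have S: "(LINT x|lebesgue_on S. h x * \<psi> x) = (LINT x|lebesgue. indicator S x *\<^sub>R (h x * \<psi> x))"
        if "S \<in> sets lebesgue" for S
        by (rule integral_restrict_space) (use that in simp)
      have "(\<lambda>x. indicator \<Omega> x *\<^sub>R (h x * \<psi> x)) = (\<lambda>x. indicator O' x *\<^sub>R (h x * \<psi> x))"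
      proof
        fix x show "indicator \<Omega> x *\<^sub>R (h x * \<psi> x) = indicator O' x *\<^sub>R (h x * \<psi> x)"
          using off[of x] O(2) by (cases "x \<in> O'") auto
      qed
      then show ?thesis unfolding S[OF \<Omega>s(1)] S[OF \<Omega>s(2)] by (rule arg_cong)
    qed
    have i1: "integrable (lebesgue_on O') (\<lambda>x. Dv x $ i $ j * \<psi> x)" by (rule integrable_times_test(1)[OF \<Omega>s(2) l1 \<psi>])
    have i2: "integrable (lebesgue_on O') (\<lambda>x. - (jacobian v (at x) $ i $ j) * \<psi> x)" by (rule integrable_times_test(1)[OF \<Omega>s(2) l2 \<psi>])
    have "(LINT x|lebesgue_on O'. (Dv x $ i $ j - jacobian v (at x) $ i $ j) * \<psi> x)
       = (LINT x|lebesgue_on O'. Dv x $ i $ j * \<psi> x) + (LINT x|lebesgue_on O'. - (jacobian v (at x) $ i $ j) * \<psi> x)"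
      unfolding Bochner_Integration.integral_add[OF i1 i2, symmetric] by (simp add: left_diff_distrib)
    then show "(LINT x|lebesgue_on O'. (Dv x $ i $ j - jacobian v (at x) $ i $ j) * \<psi> x) = 0"
      using eq unfolding restr by simp
  qed
  then have "AE x in lebesgue. \<forall>i\<in>UNIV. \<forall>j\<in>UNIV. x \<in> O' \<longrightarrow> Dv x $ i $ j - jacobian v (at x) $ i $ j = 0"
    by (intro AE_finite_allI finite)
  then show ?thesis by (rule eventually_mono) (simp add: vec_eq_iff)
qed

lemma borel_measurable_vec_nth:
  fixes f :: "'a \<Rightarrow> 'b::euclidean_space ^ 'n"
  assumes "f \<in> borel_measurable M"
  shows "(\<lambda>x. f x $ i) \<in> borel_measurable M"
  by (rule measurable_compose[OF assms borel_measurable_continuous_onI]) (intro continuous_intros)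

text \<open>Both sides of the formula of integration by parts pass to the limit by dominated
  convergence. For the gradients, uniform boundedness and convergence almost everywhere
  suffice.\<close>

lemma weak_gradient_limit:
  fixes \<phi> :: "nat \<Rightarrow> real^'n \<Rightarrow> real^'m"
  assumes \<Omega>: "open \<Omega>" "bounded \<Omega>" and \<phi>: "\<And>n. \<phi> n \<in> test_functions \<Omega>"
    and C: "\<And>n x. norm (\<phi> n x) \<le> C" "\<And>n x. norm (jacobian (\<phi> n) (at x)) \<le> C"
    and w: "\<And>x. (\<lambda>n. \<phi> n x) \<longlonglongrightarrow> w x"
    and W: "AE x in lebesgue_on \<Omega>. (\<lambda>n. jacobian (\<phi> n) (at x)) \<longlonglongrightarrow> W x" "W \<in> borel_measurable (lebesgue_on \<Omega>)" "\<And>x. norm (W x) \<le> C"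
  shows "w \<in> borel_measurable (lebesgue_on \<Omega>)" "has_weak_gradient w W \<Omega>"
proof -
  have \<Omega>s: "\<Omega> \<in> sets lebesgue" using \<Omega> by auto
  have \<Omega>m: "\<Omega> \<in> lmeasurable" using \<Omega> by (intro bounded_set_imp_lmeasurable) auto
  interpret finite_measure "lebesgue_on \<Omega>" by (rule finite_measure_lebesgue_on[OF \<Omega>m])
  have cm: "f \<in> borel_measurable (lebesgue_on \<Omega>)" if "continuous_on UNIV f" for f :: "real^'n \<Rightarrow> 'z::euclidean_space"
    by (rule continuous_imp_measurable_on_sets_lebesgue[OF continuous_on_subset[OF that subset_UNIV] \<Omega>s])
  note \<phi>s = test_functions_smooth[OF \<phi>]
  show wm: "w \<in> borel_measurable (lebesgue_on \<Omega>)"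
    by (rule borel_measurable_LIMSEQ_metric[OF cm[OF smooth_continuous[OF \<phi>s]]]) (rule w)
  have wC: "norm (w x) \<le> C" for x
    by (rule LIMSEQ_le_const2[OF tendsto_norm[OF w]]) (use C(1) in blast)
  show "has_weak_gradient w W \<Omega>"
    unfolding has_weak_gradient_def
  proof (intro conjI ballI allI)
    show "locally_integrable_on w \<Omega>" by (rule bounded_locally_integrable[OF \<Omega>s wm wC])
    show "locally_integrable_on W \<Omega>" by (rule bounded_locally_integrable[OF \<Omega>s W(2,3)])
    fix \<psi> :: "real^'n \<Rightarrow> real" and i j assume \<psi>: "\<psi> \<in> test_functions \<Omega>"
    note \<psi>s = test_functions_smooth[OF \<psi>]
    obtain M where M: "M \<ge> 0" "\<And>x. norm (\<psi> x) \<le> M" using test_functions_bounded[OF \<psi>] by blast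
    obtain M' where M': "M' \<ge> 0" "\<And>x. norm (pd (axis j 1) \<psi> x) \<le> M'"
      using test_functions_bounded[OF test_functions_pd[OF \<psi>]] by blast
    have parts: "(LINT x|lebesgue_on \<Omega>. \<phi> n x $ i * pd (axis j 1) \<psi> x) = - (LINT x|lebesgue_on \<Omega>. jacobian (\<phi> n) (at x) $ i $ j * \<psi> x)" for n
      unfolding matrix_component[of "jacobian (\<phi> n) (at _)"]
    proof (rule integration_by_parts[OF \<Omega>(1) order_refl \<Omega>s component_has_derivative[OF smooth_differentiable[OF \<phi>s]] _ \<psi>])
      show "continuous_on \<Omega> (\<lambda>x. (jacobian (\<phi> n) (at x) *v axis j 1) $ i)"
        unfolding matrix_component[symmetric] by (intro continuous_intros continuous_jacobian \<phi>s)
    qed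
    have L: "(\<lambda>n. LINT x|lebesgue_on \<Omega>. \<phi> n x $ i * pd (axis j 1) \<psi> x) \<longlonglongrightarrow> (LINT x|lebesgue_on \<Omega>. w x $ i * pd (axis j 1) \<psi> x)"
    proof (rule integral_dominated_convergence[where w = "\<lambda>x. C * M'"])
      show "(\<lambda>x. w x $ i * pd (axis j 1) \<psi> x) \<in> borel_measurable (lebesgue_on \<Omega>)"
        using wm cm[OF smooth_continuous[OF smooth_pd[OF \<psi>s]]] by (intro borel_measurable_times borel_measurable_vec_nth) auto
      show "(\<lambda>x. \<phi> n x $ i * pd (axis j 1) \<psi> x) \<in> borel_measurable (lebesgue_on \<Omega>)" for n
        by (intro cm continuous_intros smooth_continuous \<phi>s smooth_pd \<psi>s)
      show "AE x in lebesgue_on \<Omega>. (\<lambda>n. \<phi> n x $ i * pd (axis j 1) \<psi> x) \<longlonglongrightarrow> w x $ i * pd (axis j 1) \<psi> x"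
        by (intro AE_I2 tendsto_mult tendsto_const tendsto_vec_nth w)
      show "AE x in lebesgue_on \<Omega>. norm (\<phi> n x $ i * pd (axis j 1) \<psi> x) \<le> C * M'" for n
      proof (rule AE_I2)
        fix x
        have "norm (\<phi> n x $ i) \<le> C" using Finite_Cartesian_Product.norm_nth_le[of "\<phi> n x" i] C(1)[of n x] by linarith
        then show "norm (\<phi> n x $ i * pd (axis j 1) \<psi> x) \<le> C * M'"
          unfolding norm_mult using M'(2)[of x] norm_ge_zero[of "\<phi> n x $ i"] by (intro mult_mono) (auto simp del: norm_ge_zero)
      qed
    qed simp
    have R: "(\<lambda>n. LINT x|lebesgue_on \<Omega>. jacobian (\<phi> n) (at x) $ i $ j * \<psi> x) \<longlonglongrightarrow> (LINT x|lebesgue_on \<Omega>. W x $ i $ j * \<psi> x)"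
    proof (rule integral_dominated_convergence[where w = "\<lambda>x. C * M"])
      show "(\<lambda>x. W x $ i $ j * \<psi> x) \<in> borel_measurable (lebesgue_on \<Omega>)"
        using W(2) cm[OF smooth_continuous[OF \<psi>s]] by (intro borel_measurable_times borel_measurable_vec_nth) auto
      show "(\<lambda>x. jacobian (\<phi> n) (at x) $ i $ j * \<psi> x) \<in> borel_measurable (lebesgue_on \<Omega>)" for n
        by (intro cm continuous_intros smooth_continuous continuous_jacobian \<phi>s \<psi>s)
      show "AE x in lebesgue_on \<Omega>. (\<lambda>n. jacobian (\<phi> n) (at x) $ i $ j * \<psi> x) \<longlonglongrightarrow> W x $ i $ j * \<psi> x"
        using W(1) by (rule eventually_mono) (intro tendsto_mult tendsto_const tendsto_vec_nth)
      show "AE x in lebesgue_on \<Omega>. norm (jacobian (\<phi> n) (at x) $ i $ j * \<psi> x) \<le> C * M" for n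
      proof (rule AE_I2)
        fix x
        have "norm (jacobian (\<phi> n) (at x) $ i $ j) \<le> C"
          using Finite_Cartesian_Product.norm_nth_le[of "jacobian (\<phi> n) (at x) $ i" j]
            Finite_Cartesian_Product.norm_nth_le[of "jacobian (\<phi> n) (at x)" i] C(2)[of n x] by linarith
        then show "norm (jacobian (\<phi> n) (at x) $ i $ j * \<psi> x) \<le> C * M"
          unfolding norm_mult using M(2)[of x] norm_ge_zero[of "jacobian (\<phi> n) (at x) $ i $ j"] by (intro mult_mono) (auto simp del: norm_ge_zero)
      qed
    qed simp
    show "(LINT x|lebesgue_on \<Omega>. w x $ i * pd (axis j 1) \<psi> x) = - (LINT x|lebesgue_on \<Omega>. W x $ i $ j * \<psi> x)"
      using LIMSEQ_unique[OF L[unfolded parts] tendsto_minus[OF R]] .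
  qed
qed

section \<open>The limit of the perturbations\<close>

lemma geometric_limit:
  fixes \<phi> :: "nat \<Rightarrow> 'a \<Rightarrow> 'b::banach"
  assumes "\<And>n x. norm (\<phi> (Suc n) x - \<phi> n x) \<le> e * (1/2)^n"
  obtains w where "\<And>x. (\<lambda>n. \<phi> n x) \<longlonglongrightarrow> w x" "\<And>n x. norm (w x - \<phi> n x) \<le> 2 * e * (1/2)^n"
    "\<And>n k x. norm (\<phi> (n + k) x - \<phi> n x) \<le> 2 * e * (1/2)^n"
proof -
  \<comment> \<open>The subtracted tail of the geometric series lets the induction on
    \<open>k\<close> telescope.\<close>
  have d0: "norm (\<phi> (n + k) x - \<phi> n x) \<le> 2 * e * (1/2)^n - 2 * e * (1/2)^(n + k)" for n k x
  proof (induction k)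
    case (Suc k)
    have "norm (\<phi> (n + Suc k) x - \<phi> n x) \<le> norm (\<phi> (Suc (n + k)) x - \<phi> (n + k) x) + norm (\<phi> (n + k) x - \<phi> n x)"
      using norm_triangle_ineq[of "\<phi> (Suc (n + k)) x - \<phi> (n + k) x" "\<phi> (n + k) x - \<phi> n x"] by simp
    also have "\<dots> \<le> e * (1/2)^(n + k) + (2 * e * (1/2)^n - 2 * e * (1/2)^(n + k))"
      by (intro add_mono assms Suc)
    also have "\<dots> = 2 * e * (1/2)^n - 2 * e * (1/2)^(n + Suc k)" by simp
    finally show ?case .
  qed simp
  have e: "e \<ge> 0" using order_trans[OF norm_ge_zero assms[of 0]] by simp
  have d: "norm (\<phi> (n + k) x - \<phi> n x) \<le> 2 * e * (1/2)^n" for n k x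
  proof -
    have "0 \<le> 2 * e * (1/2)^(n + k)" using e by simp
    then show ?thesis using d0[where n=n and k=k and x=x] by linarith
  qed
  have "Cauchy (\<lambda>n. \<phi> n x)" for x
    unfolding Cauchy_altdef2
  proof (intro allI impI)
    fix r :: real assume r: "r > 0"
    have "(\<lambda>n. 2 * e * (1/2)^n) \<longlonglongrightarrow> 2 * e * 0" by (intro tendsto_intros) auto
    then have "eventually (\<lambda>n. 2 * e * (1/2)^n < r) sequentially" using r by (intro order_tendstoD(2)) auto
    then obtain N where N: "2 * e * (1/2)^N < r" unfolding eventually_sequentially by blast
    have "dist (\<phi> n x) (\<phi> N x) < r" if "n \<ge> N" for n
      using d[of N "n - N" x] that N by (simp add: dist_norm)
    then show "\<exists>N. \<forall>n\<ge>N. dist (\<phi> n x) (\<phi> N x) < r" by blast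
  qed
  then have "\<forall>x. \<exists>l. (\<lambda>n. \<phi> n x) \<longlonglongrightarrow> l" using Cauchy_convergent unfolding convergent_def by blast
  then obtain w where w: "\<And>x. (\<lambda>n. \<phi> n x) \<longlonglongrightarrow> w x" by metis
  have "norm (w x - \<phi> n x) \<le> 2 * e * (1/2)^n" for n x
  proof (rule LIMSEQ_le_const2)
    show "(\<lambda>k. norm (\<phi> (k + n) x - \<phi> n x)) \<longlonglongrightarrow> norm (w x - \<phi> n x)"
      by (intro tendsto_intros LIMSEQ_ignore_initial_segment w)
    show "\<exists>N. \<forall>k\<ge>N. norm (\<phi> (k + n) x - \<phi> n x) \<le> 2 * e * (1/2)^n"
      using d[of n _ x] by (auto simp: add.commute)
  qed
  then show thesis using that w d by blast
qed

context hull_setting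
begin

text \<open>The gradients are eventually constant at every point outside the intersection of the
  sets \<open>Os n\<close>, which is null; \<open>W\<close> is this final value. Outside
  \<open>Os n\<close> nothing changes any more and inside all gradients are bounded, so the
  approximating test functions converge in the norm of \<open>W11_0\<close>. This is what gives zero
  boundary values.\<close>

lemma limit_perturbation:
  assumes \<Omega>: "open \<Omega>" "bounded \<Omega>" and O: "open O0" "O0 \<subseteq> \<Omega>" and J: "continuous_on O0 J" "\<And>x. x \<in> O0 \<Longrightarrow> J x \<in> H"
    and R: "R \<ge> 0" and \<epsilon>: "\<epsilon> > 0"
  obtains w W where "w \<in> W1inf_0 \<Omega>" "has_weak_gradient w W \<Omega>" "w \<in> borel_measurable (lebesgue_on \<Omega>)"
    "\<And>x. norm (w x) \<le> \<epsilon> / 2" "\<And>x. norm (W x) \<le> 2 * R" "AE x in lebesgue. x \<in> O0 \<longrightarrow> J x + W x \<in> U"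
proof -
  have \<Omega>m: "\<Omega> \<in> lmeasurable" using \<Omega> by (intro bounded_set_imp_lmeasurable) auto
  have \<Omega>s: "\<Omega> \<in> sets lebesgue" using \<Omega> by auto
  have bO: "bounded O0" using \<Omega>(2) O(2) by (rule bounded_subset)
  \<comment> \<open>The increments sum up to at most \<open>2 * e\<close>, which is
    \<open>\<epsilon> / 2\<close>.\<close>
  define e where "e = \<epsilon> / 4"
  have e: "e > 0" using \<epsilon> by (simp add: e_def)
  obtain Os :: "nat \<Rightarrow> (real^'n) set" and \<phi> :: "nat \<Rightarrow> real^'n \<Rightarrow> real^'m"
    where Os: "\<And>n. open (Os n)" "\<And>n. Os n \<subseteq> O0" "\<And>n. Os (Suc n) \<subseteq> Os n" "\<And>n. measure lebesgue (Os (Suc n)) \<le> (1/2)^n"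
    and \<phi>0: "\<phi> 0 = (\<lambda>x. 0)" and \<phi>t: "\<And>n. \<phi> n \<in> test_functions O0"
    and step: "\<And>n x. norm (\<phi> (Suc n) x - \<phi> n x) \<le> e * (1/2)^n"
    and fixed: "\<And>n x. x \<notin> Os n \<Longrightarrow> jacobian (\<phi> (Suc n)) (at x) = jacobian (\<phi> n) (at x)"
    and inH: "\<And>n x. x \<in> O0 \<Longrightarrow> J x + jacobian (\<phi> n) (at x) \<in> H"
    and inU: "\<And>n x. x \<in> O0 - Os n \<Longrightarrow> J x + jacobian (\<phi> n) (at x) \<in> U"
    by (rule iteration[OF O(1) bO J e]) (assumption, (rule that; assumption))
  note \<phi>s = test_functions_smooth[OF \<phi>t]
  have \<phi>\<Omega>: "\<phi> n \<in> test_functions \<Omega>" for n by (rule test_functions_mono[OF \<phi>t O(2)])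
  obtain w where w: "\<And>x. (\<lambda>n. \<phi> n x) \<longlonglongrightarrow> w x" "\<And>n x. norm (w x - \<phi> n x) \<le> 2 * e * (1/2)^n"
    "\<And>n k x. norm (\<phi> (n + k) x - \<phi> n x) \<le> 2 * e * (1/2)^n"
    using geometric_limit[of \<phi> e, OF step] by blast
  have \<phi>b: "norm (\<phi> n x) \<le> \<epsilon> / 2" for n x using w(3)[of 0 n x] by (simp add: \<phi>0 e_def)
  have wb: "norm (w x) \<le> \<epsilon> / 2" for x using w(2)[of x 0] by (simp add: \<phi>0 e_def)
  have jb: "norm (jacobian (\<phi> n) (at x)) \<le> 2 * R" for n x
  proof (cases "x \<in> O0")
    case True
    have "norm (jacobian (\<phi> n) (at x)) \<le> norm (J x + jacobian (\<phi> n) (at x)) + norm (J x)"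
      using norm_triangle_ineq4[of "J x + jacobian (\<phi> n) (at x)" "J x"] by simp
    then show ?thesis using H_bound[OF inH[OF True, of n]] H_bound[OF J(2)[OF True]] by linarith
  next
    case False
    then show ?thesis using test_function_off(2)[OF \<phi>t False] R by simp
  qed
  have Osm: "Os n \<in> lmeasurable" for n
    using Os(1) bounded_subset[OF bO Os(2)] by (intro bounded_set_imp_lmeasurable) auto
  have decr: "x \<notin> Os (m + k)" if "x \<notin> Os m" for x m k
    using that by (induction k) (use Os(3) in auto)
  have stable: "jacobian (\<phi> (m + k)) (at x) = jacobian (\<phi> m) (at x)" if x: "x \<notin> Os m" for x m k
    by (induction k) (use fixed[OF decr[OF x]] in auto)
  \<comment> \<open>The indicator makes the sequence converge at every point, to 0 on the
    exceptional null set. Thus \<open>W\<close> is a limit of measurable functions everywhere and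
    bounded everywhere.\<close>
  define g where "g n x = indicator (- Os n) x *\<^sub>R jacobian (\<phi> n) (at x)" for n x
  define W where "W x = lim (\<lambda>n. g n x)" for x
  have gW: "(\<lambda>n. g n x) \<longlonglongrightarrow> jacobian (\<phi> m) (at x)" if x: "x \<notin> Os m" for m x
  proof (rule tendsto_eventually)
    have "g n x = jacobian (\<phi> m) (at x)" if "n \<ge> m" for n
      using decr[OF x, of "n - m"] stable[OF x, of "n - m"] that by (simp add: g_def)
    then show "eventually (\<lambda>n. g n x = jacobian (\<phi> m) (at x)) sequentially"
      unfolding eventually_sequentially by blast
  qed
  have g0: "(\<lambda>n. g n x) \<longlonglongrightarrow> 0" if "\<And>m. x \<in> Os m" for x
    using that by (simp add: g_def)
  have W1: "W x = jacobian (\<phi> m) (at x)" if "x \<notin> Os m" for m x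
    unfolding W_def by (rule limI[OF gW[OF that]])
  have W0: "W x = 0" if "\<And>m. x \<in> Os m" for x
    unfolding W_def by (rule limI[OF g0[OF that]])
  have Wlim: "(\<lambda>n. g n x) \<longlonglongrightarrow> W x" for x
  proof (cases "\<exists>m. x \<notin> Os m")
    case True
    then obtain m where "x \<notin> Os m" by blast
    then show ?thesis using gW W1 by metis
  next
    case False
    then have "\<And>m. x \<in> Os m" by blast
    then show ?thesis using g0 W0 by metis
  qed
  have Wb: "norm (W x) \<le> 2 * R" for x
  proof (cases "\<exists>m. x \<notin> Os m")
    case True
    then obtain m where "x \<notin> Os m" by blast
    then show ?thesis using W1 jb by metis
  next
    case False
    then have "\<And>m. x \<in> Os m" by blast
    then show ?thesis using W0[of x] R by simp
  qed
  have Wm: "W \<in> borel_measurable (lebesgue_on \<Omega>)"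
  proof (rule borel_measurable_LIMSEQ_metric[OF _ Wlim])
    fix n
    have "(\<lambda>x. jacobian (\<phi> n) (at x)) \<in> borel_measurable (lebesgue_on \<Omega>)"
      by (rule continuous_imp_measurable_on_sets_lebesgue[OF continuous_jacobian[OF \<phi>s] \<Omega>s])
    moreover have "{x \<in> space (lebesgue_on \<Omega>). x \<in> - Os n} \<in> sets (lebesgue_on \<Omega>)"
    proof -
      have "- Os n \<inter> \<Omega> \<in> sets lebesgue" using Os(1)[of n] \<Omega>(1) by (intro sets.Int) auto
      moreover have "{x \<in> space (lebesgue_on \<Omega>). x \<in> - Os n} = - Os n \<inter> \<Omega>" by auto
      ultimately show ?thesis using \<Omega>s by (simp add: sets_restrict_space_iff)
    qed
    ultimately show "g n \<in> borel_measurable (lebesgue_on \<Omega>)"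
      unfolding g_def by (intro borel_measurable_scaleR borel_measurable_indicator')
  qed
  have null: "AE x in lebesgue. \<exists>m. x \<notin> Os m"
  proof -
    have "\<exists>T. (\<Inter>m. Os m) \<subseteq> T \<and> T \<in> lmeasurable \<and> measure lebesgue T \<le> r" if r: "r > 0" for r
    proof -
      obtain n where "(1/2)^n < r" using real_arch_pow_inv[OF r, of "1/2"] by auto
      then show ?thesis using Os(4)[of n] Osm[of "Suc n"] by (intro exI[of _ "Os (Suc n)"]) auto
    qed
    then have "negligible (\<Inter>m. Os m)" unfolding negligible_outer_le by blast
    then have "(\<Inter>m. Os m) \<in> null_sets lebesgue" by (simp add: negligible_iff_null_sets)
    then show ?thesis by (rule AE_I') auto
  qed
  have conv: "AE x in lebesgue_on \<Omega>. (\<lambda>n. jacobian (\<phi> n) (at x)) \<longlonglongrightarrow> W x"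
  proof -
    have "AE x in lebesgue. x \<in> \<Omega> \<longrightarrow> (\<lambda>n. jacobian (\<phi> n) (at x)) \<longlonglongrightarrow> W x"
      using null
    proof (rule eventually_mono, intro impI)
      fix x assume "\<exists>m. x \<notin> Os m"
      then obtain m where m: "x \<notin> Os m" by blast
      have "jacobian (\<phi> n) (at x) = W x" if "n \<ge> m" for n
        using stable[OF m, of "n - m"] W1[OF m] that by simp
      then show "(\<lambda>n. jacobian (\<phi> n) (at x)) \<longlonglongrightarrow> W x"
        by (intro tendsto_eventually) (auto simp: eventually_sequentially)
    qed
    then show ?thesis using \<Omega>s by (simp add: AE_restrict_space_iff)
  qed
  define C where "C = max (\<epsilon> / 2) (2 * R)"
  have C: "norm (\<phi> n x) \<le> C" "norm (jacobian (\<phi> n) (at x)) \<le> C" "norm (W x) \<le> C" for n x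
    unfolding C_def using \<phi>b[of n x] jb[of n x] Wb[of x] by auto
  note lim = weak_gradient_limit[OF \<Omega> \<phi>\<Omega> C(1,2) w(1) conv Wm C(3)]
  interpret finite_measure "lebesgue_on \<Omega>" by (rule finite_measure_lebesgue_on[OF \<Omega>m])
  have wL: "w \<in> Linf \<Omega>" by (rule LinfI(1)[OF lim(1) AE_I2[OF wb]])
  have WL: "W \<in> Linf \<Omega>" by (rule LinfI(1)[OF Wm AE_I2[OF Wb]])
  have iw: "integrable (lebesgue_on \<Omega>) w" by (rule integrable_const_bound[OF AE_I2[OF wb] lim(1)])
  have iW: "integrable (lebesgue_on \<Omega>) W" by (rule integrable_const_bound[OF AE_I2[OF Wb] Wm])
  have em: "emeasure (lebesgue_on \<Omega>) S = ennreal (measure lebesgue S)" if "S \<subseteq> \<Omega>" "S \<in> lmeasurable" for S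
    using that \<Omega>s by (simp add: emeasure_restrict_space emeasure_eq_measure2)
  have approx: "\<exists>\<psi>\<in>test_functions \<Omega>. (\<integral>\<^sup>+x. ennreal (norm (w x - \<psi> x)) \<partial>lebesgue_on \<Omega>) +
           (\<integral>\<^sup>+x. ennreal (norm (W x - jacobian \<psi> (at x))) \<partial>lebesgue_on \<Omega>) < ennreal r" if r: "r > 0" for r
  proof -
    \<comment> \<open>The first summand stems from the values; the second from the gradients, which
      differ by at most \<open>4 * R\<close>, and only on \<open>Os (Suc n)\<close>. The volume
      bound \<open>(1/2)^n\<close> belongs to index \<open>Suc n\<close>, hence
      \<open>?k\<close>.\<close>
    define M where "M = 2 * e * measure lebesgue \<Omega> + 4 * R"
    have "(\<lambda>n. M * (1/2)^n) \<longlonglongrightarrow> M * 0" by (intro tendsto_intros) auto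
    then have "eventually (\<lambda>n. M * (1/2)^n < r) sequentially" using r by (intro order_tendstoD(2)) auto
    then obtain n where n: "M * (1/2)^n < r" unfolding eventually_sequentially by blast
    let ?k = "Suc n"
    have "(\<integral>\<^sup>+x. ennreal (norm (w x - \<phi> ?k x)) \<partial>lebesgue_on \<Omega>) \<le> (\<integral>\<^sup>+x. ennreal (2 * e * (1/2)^?k) \<partial>lebesgue_on \<Omega>)"
      by (intro nn_integral_mono ennreal_leI w(2))
    also have "\<dots> = ennreal (2 * e * (1/2)^?k) * ennreal (measure lebesgue \<Omega>)"
      using em[OF order_refl \<Omega>m] by simp
    also have "\<dots> = ennreal (2 * e * (1/2)^?k * measure lebesgue \<Omega>)"
      using e by (intro ennreal_mult[symmetric]) auto
    also have "\<dots> \<le> ennreal (2 * e * measure lebesgue \<Omega> * (1/2)^n)"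
      using e by (intro ennreal_leI) (simp add: mult_ac)
    finally have 1: "(\<integral>\<^sup>+x. ennreal (norm (w x - \<phi> ?k x)) \<partial>lebesgue_on \<Omega>) \<le> ennreal (2 * e * measure lebesgue \<Omega> * (1/2)^n)" .
    have pt: "norm (W x - jacobian (\<phi> ?k) (at x)) \<le> 4 * R * indicator (Os ?k) x" for x
    proof (cases "x \<in> Os ?k")
      case True
      then show ?thesis using norm_triangle_ineq4[of "W x" "jacobian (\<phi> ?k) (at x)"] Wb[of x] jb[of ?k x] by simp
    next
      case False
      then show ?thesis using W1[OF False] by simp
    qed
    have OsS: "Os ?k \<subseteq> \<Omega>" using Os(2)[of ?k] O(2) by blast
    have Oss: "Os ?k \<in> sets (lebesgue_on \<Omega>)"
      using fmeasurableD[OF Osm[of ?k]] OsS \<Omega>s by (simp add: sets_restrict_space_iff)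
    have "(\<integral>\<^sup>+x. ennreal (norm (W x - jacobian (\<phi> ?k) (at x))) \<partial>lebesgue_on \<Omega>)
        \<le> (\<integral>\<^sup>+x. ennreal (4 * R) * indicator (Os ?k) x \<partial>lebesgue_on \<Omega>)"
    proof (rule nn_integral_mono)
      fix x
      have "ennreal (norm (W x - jacobian (\<phi> ?k) (at x))) \<le> ennreal (4 * R * indicator (Os ?k) x)"
        by (rule ennreal_leI[OF pt])
      also have "\<dots> = ennreal (4 * R) * indicator (Os ?k) x" by (simp add: indicator_def)
      finally show "ennreal (norm (W x - jacobian (\<phi> ?k) (at x))) \<le> ennreal (4 * R) * indicator (Os ?k) x" .
    qed
    also have "\<dots> = ennreal (4 * R) * ennreal (measure lebesgue (Os ?k))"
      unfolding nn_integral_cmult_indicator[OF Oss] em[OF OsS Osm] ..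
    also have "\<dots> = ennreal (4 * R * measure lebesgue (Os ?k))" using R by (intro ennreal_mult[symmetric]) auto
    also have "\<dots> \<le> ennreal (4 * R * (1/2)^n)" using R Os(4)[of n] by (intro ennreal_leI mult_left_mono) auto
    finally have 2: "(\<integral>\<^sup>+x. ennreal (norm (W x - jacobian (\<phi> ?k) (at x))) \<partial>lebesgue_on \<Omega>) \<le> ennreal (4 * R * (1/2)^n)" .
    have "ennreal (2 * e * measure lebesgue \<Omega> * (1/2)^n) + ennreal (4 * R * (1/2)^n) = ennreal (M * (1/2)^n)"
      using e R by (subst ennreal_plus[symmetric]) (auto simp: M_def algebra_simps)
    also have "\<dots> < ennreal r" using n r by (simp add: ennreal_less_iff ennreal_lessI)
    finally show ?thesis using add_mono[OF 1 2] \<phi>\<Omega>[of ?k] by (intro bexI[of _ "\<phi> ?k"]) (rule le_less_trans)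
  qed
  have "w \<in> W1inf \<Omega>" unfolding W1inf_def using wL WL lim(2) by blast
  moreover have "w \<in> W11_0 \<Omega>" unfolding W11_0_def using iw iW lim(2) approx by blast
  ultimately have w0: "w \<in> W1inf_0 \<Omega>" by (simp add: W1inf_0_def)
  have "AE x in lebesgue. x \<in> O0 \<longrightarrow> J x + W x \<in> U"
    using null
  proof (rule eventually_mono, intro impI)
    fix x assume "\<exists>m. x \<notin> Os m" and x: "x \<in> O0"
    then obtain m where m: "x \<notin> Os m" by blast
    show "J x + W x \<in> U" unfolding W1[OF m] using inU[of x m] m x by blast
  qed
  then show thesis by (rule that[OF w0 lim(2,1) wb Wb])
qed

end

text \<open>The limit perturbation needs a continuous gradient with values in \<open>H\<close> on an
  open set, whereas \<open>Dv\<close> is only known almost everywhere. The classical Jacobian on the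
  pieces of \<open>v\<close> provides it: it agrees with \<open>Dv\<close> almost everywhere, and it
  lies in the relatively open \<open>H\<close> on an open set \<open>O0\<close> of full measure. The
  solution is \<open>v\<close> plus the limit perturbation on \<open>O0\<close>.\<close>

theorem theorem1p1:
  fixes \<Omega> :: "(real^'n) set"
    and L :: "real^'n^'m"
    and t :: real
    and \<Sigma> U :: "(real^'n^'m) set"
    and v :: "real^'n \<Rightarrow> real^'m"
    and Dv :: "real^'n \<Rightarrow> real^'n^'m"
    and \<epsilon> :: real
  assumes "CARD('m) \<ge> 2" and "CARD('n) \<ge> 2"
    and "bounded_lipschitz_domain \<Omega>"
    and "L \<noteq> 0"
    and "\<Sigma> = {\<xi>. (\<Sum>i\<in>UNIV. \<Sum>j\<in>UNIV. L $ i $ j * \<xi> $ i $ j) = t}"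
    and "\<forall>b. b \<noteq> 0 \<longrightarrow> L *v b \<noteq> 0"
    and "bounded U" and "openin (top_of_set \<Sigma>) U"
    and "v \<in> W1inf \<Omega>" and "piecewise_C1 \<Omega> v"
    and "has_weak_gradient v Dv \<Omega>"
    and "AE x in lebesgue_on \<Omega>. Dv x \<in> rc_hull U"
    and "\<epsilon> > 0"
  shows "\<exists>u \<in> W1inf \<Omega>. \<exists>Du. has_weak_gradient u Du \<Omega> \<and>
           (AE x in lebesgue_on \<Omega>. Du x \<in> U) \<and>
           (\<lambda>x. u x - v x) \<in> W1inf_0 \<Omega> \<and>
           Linf_norm \<Omega> (\<lambda>x. u x - v x) < ereal \<epsilon>"
proof -
  have \<Omega>: "open \<Omega>" "bounded \<Omega>" using assms(3) by (auto simp: bounded_lipschitz_domain_def)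
  have \<Omega>s: "\<Omega> \<in> sets lebesgue" and \<Omega>m: "\<Omega> \<in> lmeasurable" using \<Omega> by (auto intro: bounded_set_imp_lmeasurable)
  obtain R where R: "R \<ge> 0" "\<And>x. x \<in> U \<Longrightarrow> norm x \<le> R"
    using assms(7) unfolding bounded_pos by (metis less_imp_le)
  have \<Sigma>: "\<Sigma> = {x. L \<bullet> x = t}" unfolding assms(5) by (simp add: inner_vec_def)
  interpret hull_setting L t R U
    by unfold_locales (use assms(6) R(2) assms(8) \<Sigma> in auto)
  obtain A :: "nat \<Rightarrow> (real^'n) set" where A: "\<And>j. open (A j)" "\<And>j. A j \<subseteq> \<Omega>"
    "emeasure lebesgue (\<Union>j. A j) = emeasure lebesgue \<Omega>" "\<And>j. C1_closure (A j) v"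
    using assms(10) unfolding piecewise_C1_def by blast
  let ?J = "\<lambda>x. jacobian v (at x)"
  define O1 where "O1 = (\<Union>j. A j)"
  have O1: "open O1" "O1 \<subseteq> \<Omega>" unfolding O1_def using A(1,2) by auto
  have diff: "v differentiable (at x)" if "x \<in> O1" for x
    using that A(4) unfolding O1_def C1_closure_def by blast
  have contA: "continuous_on (A j) ?J" for j
  proof -
    obtain G where G: "continuous_on (closure (A j)) G" "\<And>x. x \<in> A j \<Longrightarrow> G x = ?J x"
      using A(4)[of j] unfolding C1_closure_def by blast
    show ?thesis by (rule continuous_on_eq[OF continuous_on_subset[OF G(1) closure_subset] G(2)])
  qed
  have cont: "continuous_on O1 ?J" unfolding O1_def by (rule continuous_on_open_UN) (use A(1) contA in auto)
  have full: "AE x in lebesgue. x \<in> \<Omega> \<longrightarrow> x \<in> O1"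
  proof -
    have O1m: "O1 \<in> lmeasurable" using O1(1) bounded_subset[OF \<Omega>(2) O1(2)] by (intro bounded_set_imp_lmeasurable) auto
    have "emeasure lebesgue (\<Omega> - O1) = emeasure lebesgue \<Omega> - emeasure lebesgue O1"
      using fmeasurableD2[OF O1m] fmeasurableD[OF O1m] \<Omega>s O1(2) by (intro emeasure_Diff) auto
    also have "\<dots> = 0" using A(3) fmeasurableD2[OF O1m] unfolding O1_def by simp
    finally have "\<Omega> - O1 \<in> null_sets lebesgue" using \<Omega>s fmeasurableD[OF O1m] by (intro null_setsI) auto
    then show ?thesis by (rule AE_I') auto
  qed
  have classical: "AE x in lebesgue. x \<in> O1 \<longrightarrow> Dv x = ?J x"
    by (rule weak_gradient_classical[OF \<Omega>(1) O1 assms(11) diff cont])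
  have DvH: "AE x in lebesgue. x \<in> \<Omega> \<longrightarrow> Dv x \<in> H"
  proof -
    have "AE x in lebesgue. x \<in> \<Omega> \<longrightarrow> Dv x \<in> rc_hull U"
      using assms(12) \<Omega>s by (simp add: AE_restrict_space_iff)
    then show ?thesis by (rule eventually_mono) (use rc_hull_subset_H in blast)
  qed
  \<comment> \<open>Everywhere in \<open>O1\<close> and not just almost everywhere: by continuity
    the exceptional set is open, and an open null set is empty.\<close>
  have JSg: "?J x \<in> Sg" if x: "x \<in> O1" for x
  proof (rule ccontr)
    assume nx: "?J x \<notin> Sg"
    let ?N = "O1 \<inter> ?J -` (- Sg)"
    have oN: "open ?N" by (rule continuous_open_preimage[OF cont O1(1)]) (use closed_Sg in auto)
    have "AE x in lebesgue. x \<notin> ?N"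
      using classical DvH
    proof eventually_elim
      case (elim x)
      then show ?case using O1(2) H_subset by auto
    qed
    then have "?N \<in> null_sets lebesgue" using oN AE_iff_null_sets[of ?N lebesgue] by auto
    then have "negligible ?N" by (simp add: negligible_iff_null_sets)
    then have "?N = {}" using open_not_negligible[OF oN] by blast
    then show False using x nx by blast
  qed
  define O0 where "O0 = {x \<in> O1. ?J x \<in> H}"
  have "openin (top_of_set Sg) H"
    unfolding openin_euclidean_subtopology_iff using H_subset H_nbhd by blast
  then obtain V where V: "open V" "H = Sg \<inter> V" unfolding openin_open by blast
  \<comment> \<open>Relative openness of \<open>H\<close> is enough here, since the Jacobian takes
    all its values in \<open>Sg\<close>.\<close>
  have "O0 = O1 \<inter> ?J -` V" using JSg V(2) unfolding O0_def by blast
  then have O0: "open O0" using continuous_open_preimage[OF cont O1(1) V(1)] by simp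
  have O01: "O0 \<subseteq> O1" by (auto simp: O0_def)
  have J0: "continuous_on O0 ?J" "\<And>x. x \<in> O0 \<Longrightarrow> ?J x \<in> H"
    using continuous_on_subset[OF cont O01] by (auto simp: O0_def)
  obtain w W where w: "w \<in> W1inf_0 \<Omega>" "has_weak_gradient w W \<Omega>" "w \<in> borel_measurable (lebesgue_on \<Omega>)"
    "\<And>x. norm (w x) \<le> \<epsilon> / 2" "\<And>x. norm (W x) \<le> 2 * R" "AE x in lebesgue. x \<in> O0 \<longrightarrow> ?J x + W x \<in> U"
    by (rule limit_perturbation[OF \<Omega> O0 order_trans[OF O01 O1(2)] J0 R(1) assms(13)]) (assumption, (rule that; assumption))
  define u where "u x = v x + w x" for x
  define Du where "Du x = Dv x + W x" for x
  have uG: "has_weak_gradient u Du \<Omega>"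
    unfolding u_def Du_def by (rule has_weak_gradient_add[OF \<Omega>s assms(11) w(2)])
  have DuU: "AE x in lebesgue_on \<Omega>. Du x \<in> U"
  proof -
    have "AE x in lebesgue. x \<in> \<Omega> \<longrightarrow> Du x \<in> U"
      using full classical DvH w(6)
    proof eventually_elim
      case (elim x)
      then show ?case by (auto simp: O0_def Du_def)
    qed
    then show ?thesis using \<Omega>s by (simp add: AE_restrict_space_iff)
  qed
  have uL: "u \<in> Linf \<Omega>"
  proof -
    have "v \<in> Linf \<Omega>" using assms(9) by (simp add: W1inf_def)
    then obtain C where C: "AE x in lebesgue_on \<Omega>. norm (v x) \<le> C" "v \<in> borel_measurable (lebesgue_on \<Omega>)"
      by (rule LinfE)
    have "AE x in lebesgue_on \<Omega>. norm (u x) \<le> C + \<epsilon> / 2"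
      using C(1)
    proof (rule eventually_mono)
      fix x assume "norm (v x) \<le> C"
      then show "norm (u x) \<le> C + \<epsilon> / 2"
        using norm_triangle_ineq[of "v x" "w x"] w(4)[of x] unfolding u_def by linarith
    qed
    moreover have "u \<in> borel_measurable (lebesgue_on \<Omega>)"
      unfolding u_def using C(2) w(3) by (rule borel_measurable_add)
    ultimately show ?thesis by (intro LinfI(1))
  qed
  have DuL: "Du \<in> Linf \<Omega>"
  proof (rule LinfI(1))
    \<comment> \<open>\<open>Dv\<close> is an arbitrary weak gradient of \<open>v\<close>:
      measurability of the sum comes from its local integrability, and its bound from the values in
      \<open>U\<close>.\<close>
    show "Du \<in> borel_measurable (lebesgue_on \<Omega>)"
      using locally_integrable_measurable[OF \<Omega>(1)] uG unfolding has_weak_gradient_def by blast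
    show "AE x in lebesgue_on \<Omega>. norm (Du x) \<le> R"
      using DuU by (rule eventually_mono) (rule R(2))
  qed
  have "u \<in> W1inf \<Omega>" unfolding W1inf_def using uL DuL uG by blast
  moreover have eq: "(\<lambda>x. u x - v x) = w" by (simp add: u_def fun_eq_iff)
  moreover have "Linf_norm \<Omega> w < ereal \<epsilon>"
  proof (rule le_less_trans)
    show "Linf_norm \<Omega> w \<le> ereal (\<epsilon> / 2)" by (rule LinfI(2)[OF w(3) AE_I2[OF w(4)]])
    show "ereal (\<epsilon> / 2) < ereal \<epsilon>" using assms(13) by simp
  qed
  ultimately show ?thesis using uG DuU w(1) by (intro bexI[of _ u] exI[of _ Du]) auto
qed

end
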